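(* Let $\kappa>0$ and let $\alpha:\mathbb{R}\to\mathbb{R}$ satisfy Conditions C1 and C2 (see context). Let $s>1/2$ and let $f\in C^{[s]+1}(\mathbb{R})$ with $f(0)=0$. Then for every $\varphi\in H^{s}(\mathbb{R})$ there is some $T>0$ such that the initial-value problem $$u_t+\alpha'\ast f(u)+\kappa\,\alpha'''\ast u=0,\quad x\in\mathbb{R},\ t>0,\qquad u(x,0)=\varphi(x),$$ is locally well-posed with solution $u\in C^{1}([0,T],H^{s}(\mathbb{R}))$, and the solution satisfies $$\|u(t)\|_{H^s}\le \|\varphi\|_{H^s}e^{Ct},\qquad 0\le t\le T,$$ where $C$ depends only on $M=\sup_{0\le t\le T}\|u(t)\|_{L^\infty}$ and on $\alpha$.
   Context: Convolution: $(\alpha\ast v)(x)=\int_{\mathbb{R}}\alpha(x-y)v(y)\,dy$; for a finite Borel measure $\mu$, $(\mu\ast v)(x)=\int_{\mathbb{R}} v(x-y)\,d\mu(y)$. Condition C1: $\alpha\in W^{2,1}(\mathbb{R})$. Condition C2: the distributional third derivative $\alpha'''=\mu$ is a finite Borel measure on $\mathbb{R}$ (so $\alpha'''\ast u$ means $\mu\ast u$). $H^s(\mathbb{R})$ is the $L^2$-based Sobolev space of index $s$, $W^{k,p}$ the $L^p$-based Sobolev space, and $[s]$ is the largest integer $\le s$.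
   Formalization: The constant C is a function of M that may depend on the fixed data f, κ and s as well as on α (not on φ or T); a C depending only on M and α is impossible, as f(u)=λu with non-even α and λ large shows. *)

theory Defs
  imports "HOL-Analysis.Analysis" "HOL-Probability.Essential_Supremum"
begin

definition test_fun :: "(real \<Rightarrow> real) \<Rightarrow> bool" where
  "test_fun \<psi> \<longleftrightarrow> (\<forall>k x. ((deriv ^^ k) \<psi>) differentiable (at x)) \<and>
                   (\<exists>R. \<forall>x. R < \<bar>x\<bar> \<longrightarrow> \<psi> x = 0)"

definition weak_deriv :: "(real \<Rightarrow> real) \<Rightarrow> (real \<Rightarrow> real) \<Rightarrow> bool" where
  "weak_deriv h g \<longleftrightarrow> (\<forall>\<psi>. test_fun \<psi> \<longrightarrow>
      integrable lborel (\<lambda>x. h x * deriv \<psi> x) \<and> integrable lborel (\<lambda>x. g x * \<psi> x) \<and>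
      (LINT x|lborel. h x * deriv \<psi> x) = - (LINT x|lborel. g x * \<psi> x))"

definition W21_with :: "(real \<Rightarrow> real) \<Rightarrow> (real \<Rightarrow> real) \<Rightarrow> (real \<Rightarrow> real) \<Rightarrow> bool" where
  "W21_with a a1 a2 \<longleftrightarrow> integrable lborel a \<and> integrable lborel a1 \<and> integrable lborel a2 \<and>
      weak_deriv a a1 \<and> weak_deriv a1 a2"

text \<open>A finite signed Borel measure is represented as mu_p - mu_n (Jordan decomposition)
  with mu_p, mu_n finite (nonnegative) Borel measures on the reals.\<close>
definition finite_borel_measure :: "real measure \<Rightarrow> bool" where
  "finite_borel_measure m \<longleftrightarrow> sets m = sets borel \<and> finite_measure m"

definition deriv_is_measure :: "(real \<Rightarrow> real) \<Rightarrow> real measure \<Rightarrow> real measure \<Rightarrow> bool" where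
  "deriv_is_measure h mp mn \<longleftrightarrow> finite_borel_measure mp \<and> finite_borel_measure mn \<and>
     (\<forall>\<psi>. test_fun \<psi> \<longrightarrow> integrable lborel (\<lambda>x. h x * deriv \<psi> x) \<and>
        - (LINT x|lborel. h x * deriv \<psi> x) = (LINT x|mp. \<psi> x) - (LINT x|mn. \<psi> x))"

definition conv :: "(real \<Rightarrow> real) \<Rightarrow> (real \<Rightarrow> real) \<Rightarrow> real \<Rightarrow> real" where
  "conv a v x = (LINT y|lborel. a (x - y) * v y)"

definition mconv :: "real measure \<Rightarrow> real measure \<Rightarrow> (real \<Rightarrow> real) \<Rightarrow> real \<Rightarrow> real" where
  "mconv mp mn v x = (LINT y|mp. v (x - y)) - (LINT y|mn. v (x - y))"

definition fourier :: "(real \<Rightarrow> real) \<Rightarrow> real \<Rightarrow> complex" where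
  "fourier \<psi> \<xi> = (LINT x|lborel. complex_of_real (\<psi> x) * cis (- (x * \<xi>)))"

definition is_fourier :: "(real \<Rightarrow> real) \<Rightarrow> (real \<Rightarrow> complex) \<Rightarrow> bool" where
  "is_fourier u g \<longleftrightarrow> g \<in> borel_measurable lborel \<and> (\<forall>\<psi>. test_fun \<psi> \<longrightarrow>
      integrable lborel (\<lambda>x. complex_of_real (u x) * fourier \<psi> x) \<and>
      integrable lborel (\<lambda>\<xi>. g \<xi> * complex_of_real (\<psi> \<xi>)) \<and>
      (LINT x|lborel. complex_of_real (u x) * fourier \<psi> x) =
      (LINT \<xi>|lborel. g \<xi> * complex_of_real (\<psi> \<xi>)))"

definition in_Hs :: "real \<Rightarrow> (real \<Rightarrow> real) \<Rightarrow> bool" where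
  "in_Hs s u \<longleftrightarrow> u \<in> borel_measurable lborel \<and> integrable lborel (\<lambda>x. (u x)\<^sup>2) \<and>
     (\<exists>g. is_fourier u g \<and> integrable lborel (\<lambda>\<xi>. (1 + \<xi>\<^sup>2) powr s * (cmod (g \<xi>))\<^sup>2))"

definition fourier_rep :: "(real \<Rightarrow> real) \<Rightarrow> real \<Rightarrow> complex" where
  "fourier_rep u = (SOME g. is_fourier u g)"

definition Hs_norm :: "real \<Rightarrow> (real \<Rightarrow> real) \<Rightarrow> real" where
  "Hs_norm s u = sqrt (LINT \<xi>|lborel. (1 + \<xi>\<^sup>2) powr s * (cmod (fourier_rep u \<xi>))\<^sup>2)"

definition Linf_norm :: "(real \<Rightarrow> real) \<Rightarrow> real" where
  "Linf_norm v = real_of_ereal (esssup lborel (\<lambda>x. ereal \<bar>v x\<bar>))"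

definition C_n :: "nat \<Rightarrow> (real \<Rightarrow> real) \<Rightarrow> bool" where
  "C_n n f \<longleftrightarrow> (\<forall>k<n. \<forall>x. ((deriv ^^ k) f) differentiable (at x)) \<and>
               continuous_on UNIV ((deriv ^^ n) f)"

definition Hs_cont_on :: "real \<Rightarrow> real \<Rightarrow> (real \<Rightarrow> real \<Rightarrow> real) \<Rightarrow> bool" where
  "Hs_cont_on s T u \<longleftrightarrow> (\<forall>t\<in>{0..T}. in_Hs s (u t) \<and>
      ((\<lambda>\<tau>. Hs_norm s (\<lambda>x. u \<tau> x - u t x)) \<longlongrightarrow> 0) (at t within {0..T}))"

definition Hs_deriv_on :: "real \<Rightarrow> real \<Rightarrow> (real \<Rightarrow> real \<Rightarrow> real) \<Rightarrow> (real \<Rightarrow> real \<Rightarrow> real) \<Rightarrow> bool" where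
  "Hs_deriv_on s T u u' \<longleftrightarrow> (\<forall>t\<in>{0..T}.
      ((\<lambda>\<tau>. Hs_norm s (\<lambda>x. (u \<tau> x - u t x) / (\<tau> - t) - u' t x)) \<longlongrightarrow> 0) (at t within {0..T}))"

definition is_solution ::
  "real \<Rightarrow> real \<Rightarrow> (real \<Rightarrow> real) \<Rightarrow> real measure \<Rightarrow> real measure \<Rightarrow> (real \<Rightarrow> real) \<Rightarrow>
   (real \<Rightarrow> real) \<Rightarrow> real \<Rightarrow> (real \<Rightarrow> real \<Rightarrow> real) \<Rightarrow> bool" where
  "is_solution s \<kappa> a1 mp mn f \<phi> T u \<longleftrightarrow>
     (\<exists>u'. Hs_cont_on s T u \<and> Hs_cont_on s T u' \<and> Hs_deriv_on s T u u' \<and>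
        (\<forall>t\<in>{0<..T}. AE x in lborel.
            u' t x + conv a1 (\<lambda>y. f (u t y)) x + \<kappa> * mconv mp mn (u t) x = 0)) \<and>
     (AE x in lborel. u 0 x = \<phi> x)"

end

theory Submission
  imports Defs "HOL-Probability.Probability"
begin

text \<open>
  On the Fourier side \<open>H\<^sup>s\<close> is a weighted \<open>L\<^sup>2\<close> space, and the initial-value problem becomes an
  ordinary differential equation \<open>w' = G w\<close> in the Hilbert space \<open>L\<^sup>2\<close>. Since \<open>\<alpha>'''\<close> is a finite
  measure, \<open>(1 + \<xi>\<^sup>2)\<close> times the Fourier transform of \<open>\<alpha>'\<close> is bounded: convolution with \<open>\<alpha>'\<close> gains
  two derivatives. So \<open>u \<mapsto> f(u)\<close> only has to be a locally Lipschitz map from \<open>H\<^sup>s\<close> to \<open>H\<^sup>m\<close> with the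
  integer \<open>m = max 0 (\<lceil>s\<rceil> - 2)\<close>, for which \<open>f \<in> C\<^bsup>[s]+1\<^esup>\<close> suffices by Faa di Bruno's formula.
  Picard iteration and Gronwall's inequality then give existence, uniqueness and continuous
  dependence. The growth estimate needs \<open>\<parallel>f(u)\<parallel> \<le> C(\<parallel>u\<parallel>\<^sub>\<infinity>) \<parallel>u\<parallel>\<close> with the norms of \<open>H\<^sup>m\<close> and \<open>H\<^sup>s\<close>; as
  \<open>m + 1 < s\<close>, it follows from a pointwise interpolation inequality on unit intervals followed by
  averaging over the intervals, without Gagliardo--Nirenberg inequalities.
\<close>

section \<open>The Hilbert space of square integrable functions\<close>

text \<open>The Lipschitz constants behind existence may depend on the full norm of the data, but
  the exponent of the growth estimate may see the solution through its sup norm only, and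
  \<open>\<Phi>\<close> is fixed before the datum. A term of order \<open>m\<close> in Faa di
  Bruno's formula with \<open>r\<close> factors has derivative orders adding up to \<open>m\<close>.
  Interpolating every factor at one common scale \<open>h\<close> bounds the product by a constant
  times \<open>a ^ r / h ^ m\<close>, where \<open>a\<close> is the local size of \<open>u\<close>;
  the choice \<open>h ^ m = a / B\<close> makes this \<open>a ^ (r - 1) * B\<close>, linear in the
  bound \<open>B\<close> on \<open>u\<close> and its derivative of order \<open>m\<close>. The
  passage from suprema over windows to \<open>L\<^sup>2\<close> norms costs one derivative. So
  \<open>m\<close> has to meet two opposite demands: \<open>s - 2 \<le> m\<close>, for the two
  gained derivatives to restore order \<open>s\<close>, and \<open>m + 1 < s\<close>, for the lost
  derivative to be available. Rounding \<open>s\<close> up meets both when \<open>s > 2\<close>; for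
  \<open>s \<le> 2\<close> the Lipschitz bound \<open>\<bar>f(u)\<bar> \<le> A \<bar>u\<bar>\<close>
  suffices.\<close>

definition sq_int :: "(real \<Rightarrow> complex) \<Rightarrow> bool" where
  "sq_int h \<longleftrightarrow> h \<in> borel_measurable borel \<and> integrable lborel (\<lambda>x. (cmod (h x))\<^sup>2)"

lemma sq_int_measurable [measurable_dest]: "sq_int h \<Longrightarrow> h \<in> borel_measurable borel"
  by (simp add: sq_int_def)

lemma sq_intD: "sq_int h \<Longrightarrow> integrable lborel (\<lambda>x. (cmod (h x))\<^sup>2)"
  by (simp add: sq_int_def)

lemma sq_int_0 [simp]: "sq_int (\<lambda>_. 0)"
  by (simp add: sq_int_def)

lemma sq_int_bound:
  assumes "integrable lborel b" and [measurable]: "h \<in> borel_measurable borel"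
    and "AE x in lborel. (cmod (h x))\<^sup>2 \<le> b x"
  shows "sq_int h"
  unfolding sq_int_def
proof
  show "integrable lborel (\<lambda>x. (cmod (h x))\<^sup>2)"
    by (rule Bochner_Integration.integrable_bound[OF assms(1)]) (use assms(3) in auto)
qed (rule assms)

lemma sq_int_mono:
  assumes "sq_int g" "h \<in> borel_measurable borel" "\<And>x. cmod (h x) \<le> c * cmod (g x)"
  shows "sq_int h"
proof (rule sq_int_bound)
  show "integrable lborel (\<lambda>x. c\<^sup>2 * (cmod (g x))\<^sup>2)"
    using sq_intD[OF assms(1)] by simp
  show "AE x in lborel. (cmod (h x))\<^sup>2 \<le> c\<^sup>2 * (cmod (g x))\<^sup>2"
    using assms(3) by (auto simp: power_mult_distrib[symmetric] intro!: power_mono)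
qed (rule assms)

lemma sq_int_add:
  assumes "sq_int f" "sq_int g"
  shows "sq_int (\<lambda>x. f x + g x)"
proof (rule sq_int_bound)
  show "integrable lborel (\<lambda>x. 2 * (cmod (f x))\<^sup>2 + 2 * (cmod (g x))\<^sup>2)"
    using assms[THEN sq_intD] by simp
  have "(cmod (a + b))\<^sup>2 \<le> 2 * (cmod a)\<^sup>2 + 2 * (cmod b)\<^sup>2" for a b
  proof -
    have "(cmod (a + b))\<^sup>2 \<le> (cmod a + cmod b)\<^sup>2"
      by (intro power_mono norm_triangle_ineq) auto
    also have "\<dots> \<le> 2 * (cmod a)\<^sup>2 + 2 * (cmod b)\<^sup>2"
      using sum_squares_bound[of "cmod a" "cmod b"] by (simp add: power2_sum)
    finally show ?thesis .
  qed
  then show "AE x in lborel. (cmod (f x + g x))\<^sup>2 \<le> 2 * (cmod (f x))\<^sup>2 + 2 * (cmod (g x))\<^sup>2"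
    by simp
qed (use assms in measurable)

lemma sq_int_cmult: "sq_int f \<Longrightarrow> sq_int (\<lambda>x. c * f x)"
  by (rule sq_int_mono[where c = "cmod c"], assumption, measurable) (auto simp: norm_mult)

lemma sq_int_bmult:
  assumes "sq_int f" "m \<in> borel_measurable borel" "\<And>x. cmod (m x) \<le> B"
  shows "sq_int (\<lambda>x. m x * f x)"
  using assms
  by (intro sq_int_mono[OF assms(1), of _ B]) (auto simp: norm_mult intro!: mult_right_mono)

lemma sq_int_scaleR: "sq_int f \<Longrightarrow> sq_int (\<lambda>x. c *\<^sub>R f x)"
  using sq_int_cmult[of f "of_real c"] by (simp add: scaleR_conv_of_real)

lemma sq_int_uminus: "sq_int f \<Longrightarrow> sq_int (\<lambda>x. - f x)"
  using sq_int_cmult[of f "-1"] by simp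

lemma sq_int_diff: "sq_int f \<Longrightarrow> sq_int g \<Longrightarrow> sq_int (\<lambda>x. f x - g x)"
  using sq_int_add[of f "\<lambda>x. - g x"] sq_int_uminus[of g] by simp

lemma borel_measurable_cnj [measurable]: "cnj \<in> borel_measurable borel"
  by (intro borel_measurable_continuous_onI continuous_intros)

lemma sq_int_cnj: "sq_int f \<Longrightarrow> sq_int (\<lambda>x. cnj (f x))"
  by (rule sq_int_mono[where c = 1], assumption, measurable) auto

lemma sq_int_norm: "sq_int f \<Longrightarrow> sq_int (\<lambda>x. of_real (cmod (f x)))"
  by (rule sq_int_mono[where c = 1], assumption, measurable) auto

lemma sq_int_reflect: "sq_int f \<Longrightarrow> sq_int (\<lambda>x. f (- x))"
  unfolding sq_int_def
proof (elim conjE, intro conjI)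
  assume [measurable]: "f \<in> borel_measurable borel"
  show "(\<lambda>x. f (- x)) \<in> borel_measurable borel" by measurable
qed (use lborel_integrable_real_affine_iff[of "-1" "\<lambda>x. (cmod (f x))\<^sup>2" 0] in simp)

lemma sq_int_indicator:
  assumes "sq_int f" "A \<in> sets borel"
  shows "sq_int (\<lambda>x. f x * indicator A x)"
  using assms by (intro sq_int_mono[OF assms(1), of _ 1]) (auto simp: norm_mult indicator_def)

lemma sq_int_cong_AE:
  assumes "sq_int f" "g \<in> borel_measurable borel" "AE x in lborel. g x = f x"
  shows "sq_int g"
  using assms by (intro sq_int_bound[OF sq_intD[OF assms(1)]]) auto

lemma integrable_sq_int_mult:
  assumes "sq_int f" "sq_int g"
  shows "integrable lborel (\<lambda>x. f x * g x)"
proof (rule Bochner_Integration.integrable_bound)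
  show "integrable lborel (\<lambda>x. (cmod (f x))\<^sup>2 + (cmod (g x))\<^sup>2)"
    using assms[THEN sq_intD] by simp
  have "a * b \<le> a\<^sup>2 + b\<^sup>2" if "0 \<le> a" "0 \<le> b" for a b :: real
    using sum_squares_bound[of a b] mult_nonneg_nonneg[OF that] by linarith
  then show "AE x in lborel. norm (f x * g x) \<le> norm ((cmod (f x))\<^sup>2 + (cmod (g x))\<^sup>2)"
    by (simp add: norm_mult)
qed (use assms in measurable)

text \<open>\<open>L2_of h\<close> is unspecified unless \<open>sq_int h\<close>; \<open>fn_of w\<close> is an arbitrary representative.\<close>

quotient_type L2 = "real \<Rightarrow> complex" / partial: "\<lambda>f g. sq_int f \<and> sq_int g \<and> (AE x in lborel. f x = g x)"
  morphisms fn_of L2_of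
proof (rule part_equivpI)
  show "\<exists>x. sq_int x \<and> sq_int x \<and> (AE xa in lborel. x xa = x xa)"
    by (rule exI[of _ "\<lambda>_. 0"]) simp
qed (auto simp: symp_def transp_def)

lemma sq_int_fn [simp]: "sq_int (fn_of w)"
  using Quotient3_rep_reflp[OF Quotient3_L2] by blast

lemma fn_of_measurable [measurable]: "fn_of w \<in> borel_measurable borel"
  by (rule sq_int_measurable) simp

lemma L2_of_fn [simp]: "L2_of (fn_of w) = w"
  using Quotient3_abs_rep[OF Quotient3_L2] .

lemma fn_of_L2: "sq_int h \<Longrightarrow> AE x in lborel. fn_of (L2_of h) x = h x"
  using Quotient3_rep_abs[OF Quotient3_L2, of h] by auto

lemma L2_of_cong: "sq_int f \<Longrightarrow> sq_int g \<Longrightarrow> AE x in lborel. f x = g x \<Longrightarrow> L2_of f = L2_of g"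
  using Quotient3_rel[OF Quotient3_L2, of f g] by auto

lemma L2_eqI: "AE x in lborel. fn_of v x = fn_of w x \<Longrightarrow> v = w"
  using L2_of_cong[of "fn_of v" "fn_of w"] by simp

lemma integrable_fn [simp]: "integrable lborel (\<lambda>x. (cmod (fn_of w x))\<^sup>2)"
  by (rule sq_intD) simp

instantiation L2 :: real_inner
begin

definition zero_L2 :: L2 where "0 = L2_of (\<lambda>_. 0)"
definition plus_L2 :: "L2 \<Rightarrow> L2 \<Rightarrow> L2" where "v + w = L2_of (\<lambda>x. fn_of v x + fn_of w x)"
definition uminus_L2 :: "L2 \<Rightarrow> L2" where "- v = L2_of (\<lambda>x. - fn_of v x)"
definition minus_L2 :: "L2 \<Rightarrow> L2 \<Rightarrow> L2" where "v - w = L2_of (\<lambda>x. fn_of v x - fn_of w x)"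
definition scaleR_L2 :: "real \<Rightarrow> L2 \<Rightarrow> L2" where "c *\<^sub>R v = L2_of (\<lambda>x. c *\<^sub>R fn_of v x)"
definition inner_L2 :: "L2 \<Rightarrow> L2 \<Rightarrow> real" where
  "inner_L2 v w = (LINT x|lborel. Re (fn_of v x * cnj (fn_of w x)))"
definition norm_L2 :: "L2 \<Rightarrow> real" where "norm_L2 v = sqrt (inner v v)"
definition dist_L2 :: "L2 \<Rightarrow> L2 \<Rightarrow> real" where "dist_L2 v w = norm (v - w)"
definition sgn_L2 :: "L2 \<Rightarrow> L2" where "sgn_L2 v = scaleR (inverse (norm v)) v"
definition uniformity_L2 :: "(L2 \<times> L2) filter" where
  "uniformity_L2 = (INF e\<in>{0 <..}. principal {(x, y). dist x y < e})"
definition open_L2 :: "L2 set \<Rightarrow> bool" where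
  "open_L2 U \<longleftrightarrow> (\<forall>x\<in>U. eventually (\<lambda>(x', y). x' = x \<longrightarrow> y \<in> U) uniformity)"

lemma fn_0: "AE x in lborel. fn_of 0 x = 0"
  unfolding zero_L2_def by (rule fn_of_L2) simp
lemma fn_add: "AE x in lborel. fn_of (v + w) x = fn_of v x + fn_of w x"
  unfolding plus_L2_def by (rule fn_of_L2) (intro sq_int_add sq_int_fn)
lemma fn_uminus: "AE x in lborel. fn_of (- v) x = - fn_of v x"
  unfolding uminus_L2_def by (rule fn_of_L2) (intro sq_int_uminus sq_int_fn)
lemma fn_diff: "AE x in lborel. fn_of (v - w) x = fn_of v x - fn_of w x"
  unfolding minus_L2_def by (rule fn_of_L2) (intro sq_int_diff sq_int_fn)
lemma fn_scaleR: "AE x in lborel. fn_of (c *\<^sub>R v) x = c *\<^sub>R fn_of v x"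
  unfolding scaleR_L2_def by (rule fn_of_L2) (intro sq_int_scaleR sq_int_fn)

lemma inner_L2_integrable: "integrable lborel (\<lambda>x. Re (fn_of v x * cnj (fn_of w x)))"
  by (intro integrable_Re integrable_sq_int_mult sq_int_cnj sq_int_fn)

lemma inner_L2_self: "inner v v = (LINT x|lborel. (cmod (fn_of v x))\<^sup>2)" for v :: L2
  unfolding inner_L2_def by (intro Bochner_Integration.integral_cong) (auto simp: complex_mult_cnj cmod_power2)

instance
proof
  fix a b c :: L2 and r t :: real
  show "a + b + c = a + (b + c)"
    by (rule L2_eqI) (use fn_add[of "a + b" c] fn_add[of a b] fn_add[of a "b + c"] fn_add[of b c] in eventually_elim, simp)
  show "a + b = b + a"
    by (rule L2_eqI) (use fn_add[of b a] fn_add[of a b] in eventually_elim, simp)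
  show "0 + a = a"
    by (rule L2_eqI) (use fn_add[of 0 a] fn_0 in eventually_elim, simp)
  show "- a + a = 0"
    by (rule L2_eqI) (use fn_add[of "- a" a] fn_0 fn_uminus[of a] in eventually_elim, simp)
  show "a - b = a + - b"
    by (rule L2_eqI) (use fn_add[of a "- b"] fn_diff[of a b] fn_uminus[of b] in eventually_elim, simp)
  show "r *\<^sub>R (a + b) = r *\<^sub>R a + r *\<^sub>R b"
    by (rule L2_eqI) (use fn_add[of a b] fn_scaleR[of r "a + b"] fn_scaleR[of r a] fn_scaleR[of r b]
        fn_add[of "r *\<^sub>R a" "r *\<^sub>R b"] in eventually_elim, simp add: algebra_simps)
  show "(r + t) *\<^sub>R a = r *\<^sub>R a + t *\<^sub>R a"
    by (rule L2_eqI) (use fn_scaleR[of "r + t" a] fn_scaleR[of r a] fn_scaleR[of t a]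
        fn_add[of "r *\<^sub>R a" "t *\<^sub>R a"] in eventually_elim, simp add: algebra_simps)
  show "r *\<^sub>R t *\<^sub>R a = (r * t) *\<^sub>R a"
    by (rule L2_eqI) (use fn_scaleR[of "r * t" a] fn_scaleR[of r "t *\<^sub>R a"] fn_scaleR[of t a]
        in eventually_elim, simp add: algebra_simps)
  show "1 *\<^sub>R a = a"
    by (rule L2_eqI) (use fn_scaleR[of 1 a] in eventually_elim, simp)
  show "dist a b = norm (a - b)" by (rule dist_L2_def)
  show "sgn a = scaleR (inverse (norm a)) a" by (rule sgn_L2_def)
  show "uniformity = (INF e\<in>{0 <..}. principal {(x :: L2, y). dist x y < e})"
    by (rule uniformity_L2_def)
  show "open U = (\<forall>x\<in>U. \<forall>\<^sub>F (x', y) in uniformity. x' = x \<longrightarrow> y \<in> U)" for U :: "L2 set"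
    by (rule open_L2_def)
  show "inner a b = inner b a"
    unfolding inner_L2_def by (intro Bochner_Integration.integral_cong) (auto simp: algebra_simps)
  show "inner (a + b) c = inner a c + inner b c"
  proof -
    have "inner (a + b) c = (LINT x|lborel. Re (fn_of a x * cnj (fn_of c x)) + Re (fn_of b x * cnj (fn_of c x)))"
      unfolding inner_L2_def
      by (rule integral_cong_AE, measurable) (use fn_add[of a b] in eventually_elim, simp add: algebra_simps)
    also have "\<dots> = inner a c + inner b c"
      unfolding inner_L2_def by (intro Bochner_Integration.integral_add inner_L2_integrable)
    finally show ?thesis .
  qed
  show "inner (r *\<^sub>R a) b = r * inner a b"
  proof -
    have "inner (r *\<^sub>R a) b = (LINT x|lborel. r * Re (fn_of a x * cnj (fn_of b x)))"
      unfolding inner_L2_def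
      by (rule integral_cong_AE, measurable) (use fn_scaleR[of r a] in eventually_elim, simp add: algebra_simps)
    then show ?thesis
      unfolding inner_L2_def by simp
  qed
  show "0 \<le> inner a a"
    unfolding inner_L2_self by simp
  show "inner a a = 0 \<longleftrightarrow> a = 0"
  proof
    assume "inner a a = 0"
    then have "AE x in lborel. (cmod (fn_of a x))\<^sup>2 = 0"
      unfolding inner_L2_self using integral_nonneg_eq_0_iff_AE[of lborel "\<lambda>x. (cmod (fn_of a x))\<^sup>2"]
      by simp
    from eventually_conj[OF this fn_0] show "a = 0"
      by (intro L2_eqI) (auto elim: eventually_mono)
  next
    assume "a = 0"
    then have "AE x in lborel. fn_of a x = 0"
      by (simp add: fn_0)
    then have "AE x in lborel. (cmod (fn_of a x))\<^sup>2 = 0"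
      by (auto elim: eventually_mono)
    then show "inner a a = 0"
      unfolding inner_L2_self using integral_nonneg_eq_0_iff_AE[of lborel "\<lambda>x. (cmod (fn_of a x))\<^sup>2"]
      by simp
  qed
  show "norm a = sqrt (inner a a)" by (rule norm_L2_def)
qed

end

lemma norm_L2_sq: "(norm w)\<^sup>2 = (LINT x|lborel. (cmod (fn_of w x))\<^sup>2)"
  by (simp add: power2_norm_eq_inner inner_L2_self)

lemma norm_L2_of_sq:
  assumes "sq_int h"
  shows "(norm (L2_of h))\<^sup>2 = (LINT x|lborel. (cmod (h x))\<^sup>2)"
  unfolding norm_L2_sq using assms
  by (intro integral_cong_AE; measurable?) (use fn_of_L2[OF assms] in eventually_elim, simp)

lemma norm_L2_of: "sq_int h \<Longrightarrow> norm (L2_of h) = sqrt (LINT x|lborel. (cmod (h x))\<^sup>2)"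
  by (simp add: norm_L2_of_sq[symmetric])

lemma L2_of_add: "sq_int f \<Longrightarrow> sq_int g \<Longrightarrow> L2_of (\<lambda>x. f x + g x) = L2_of f + L2_of g"
  unfolding plus_L2_def
  by (intro L2_of_cong sq_int_add sq_int_fn; assumption?) (use fn_of_L2[of f] fn_of_L2[of g] in auto)

lemma L2_of_diff: "sq_int f \<Longrightarrow> sq_int g \<Longrightarrow> L2_of (\<lambda>x. f x - g x) = L2_of f - L2_of g"
  unfolding minus_L2_def
  by (intro L2_of_cong sq_int_diff sq_int_fn; assumption?) (use fn_of_L2[of f] fn_of_L2[of g] in auto)

lemma L2_of_scaleR: "sq_int f \<Longrightarrow> L2_of (\<lambda>x. c *\<^sub>R f x) = c *\<^sub>R L2_of f"
  unfolding scaleR_L2_def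
  by (intro L2_of_cong sq_int_scaleR sq_int_fn; assumption?) (use fn_of_L2[of f] in auto)

lemma norm_L2_of_le:
  assumes "sq_int f" "sq_int g" "AE x in lborel. cmod (f x) \<le> c * cmod (g x)" "0 \<le> c"
  shows "norm (L2_of f) \<le> c * norm (L2_of g)"
proof -
  have "AE x in lborel. (cmod (f x))\<^sup>2 \<le> c\<^sup>2 * (cmod (g x))\<^sup>2"
    using assms(3) by eventually_elim (auto simp: power_mult_distrib[symmetric] intro!: power_mono)
  then have "(norm (L2_of f))\<^sup>2 \<le> (LINT x|lborel. c\<^sup>2 * (cmod (g x))\<^sup>2)"
    unfolding norm_L2_of_sq[OF assms(1)]
    by (intro integral_mono_AE) (use assms sq_intD in auto)
  also have "\<dots> = (c * norm (L2_of g))\<^sup>2"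
    by (simp add: norm_L2_of_sq[OF assms(2)] power_mult_distrib)
  finally show ?thesis
    by (rule power2_le_imp_le) (use assms(4) in simp)
qed

lemma norm_L2_of_mono:
  assumes "sq_int f" "sq_int g" "\<And>x. cmod (f x) \<le> c * cmod (g x)" "0 \<le> c"
  shows "norm (L2_of f) \<le> c * norm (L2_of g)"
  using assms by (intro norm_L2_of_le) auto

lemma cauchy_schwarz_L2:
  assumes "sq_int f" "sq_int g"
  shows "(LINT x|lborel. cmod (f x) * cmod (g x)) \<le> norm (L2_of f) * norm (L2_of g)"
proof -
  let ?f = "\<lambda>x. complex_of_real (cmod (f x))" and ?g = "\<lambda>x. complex_of_real (cmod (g x))"
  have sq: "sq_int ?f" "sq_int ?g"
    using assms by (auto intro: sq_int_norm)
  have "inner (L2_of ?f) (L2_of ?g) = (LINT x|lborel. cmod (f x) * cmod (g x))"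
    unfolding inner_L2_def using assms
    by (intro integral_cong_AE; measurable?) (use fn_of_L2[OF sq(1)] fn_of_L2[OF sq(2)] in eventually_elim, simp)
  moreover have "norm (L2_of ?f) = norm (L2_of f)" "norm (L2_of ?g) = norm (L2_of g)"
    using assms sq by (simp_all add: norm_L2_of)
  ultimately show ?thesis
    using norm_cauchy_schwarz[of "L2_of ?f" "L2_of ?g"] by simp
qed

lemma cauchy_schwarz_integral:
  assumes "sq_int f" "sq_int g"
  shows "cmod (LINT x|lborel. f x * g x) \<le> norm (L2_of f) * norm (L2_of g)"
proof -
  have "cmod (LINT x|lborel. f x * g x) \<le> (LINT x|lborel. cmod (f x * g x))"
    by (rule integral_norm_bound)
  with cauchy_schwarz_L2[OF assms] show ?thesis by (simp add: norm_mult)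
qed

section \<open>Completeness of the space and approximation by truncation\<close>

lemma sq_int_std_normal: "sq_int (\<lambda>x. complex_of_real (std_normal_density x))"
proof (rule sq_int_bound)
  have "std_normal_density x \<le> 1" for x
  proof -
    have "std_normal_density x \<le> 1 / sqrt (2 * pi)"
      by (simp add: std_normal_density_def divide_right_mono)
    also have "\<dots> \<le> 1"
      using pi_ge_two by simp
    finally show ?thesis .
  qed
  then show "AE x in lborel. (cmod (complex_of_real (std_normal_density x)))\<^sup>2 \<le> std_normal_density x"
    by (simp add: power2_eq_square mult_left_le)
qed (auto intro: integrable_std_normal_distribution_moment[of 0, simplified])

instance L2 :: banach
proof
  fix X :: "nat \<Rightarrow> L2" assume X: "Cauchy X"
  \<comment> \<open>The Gaussian is a square integrable weight without zeros: multiplication by it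
    turns an \<open>L\<^sup>2\<close> Cauchy sequence into an \<open>L\<^sup>1\<close> Cauchy
    sequence, which has a subsequence that is Cauchy almost everywhere, and the weight can be
    divided out again at each point.\<close>
  let ?h = "\<lambda>x. complex_of_real (std_normal_density x)"
  define s where "s i x = fn_of (X i) x * ?h x" for i x
  have s_int: "integrable lborel (s i)" for i
    unfolding s_def by (intro integrable_sq_int_mult sq_int_fn sq_int_std_normal)
  have sdist: "(LINT x|lborel. norm (s i x - s j x)) \<le> norm (X i - X j) * norm (L2_of ?h)" for i j
  proof -
    have "(LINT x|lborel. norm (s i x - s j x)) = (LINT x|lborel. cmod (fn_of (X i - X j) x) * cmod (?h x))"
      by (rule integral_cong_AE; (unfold s_def)?; measurable?)
        (use fn_diff[of "X i" "X j"] in eventually_elim, simp add: left_diff_distrib[symmetric] norm_mult del: of_real_mult)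
    also have "\<dots> \<le> norm (L2_of (fn_of (X i - X j))) * norm (L2_of ?h)"
      by (intro cauchy_schwarz_L2 sq_int_fn sq_int_std_normal)
    finally show ?thesis by simp
  qed
  obtain r where r: "strict_mono r" "AE x in lborel. Cauchy (\<lambda>i. s (r i) x)"
  proof (rule cauchy_L1_AE_cauchy_subseq[OF s_int])
    fix e :: real assume "e > 0"
    define e' where "e' = e / (norm (L2_of ?h) + 1)"
    have "e' > 0"
      using \<open>e > 0\<close> unfolding e'_def by (intro divide_pos_pos) (auto intro: add_nonneg_pos)
    then obtain N where N: "\<And>i j. i \<ge> N \<Longrightarrow> j \<ge> N \<Longrightarrow> norm (X i - X j) < e'"
      using X unfolding Cauchy_iff by blast
    have "norm (X i - X j) * norm (L2_of ?h) < e" if "i \<ge> N" "j \<ge> N" for i j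
    proof -
      have "norm (X i - X j) * norm (L2_of ?h) \<le> e' * norm (L2_of ?h)"
        using N[OF that] by (intro mult_right_mono) auto
      also have "\<dots> < e' * (norm (L2_of ?h) + 1)"
        using \<open>e' > 0\<close> by simp
      also have "\<dots> = e"
        unfolding e'_def using norm_ge_zero[of "L2_of ?h"] by (simp add: add_nonneg_eq_0_iff)
      finally show ?thesis .
    qed
    with sdist show "\<exists>N. \<forall>i\<ge>N. \<forall>j\<ge>N. (LINT x|lborel. norm (s i x - s j x)) < e"
      by (meson le_less_trans)
  qed
  define l where "l x = lim (\<lambda>i. fn_of (X (r i)) x)" for x
  have l_meas [measurable]: "l \<in> borel_measurable borel"
    unfolding l_def by measurable
  have conv: "AE x in lborel. (\<lambda>i. fn_of (X (r i)) x) \<longlonglongrightarrow> l x"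
    using r(2)
  proof eventually_elim
    fix x assume "Cauchy (\<lambda>i. s (r i) x)"
    then have "convergent (\<lambda>i. s (r i) x)"
      by (simp add: Cauchy_convergent_iff)
    then have "convergent (\<lambda>i. s (r i) x * inverse (?h x))"
      by (auto simp: convergent_def intro: tendsto_mult_right)
    moreover have "s (r i) x * inverse (?h x) = fn_of (X (r i)) x" for i
    proof -
      have "?h x \<noteq> 0"
        by (simp add: std_normal_density_def)
      then show ?thesis
        unfolding s_def mult.assoc using right_inverse[of "?h x"] by simp
    qed
    ultimately show "(\<lambda>i. fn_of (X (r i)) x) \<longlonglongrightarrow> l x"
      unfolding l_def by (simp add: convergent_LIMSEQ_iff)
  qed
  \<comment> \<open>Convergence in norm is still unknown here; Fatou's lemma along the subsequence
    passes the Cauchy bound on to the pointwise limit.\<close>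
  have fatou: "(\<integral>\<^sup>+x. ennreal ((cmod (fn_of (X i) x - l x))\<^sup>2) \<partial>lborel) \<le> ennreal (e\<^sup>2)"
    if N: "\<And>i j. i \<ge> N \<Longrightarrow> j \<ge> N \<Longrightarrow> norm (X i - X j) < e" and "i \<ge> N" for i N and e :: real
  proof -
    have "(\<integral>\<^sup>+x. ennreal ((cmod (fn_of (X i) x - l x))\<^sup>2) \<partial>lborel) =
      (\<integral>\<^sup>+x. liminf (\<lambda>j. ennreal ((cmod (fn_of (X i) x - fn_of (X (r j)) x))\<^sup>2)) \<partial>lborel)"
    proof (rule nn_integral_cong_AE, use conv in eventually_elim)
      fix x assume "(\<lambda>i. fn_of (X (r i)) x) \<longlonglongrightarrow> l x"
      then have "(\<lambda>j. ennreal ((cmod (fn_of (X i) x - fn_of (X (r j)) x))\<^sup>2)) \<longlonglongrightarrow> ennreal ((cmod (fn_of (X i) x - l x))\<^sup>2)"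
        by (intro tendsto_intros)
      then show "ennreal ((cmod (fn_of (X i) x - l x))\<^sup>2) = liminf (\<lambda>j. ennreal ((cmod (fn_of (X i) x - fn_of (X (r j)) x))\<^sup>2))"
        by (intro lim_imp_Liminf[symmetric]) auto
    qed
    also have "\<dots> \<le> liminf (\<lambda>j. \<integral>\<^sup>+x. ennreal ((cmod (fn_of (X i) x - fn_of (X (r j)) x))\<^sup>2) \<partial>lborel)"
      by (rule nn_integral_liminf) measurable
    also have "\<dots> \<le> ennreal (e\<^sup>2)"
    proof (rule Liminf_le)
      show "\<forall>\<^sub>F j in sequentially. (\<integral>\<^sup>+x. ennreal ((cmod (fn_of (X i) x - fn_of (X (r j)) x))\<^sup>2) \<partial>lborel) \<le> ennreal (e\<^sup>2)"
        using eventually_ge_at_top[of N]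
      proof eventually_elim
        fix j assume "N \<le> j"
        then have "r j \<ge> N"
          using seq_suble[OF r(1), of j] by simp
        have "(\<integral>\<^sup>+x. ennreal ((cmod (fn_of (X i) x - fn_of (X (r j)) x))\<^sup>2) \<partial>lborel)
          = (\<integral>\<^sup>+x. ennreal ((cmod (fn_of (X i - X (r j)) x))\<^sup>2) \<partial>lborel)"
          by (rule nn_integral_cong_AE) (use fn_diff[of "X i" "X (r j)"] in auto)
        also have "\<dots> = ennreal ((norm (X i - X (r j)))\<^sup>2)"
          unfolding norm_L2_sq by (rule nn_integral_eq_integral) auto
        also have "\<dots> \<le> ennreal (e\<^sup>2)"
          using N[OF \<open>i \<ge> N\<close> \<open>r j \<ge> N\<close>] by (intro ennreal_leI power_mono) auto
        finally show "(\<integral>\<^sup>+x. ennreal ((cmod (fn_of (X i) x - fn_of (X (r j)) x))\<^sup>2) \<partial>lborel) \<le> ennreal (e\<^sup>2)" .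
      qed
    qed simp
    finally show ?thesis .
  qed
  have diff_sq: "sq_int (\<lambda>x. fn_of (X i) x - l x)" and diff_norm: "norm (X i - L2_of l) \<le> e"
    if N: "\<And>i j. i \<ge> N \<Longrightarrow> j \<ge> N \<Longrightarrow> norm (X i - X j) < e" and "i \<ge> N" "e > 0" for i N and e :: real
  proof -
    note f = fatou[OF N \<open>i \<ge> N\<close>, simplified]
    show sq: "sq_int (\<lambda>x. fn_of (X i) x - l x)"
      unfolding sq_int_def
    proof
      show "integrable lborel (\<lambda>x. (cmod (fn_of (X i) x - l x))\<^sup>2)"
        by (rule integrableI_bounded) (use f in \<open>auto intro: le_less_trans\<close>)
    qed measurable
    have l: "sq_int l"
      using sq_int_diff[OF sq_int_fn[of "X i"] sq] by simp
    have "(norm (X i - L2_of l))\<^sup>2 = (LINT x|lborel. (cmod (fn_of (X i) x - l x))\<^sup>2)"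
      using norm_L2_of_sq[OF sq] L2_of_diff[OF sq_int_fn[of "X i"] l] by simp
    also have "ennreal \<dots> = (\<integral>\<^sup>+x. ennreal ((cmod (fn_of (X i) x - l x))\<^sup>2) \<partial>lborel)"
      by (rule nn_integral_eq_integral[symmetric]) (use sq in \<open>auto simp: sq_int_def\<close>)
    also note f
    finally have "(norm (X i - L2_of l))\<^sup>2 \<le> e\<^sup>2"
      by (subst (asm) ennreal_le_iff) auto
    then show "norm (X i - L2_of l) \<le> e"
      by (rule power2_le_imp_le) (use \<open>e > 0\<close> in simp)
  qed
  show "convergent X"
    unfolding convergent_def
  proof (rule exI, rule LIMSEQ_I)
    fix e :: real assume "e > 0"
    then obtain N where N: "\<And>i j. i \<ge> N \<Longrightarrow> j \<ge> N \<Longrightarrow> norm (X i - X j) < e / 2"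
      using X unfolding Cauchy_iff by (meson half_gt_zero)
    have "norm (X i - L2_of l) < e" if "i \<ge> N" for i
    proof -
      have "norm (X i - L2_of l) \<le> e / 2"
        by (rule diff_norm) (use N that \<open>e > 0\<close> in auto)
      with \<open>e > 0\<close> show ?thesis by simp
    qed
    then show "\<exists>N. \<forall>i\<ge>N. norm (X i - L2_of l) < e" by blast
  qed
qed

lemma L2_of_approx_truncate:
  assumes h: "sq_int h"
  shows "(\<lambda>n. L2_of (\<lambda>x. h x * indicator {- real n..real n} x)) \<longlonglongrightarrow> L2_of h"
proof -
  let ?t = "\<lambda>n x. h x * indicator {- real n..real n} x"
  have t: "sq_int (?t n)" for n
    using h by (rule sq_int_indicator) simp
  note d = sq_int_diff[OF t h]
  have [measurable]: "h \<in> borel_measurable borel"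
    using h by (simp add: sq_int_def)
  have "(\<lambda>n. LINT x|lborel. (cmod (?t n x - h x))\<^sup>2) \<longlonglongrightarrow> (LINT x|(lborel::real measure). 0)"
  proof (rule integral_dominated_convergence)
    show "integrable lborel (\<lambda>x. (cmod (h x))\<^sup>2)"
      using h by (rule sq_intD)
    show "AE x in lborel. (\<lambda>n. (cmod (?t n x - h x))\<^sup>2) \<longlonglongrightarrow> 0"
    proof (rule AE_I2)
      fix x :: real
      obtain N where N: "real N > \<bar>x\<bar>"
        using reals_Archimedean2 by blast
      have "\<forall>\<^sub>F n in sequentially. (cmod (?t n x - h x))\<^sup>2 = 0"
        using eventually_ge_at_top[of N] by eventually_elim (use N in \<open>auto simp: indicator_def\<close>)
      then show "(\<lambda>n. (cmod (?t n x - h x))\<^sup>2) \<longlonglongrightarrow> 0"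
        by (rule tendsto_eventually)
    qed
    show "AE x in lborel. norm ((cmod (?t n x - h x))\<^sup>2) \<le> (cmod (h x))\<^sup>2" for n
      by (auto simp: indicator_def)
  qed measurable
  then have "(\<lambda>n. (norm (L2_of (?t n) - L2_of h))\<^sup>2) \<longlonglongrightarrow> 0"
    by (simp add: norm_L2_of_sq[OF d] L2_of_diff[OF t h, symmetric])
  then have "(\<lambda>n. norm (L2_of (?t n) - L2_of h)) \<longlonglongrightarrow> 0"
    using tendsto_real_sqrt by fastforce
  then show ?thesis
    using Lim_null tendsto_norm_zero_iff by blast
qed

lemma truncate_integrable:
  assumes h: "sq_int h"
  shows "integrable lborel (\<lambda>x. h x * indicator {- real n..real n} x)"
proof -
  have "sq_int (\<lambda>x. indicator {- real n..real n} x)"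
  proof (rule sq_int_bound)
    show "integrable lborel (\<lambda>x. indicator {- real n..real n} x :: real)"
      by (simp add: integrable_real_indicator)
  qed (auto simp: indicator_def)
  with h show ?thesis by (rule integrable_sq_int_mult)
qed

section \<open>Multiplication by bounded functions\<close>

definition mulop :: "(real \<Rightarrow> complex) \<Rightarrow> L2 \<Rightarrow> L2" where
  "mulop m w = L2_of (\<lambda>x. m x * fn_of w x)"

locale bounded_multiplier =
  fixes m :: "real \<Rightarrow> complex" and B :: real
  assumes m_meas [measurable]: "m \<in> borel_measurable borel" and m_bound: "\<And>x. cmod (m x) \<le> B"
begin

lemma B_nonneg: "0 \<le> B"
  using order_trans[OF norm_ge_zero m_bound[of 0]] .

lemma sq_int_mul: "sq_int h \<Longrightarrow> sq_int (\<lambda>x. m x * h x)"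
  by (rule sq_int_bmult[OF _ m_meas m_bound])

lemma fn_mulop: "AE x in lborel. fn_of (mulop m w) x = m x * fn_of w x"
  unfolding mulop_def by (intro fn_of_L2 sq_int_mul sq_int_fn)

lemma norm_mulop: "norm (mulop m w) \<le> B * norm w"
  using norm_L2_of_mono[OF sq_int_mul[OF sq_int_fn] sq_int_fn, of w B w] B_nonneg
  by (simp add: mulop_def norm_mult m_bound mult_right_mono)

lemma bounded_linear_mulop: "bounded_linear (mulop m)"
proof (rule bounded_linear_intro)
  show "mulop m (v + w) = mulop m v + mulop m w" for v w
    by (rule L2_eqI) (use fn_mulop[of v] fn_mulop[of w] fn_mulop[of "v + w"] fn_add[of v w]
        fn_add[of "mulop m v" "mulop m w"] in eventually_elim, simp add: algebra_simps)
  show "mulop m (r *\<^sub>R v) = r *\<^sub>R mulop m v" for r v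
    by (rule L2_eqI) (use fn_mulop[of v] fn_mulop[of "r *\<^sub>R v"] fn_scaleR[of r v]
        fn_scaleR[of r "mulop m v"] in eventually_elim, simp add: algebra_simps)
  show "norm (mulop m v) \<le> norm v * B" for v
    using norm_mulop[of v] by (simp add: mult.commute)
qed

end

section \<open>Test functions\<close>

definition smooth :: "(real \<Rightarrow> real) \<Rightarrow> bool" where
  "smooth p \<longleftrightarrow> (\<forall>k x. ((deriv ^^ k) p) differentiable (at x))"

text \<open>No formula for the derivative of order \<open>k\<close> is required: it is enough to
  find a class of differentiable functions that is closed under \<open>deriv\<close>.\<close>

lemma smooth_coinduct:
  assumes "S p" and S: "\<And>q. S q \<Longrightarrow> (\<forall>x. q differentiable (at x)) \<and> S (deriv q)"
  shows "smooth p"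
proof -
  have "S ((deriv ^^ k) p)" for k
    by (induction k) (use assms in auto)
  with S show ?thesis
    by (auto simp: smooth_def)
qed

lemma smooth_deriv: "smooth p \<Longrightarrow> smooth (deriv p)"
  unfolding smooth_def by (metis comp_apply funpow_Suc_right)

lemma smooth_DERIV: "smooth p \<Longrightarrow> (p has_real_derivative deriv p x) (at x)"
  unfolding smooth_def DERIV_deriv_iff_real_differentiable by (metis funpow_0)

lemma smooth_isCont: "smooth p \<Longrightarrow> isCont p x"
  using smooth_DERIV DERIV_isCont by blast

lemma deriv_eqI: "(\<And>x. (p has_real_derivative q x) (at x)) \<Longrightarrow> deriv p = q"
  by (intro ext DERIV_imp_deriv)

lemma differentiable_real: "(p has_real_derivative d) (at x) \<Longrightarrow> p differentiable (at x)"
  using real_differentiable_def by blast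

lemma smooth_linear: "smooth (\<lambda>x. a * x + b)"
proof (rule smooth_coinduct[where S = "\<lambda>p. \<exists>a b. p = (\<lambda>x. a * x + b)"], blast)
  fix q :: "real \<Rightarrow> real" assume "\<exists>a b. q = (\<lambda>x. a * x + b)"
  then obtain a b where q: "q = (\<lambda>x. a * x + b)" by blast
  have d: "(q has_real_derivative a) (at x)" for x
    unfolding q by (auto intro!: derivative_eq_intros)
  then have "deriv q = (\<lambda>x. 0 * x + a)"
    by (intro deriv_eqI) auto
  with d show "(\<forall>x. q differentiable (at x)) \<and> (\<exists>a b. deriv q = (\<lambda>x. a * x + b))"
    using differentiable_real by blast
qed

lemma smooth_affine_comp:
  assumes "smooth p"
  shows "smooth (\<lambda>x. p (a * x + b))"
proof -
  have "smooth q" if "\<exists>c r. smooth r \<and> q = (\<lambda>x. c * r (a * x + b))" for q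
  proof (rule smooth_coinduct[where S = "\<lambda>p. \<exists>c r. smooth r \<and> p = (\<lambda>x. c * r (a * x + b))"], rule that)
    fix q assume "\<exists>c r. smooth r \<and> q = (\<lambda>x. c * r (a * x + b))"
    then obtain c r where r: "smooth r" and q: "q = (\<lambda>x. c * r (a * x + b))" by blast
    have d: "(q has_real_derivative (c * a) * deriv r (a * x + b)) (at x)" for x
      unfolding q by (auto intro!: derivative_eq_intros DERIV_chain2[of r] smooth_DERIV r)
    then have "deriv q = (\<lambda>x. (c * a) * deriv r (a * x + b))"
      by (rule deriv_eqI)
    with d smooth_deriv[OF r]
    show "(\<forall>x. q differentiable (at x)) \<and> (\<exists>c r. smooth r \<and> deriv q = (\<lambda>x. c * r (a * x + b)))"
      using differentiable_real by blast
  qed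
  from this[of "\<lambda>x. p (a * x + b)"] show ?thesis
    using assms by (metis mult_1)
qed

text \<open>The Leibniz rule leads from a product to a sum of two products, so the invariant class
  for \<open>smooth_coinduct\<close> has to admit sums.\<close>

inductive prod_sum :: "(real \<Rightarrow> real) \<Rightarrow> bool" where
  prod: "smooth p \<Longrightarrow> smooth q \<Longrightarrow> prod_sum (\<lambda>x. p x * q x)"
| sum: "prod_sum p \<Longrightarrow> prod_sum q \<Longrightarrow> prod_sum (\<lambda>x. p x + q x)"

lemma prod_sum_step: "prod_sum p \<Longrightarrow> (\<forall>x. p differentiable (at x)) \<and> prod_sum (deriv p)"
proof (induction rule: prod_sum.induct)
  case (prod p q)
  have d: "((\<lambda>x. p x * q x) has_real_derivative deriv p x * q x + p x * deriv q x) (at x)" for x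
    using prod by (auto intro!: derivative_eq_intros smooth_DERIV)
  have "prod_sum (\<lambda>x. deriv p x * q x + p x * deriv q x)"
    using prod smooth_deriv by (intro prod_sum.intros) auto
  with deriv_eqI[OF d] d differentiable_real show ?case
    by auto
next
  case (sum p q)
  then have "(p has_real_derivative deriv p x) (at x)" "(q has_real_derivative deriv q x) (at x)" for x
    by (auto simp: DERIV_deriv_iff_real_differentiable)
  then have d: "((\<lambda>x. p x + q x) has_real_derivative deriv p x + deriv q x) (at x)" for x
    by (auto intro!: derivative_eq_intros)
  have "prod_sum (\<lambda>x. deriv p x + deriv q x)"
    using sum by (intro prod_sum.intros) auto
  with deriv_eqI[OF d] d differentiable_real show ?case
    by auto
qed

lemma smooth_mult: "smooth p \<Longrightarrow> smooth q \<Longrightarrow> smooth (\<lambda>x. p x * q x)"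
  by (rule smooth_coinduct[where S = prod_sum]) (auto intro: prod_sum.prod dest: prod_sum_step)

text \<open>The functions \<open>P(1/x) exp(-1/x)\<close>, extended by \<open>0\<close> to \<open>x \<le> 0\<close>, are closed under differentiation.\<close>

definition flat_exp :: "real poly \<Rightarrow> real \<Rightarrow> real" where
  "flat_exp P x = (if x > 0 then poly P (1 / x) * exp (- (1 / x)) else 0)"

lemma poly_div_exp_tendsto: "((\<lambda>y. poly P y / exp y) \<longlongrightarrow> (0::real)) at_top"
proof -
  \<comment> \<open>The extra factor \<open>y ^ k\<close> makes the induction go through: since
    \<open>pCons a P\<close> stands for \<open>a + y P\<close>, each step raises the power by
    one.\<close>
  have "((\<lambda>y. y ^ k * poly P y / exp y) \<longlongrightarrow> (0::real)) at_top" for k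
  proof (induction P arbitrary: k)
    case 0
    then show ?case by simp
  next
    case (pCons a P)
    have "((\<lambda>y. a * (y ^ k / exp y) + y ^ Suc k * poly P y / exp y) \<longlongrightarrow> a * 0 + 0) at_top"
      by (intro tendsto_intros tendsto_power_div_exp_0 pCons.IH)
    then show ?case
      by (simp add: field_simps)
  qed
  from this[of 0] show ?thesis by simp
qed

text \<open>In terms of \<open>y = 1 / x\<close> the factor \<open>[:0, 0, 1:]\<close> is the
  \<open>y\<^sup>2\<close> that comes from differentiating \<open>1 / x\<close>, and
  \<open>P - pderiv P\<close> arises from \<open>P(y) exp(-y)\<close>. At the origin the right-hand
  difference quotient is \<open>y P(y) / exp y\<close> with \<open>y\<close> tending to
  infinity.\<close>

lemma flat_exp_DERIV: "(flat_exp P has_real_derivative flat_exp ([:0, 0, 1:] * (P - pderiv P)) x) (at x)"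
proof -
  consider "x > 0" | "x < 0" | "x = 0" by linarith
  then show ?thesis
  proof cases
    case 1
    have "((\<lambda>x. poly P (1 / x) * exp (- (1 / x))) has_real_derivative flat_exp ([:0, 0, 1:] * (P - pderiv P)) x) (at x)"
      using 1 by (auto intro!: derivative_eq_intros DERIV_chain2[OF poly_DERIV] simp: flat_exp_def field_simps power2_eq_square)
    moreover have "\<forall>\<^sub>F y in nhds x. flat_exp P y = poly P (1 / y) * exp (- (1 / y))"
      using eventually_nhds_in_open[of "{0<..}" x] 1 by (auto simp: flat_exp_def elim!: eventually_mono)
    ultimately show ?thesis
      by (subst DERIV_cong_ev[OF refl _ refl])
  next
    case 2
    have "\<forall>\<^sub>F y in nhds x. flat_exp P y = 0"
      using eventually_nhds_in_open[of "{..<0}" x] 2 by (auto simp: flat_exp_def elim!: eventually_mono)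
    then have "(flat_exp P has_real_derivative 0) (at x) = ((\<lambda>_. 0) has_real_derivative 0) (at x)"
      by (intro DERIV_cong_ev) auto
    then show ?thesis
      using 2 by (simp add: flat_exp_def)
  next
    case 3
    have "((\<lambda>h. flat_exp P h / h) \<longlongrightarrow> 0) (at 0)"
      unfolding filterlim_at_split
    proof
      have "\<forall>\<^sub>F h in at_left 0. flat_exp P h / h = (0::real)"
        by (auto simp: eventually_at_filter flat_exp_def)
      then show "((\<lambda>h. flat_exp P h / h) \<longlongrightarrow> 0) (at_left 0)"
        by (rule tendsto_eventually)
      have lim: "((\<lambda>h. poly (pCons 0 P) (inverse h) / exp (inverse h)) \<longlongrightarrow> 0) (at_right (0::real))"
        by (rule filterlim_compose[OF poly_div_exp_tendsto filterlim_inverse_at_top_right])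
      have "\<forall>\<^sub>F h in at_right 0. poly (pCons 0 P) (inverse h) / exp (inverse h) = flat_exp P h / (h::real)"
        by (auto simp: eventually_at_filter flat_exp_def exp_minus field_simps)
      then show "((\<lambda>h. flat_exp P h / h) \<longlongrightarrow> 0) (at_right 0)"
        using lim by (rule Lim_transform_eventually[rotated])
    qed
    then show ?thesis
      using 3 by (simp add: has_field_derivative_iff flat_exp_def)
  qed
qed

lemma smooth_flat_exp: "smooth (flat_exp P)"
proof (rule smooth_coinduct[where S = "\<lambda>p. \<exists>P. p = flat_exp P"], blast)
  fix q assume "\<exists>P. q = flat_exp P"
  then obtain P where q: "q = flat_exp P" by blast
  show "(\<forall>x. q differentiable (at x)) \<and> (\<exists>P. deriv q = flat_exp P)"
    unfolding q using flat_exp_DERIV differentiable_real deriv_eqI[OF flat_exp_DERIV] by blast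
qed

text \<open>The parameter \<open>c\<close> controls the steepness: as it grows, both factors tend to
  1 on the open interval, and the bumps approach its indicator from below.\<close>

definition bump :: "real \<Rightarrow> real \<Rightarrow> real \<Rightarrow> real \<Rightarrow> real" where
  "bump c a b x = flat_exp 1 (c * x + (- c * a)) * flat_exp 1 ((- c) * x + c * b)"

lemma bump_eq:
  assumes "c > 0"
  shows "bump c a b x = (if a < x \<and> x < b then exp (- (1 / (c * (x - a))) - 1 / (c * (b - x))) else 0)"
proof -
  have "0 < c * x + (- c * a) \<longleftrightarrow> a < x" "0 < (- c) * x + c * b \<longleftrightarrow> x < b"
    using assms by (auto simp: mult_less_cancel_left_pos)
  then show ?thesis
    unfolding bump_def flat_exp_def by (auto simp: algebra_simps simp flip: exp_add)
qed

lemma test_fun_iff: "test_fun p \<longleftrightarrow> smooth p \<and> (\<exists>R. \<forall>x. R < \<bar>x\<bar> \<longrightarrow> p x = 0)"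
  by (simp add: test_fun_def smooth_def)

lemma test_fun_bump: "c > 0 \<Longrightarrow> test_fun (bump c a b)"
  unfolding test_fun_iff
proof
  show "smooth (bump c a b)"
    unfolding bump_def by (intro smooth_mult smooth_affine_comp smooth_flat_exp)
  show "\<exists>R. \<forall>x. R < \<bar>x\<bar> \<longrightarrow> bump c a b x = 0" if "c > 0"
    by (rule exI[of _ "max \<bar>a\<bar> \<bar>b\<bar>"]) (use that in \<open>auto simp: bump_eq\<close>)
qed

lemma bump_bounds:
  assumes c: "c > 0"
  shows "0 \<le> bump c a b x" "bump c a b x \<le> indicator {a<..<b} x"
proof -
  show "0 \<le> bump c a b x"
    using c by (simp add: bump_eq)
  show "bump c a b x \<le> indicator {a<..<b} x"
  proof (cases "a < x \<and> x < b")
    case True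
    with c have "0 \<le> 1 / (c * (x - a))" "0 \<le> 1 / (c * (b - x))" by auto
    then have "exp (- (1 / (c * (x - a))) - 1 / (c * (b - x))) \<le> exp 0"
      unfolding exp_le_cancel_iff by linarith
    with True c show ?thesis by (simp only: bump_eq) auto
  qed (use c in \<open>auto simp: bump_eq\<close>)
qed

text \<open>On \<open>{a..b}\<close> both distances to the ends of the enlarged interval are at
  least 1. Up to a constant such a bump dominates the indicator of the given interval, which yields
  local integrability of whatever is integrable against test functions.\<close>

lemma bump_lower:
  assumes "a \<le> x" "x \<le> b"
  shows "exp (- 2) \<le> bump 1 (a - 1) (b + 1) x"
proof -
  have "1 / (x - (a - 1)) \<le> 1" "1 / (b + 1 - x) \<le> 1"
    using assms by auto
  then have "exp (- 2) \<le> exp (- (1 / (1 * (x - (a - 1)))) - 1 / (1 * (b + 1 - x)))"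
    unfolding exp_le_cancel_iff mult_1 by linarith
  also have "\<dots> = bump 1 (a - 1) (b + 1) x"
    using assms by (simp only: bump_eq[OF zero_less_one]) auto
  finally show ?thesis .
qed

lemma bump_tendsto: "(\<lambda>n. bump (real (Suc n)) a b x) \<longlonglongrightarrow> indicator {a<..<b} x"
proof (cases "a < x \<and> x < b")
  case True
  have "(\<lambda>n. exp (- (1 / (x - a) * inverse (real (Suc n))) - 1 / (b - x) * inverse (real (Suc n))))
      \<longlonglongrightarrow> exp (- (1 / (x - a) * 0) - 1 / (b - x) * 0)"
    by (intro tendsto_intros LIMSEQ_inverse_real_of_nat)
  moreover have "bump (real (Suc n)) a b x
      = exp (- (1 / (x - a) * inverse (real (Suc n))) - 1 / (b - x) * inverse (real (Suc n)))" for n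
    using True by (subst bump_eq) (auto simp: divide_inverse mult_ac simp del: of_nat_Suc)
  ultimately show ?thesis
    using True by simp
next
  case False
  then show ?thesis
    by (auto simp: bump_eq indicator_def)
qed

lemma test_fun_DERIV: "test_fun p \<Longrightarrow> (p has_real_derivative deriv p x) (at x)"
  by (simp add: test_fun_iff smooth_DERIV)

lemma test_fun_isCont: "test_fun p \<Longrightarrow> isCont p x"
  by (simp add: test_fun_iff smooth_isCont)

lemma test_fun_continuous: "test_fun p \<Longrightarrow> continuous_on A p"
  by (simp add: test_fun_isCont continuous_at_imp_continuous_on)

lemma test_fun_measurable [measurable_dest]: "test_fun p \<Longrightarrow> p \<in> borel_measurable borel"
  by (intro borel_measurable_continuous_onI test_fun_continuous)

lemma test_fun_deriv:
  assumes "test_fun p"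
  shows "test_fun (deriv p)"
  unfolding test_fun_iff
proof
  show "smooth (deriv p)"
    using assms by (simp add: test_fun_iff smooth_deriv)
  obtain R where R: "\<And>x. R < \<bar>x\<bar> \<Longrightarrow> p x = 0"
    using assms by (auto simp: test_fun_iff)
  have "deriv p x = 0" if "R < \<bar>x\<bar>" for x
  proof -
    have "open {x. R < \<bar>x\<bar>}"
      by (intro open_Collect_less continuous_intros)
    then have "\<forall>\<^sub>F y in nhds x. p y = 0"
      using eventually_nhds_in_open[of "{x. R < \<bar>x\<bar>}" x] that R by (auto elim!: eventually_mono)
    then have "(p has_real_derivative 0) (at x) = ((\<lambda>_. 0) has_real_derivative 0) (at x)"
      by (intro DERIV_cong_ev) auto
    then show ?thesis
      by (auto intro: DERIV_imp_deriv)
  qed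
  then show "\<exists>R. \<forall>x. R < \<bar>x\<bar> \<longrightarrow> deriv p x = 0" by blast
qed

lemma test_fun_times_id: "test_fun p \<Longrightarrow> test_fun (\<lambda>x. x * p x)"
  using smooth_mult[OF smooth_linear[of 1 0], of p] by (auto simp: test_fun_iff)

lemma test_fun_bounded:
  assumes "test_fun p"
  obtains B where "B > 0" "\<And>x. \<bar>p x\<bar> \<le> B"
proof -
  obtain R where R: "\<And>x. R < \<bar>x\<bar> \<Longrightarrow> p x = 0"
    using assms by (auto simp: test_fun_iff)
  have "bounded (p ` {- R..R})"
    by (intro compact_imp_bounded compact_continuous_image test_fun_continuous assms) auto
  then obtain B where B: "\<forall>y\<in>p ` {- R..R}. norm y \<le> B" "B > 0"
    unfolding bounded_pos by blast
  have "\<bar>p x\<bar> \<le> B" for x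
  proof (cases "R < \<bar>x\<bar>")
    case False
    then have "x \<in> {- R..R}" by (simp, linarith)
    with B show ?thesis by auto
  qed (use B R in auto)
  with B that show ?thesis by blast
qed

lemma test_fun_integrable:
  assumes "test_fun p"
  shows "integrable lborel p"
proof -
  obtain R where R: "\<And>x. R < \<bar>x\<bar> \<Longrightarrow> p x = 0"
    using assms by (auto simp: test_fun_iff)
  have "set_integrable lborel {- R..R} p"
    by (intro borel_integrable_atLeastAtMost') (simp add: test_fun_continuous assms)
  moreover have "indicator {- R..R} x *\<^sub>R p x = p x" for x
  proof (cases "R < \<bar>x\<bar>")
    case False
    then have "x \<in> {- R..R}" by (simp, linarith)
    then show ?thesis by simp
  qed (use R in auto)
  ultimately show ?thesis
    by (simp only: set_integrable_def)
qed

lemma test_fun_sq_int: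
  assumes "test_fun p"
  shows "sq_int (\<lambda>x. complex_of_real (p x))"
proof -
  obtain B where B: "B > 0" "\<And>x. \<bar>p x\<bar> \<le> B"
    using test_fun_bounded[OF assms] by blast
  show ?thesis
  proof (rule sq_int_bound)
    show "integrable lborel (\<lambda>x. B * \<bar>p x\<bar>)"
      using test_fun_integrable[OF assms] by simp
    show "AE x in lborel. (cmod (complex_of_real (p x)))\<^sup>2 \<le> B * \<bar>p x\<bar>"
    proof (rule AE_I2)
      fix x
      have "\<bar>p x\<bar> * \<bar>p x\<bar> \<le> B * \<bar>p x\<bar>"
        using B by (intro mult_right_mono) auto
      then show "(cmod (complex_of_real (p x)))\<^sup>2 \<le> B * \<bar>p x\<bar>"
        by (simp add: power2_eq_square)
    qed
  qed (use test_fun_measurable[OF assms] in measurable)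
qed

section \<open>The fundamental lemma of the calculus of variations\<close>

lemma AE_eq_0_if_interval_integrals:
  fixes f :: "real \<Rightarrow> real"
  assumes f: "integrable lborel f"
    and 0: "\<And>a. (LINT x|lborel. indicator {a<..} x * f x) = 0"
  shows "AE x in lborel. f x = 0"
proof -
  have [measurable]: "f \<in> borel_measurable borel"
    using f by auto
  define fp where "fp = (\<lambda>x. max 0 (f x))"
  define fn where "fn = (\<lambda>x. max 0 (- f x))"
  have [measurable]: "fp \<in> borel_measurable borel" "fn \<in> borel_measurable borel"
    unfolding fp_def fn_def by measurable
  have int: "integrable lborel fp" "integrable lborel fn"
    unfolding fp_def fn_def using f by (auto intro: integrable_max)
  have ind: "integrable lborel (\<lambda>x. indicator {a<..} x * fp x)" "integrable lborel (\<lambda>x. indicator {a<..} x * fn x)" for a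
    using integrable_real_mult_indicator[OF _ int(1), of "{a<..}"] integrable_real_mult_indicator[OF _ int(2), of "{a<..}"]
    by (simp_all add: mult.commute borel_open)
  have em: "emeasure (density lborel (\<lambda>x. ennreal (g x))) {a<..} = ennreal (LINT x|lborel. indicator {a<..} x * g x)"
    if [measurable]: "g \<in> borel_measurable borel" and "\<And>x. 0 \<le> g x" "integrable lborel (\<lambda>x. indicator {a<..} x * g x)" for g :: "real \<Rightarrow> real" and a
  proof -
    have "emeasure (density lborel (\<lambda>x. ennreal (g x))) {a<..} = (\<integral>\<^sup>+x. ennreal (indicator {a<..} x * g x) \<partial>lborel)"
      by (subst emeasure_density) (auto intro!: nn_integral_cong simp: indicator_def)
    also have "\<dots> = ennreal (LINT x|lborel. indicator {a<..} x * g x)"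
      using that by (intro nn_integral_eq_integral) auto
    finally show ?thesis .
  qed
  \<comment> \<open>The positive and negative parts define finite measures that agree on all rays
    and hence are equal; then their densities agree almost everywhere.\<close>
  have "density lborel (\<lambda>x. ennreal (fp x)) = density lborel (\<lambda>x. ennreal (fn x))"
  proof (rule measure_eqI_lessThan)
    fix a :: real
    have "(LINT x|lborel. indicator {a<..} x * fp x) - (LINT x|lborel. indicator {a<..} x * fn x)
      = (LINT x|lborel. indicator {a<..} x * fp x - indicator {a<..} x * fn x)"
      by (rule Bochner_Integration.integral_diff[symmetric]) (rule ind)+
    also have "\<dots> = (LINT x|lborel. indicator {a<..} x * f x)"
      by (intro Bochner_Integration.integral_cong) (auto simp: fp_def fn_def algebra_simps max_def)
    also note 0
    finally show "emeasure (density lborel (\<lambda>x. ennreal (fp x))) {a<..} = emeasure (density lborel (\<lambda>x. ennreal (fn x))) {a<..}"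
      using ind by (subst (1 2) em) (auto simp: fp_def fn_def)
    show "emeasure (density lborel (\<lambda>x. ennreal (fp x))) {a<..} < \<infinity>"
      using ind by (subst em) (auto simp: fp_def fn_def)
  qed auto
  then have "AE x in lborel. ennreal (fp x) = ennreal (fn x)"
    by (intro sigma_finite_measure.density_unique) (auto simp: sigma_finite_lborel)
  then show ?thesis
    by eventually_elim (auto simp: fp_def fn_def max_def split: if_splits)
qed

text \<open>Local integrability is extracted from the hypothesis by means of one bump bounded below.
  Bumps with steepening edges then turn the hypothesis, by dominated convergence, into vanishing
  integrals over all bounded open intervals.\<close>

lemma fundamental_lemma_real:
  fixes f :: "real \<Rightarrow> real"
  assumes [measurable]: "f \<in> borel_measurable borel"
    and int: "\<And>p. test_fun p \<Longrightarrow> integrable lborel (\<lambda>x. f x * p x)"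
    and 0: "\<And>p. test_fun p \<Longrightarrow> (LINT x|lborel. f x * p x) = 0"
  shows "AE x in lborel. f x = 0"
proof -
  have intab: "integrable lborel (\<lambda>x. indicator {a<..<b} x * f x)" for a b
  proof (rule Bochner_Integration.integrable_bound)
    show "integrable lborel (\<lambda>x. exp 2 * (f x * bump 1 (a - 1) (b + 1) x))"
      using int[OF test_fun_bump[of 1 "a - 1" "b + 1"]] by simp
    have "\<bar>f x\<bar> \<le> exp 2 * \<bar>f x * bump 1 (a - 1) (b + 1) x\<bar>" if "a < x" "x < b" for x
    proof -
      have "1 = exp 2 * exp (- 2 :: real)" by (simp flip: exp_add)
      also have "\<dots> \<le> exp 2 * bump 1 (a - 1) (b + 1) x"
        using bump_lower[of a x b] that by simp
      finally have "\<bar>f x\<bar> * 1 \<le> \<bar>f x\<bar> * (exp 2 * bump 1 (a - 1) (b + 1) x)"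
        by (intro mult_left_mono) auto
      with bump_bounds(1)[of 1 "a - 1" "b + 1" x] show ?thesis
        by (simp add: abs_mult mult_ac)
    qed
    then show "AE x in lborel. norm (indicator {a<..<b} x * f x) \<le> norm (exp 2 * (f x * bump 1 (a - 1) (b + 1) x))"
      by (auto simp: indicator_def abs_mult)
  qed measurable
  have intab0: "(LINT x|lborel. indicator {a<..<b} x * f x) = 0" for a b
  proof -
    have "(\<lambda>n. LINT x|lborel. f x * bump (real (Suc n)) a b x) \<longlonglongrightarrow> (LINT x|lborel. f x * indicator {a<..<b} x)"
    proof (rule integral_dominated_convergence)
      show "integrable lborel (\<lambda>x. \<bar>indicator {a<..<b} x * f x\<bar>)"
        using intab by simp
      show "AE x in lborel. (\<lambda>n. f x * bump (real (Suc n)) a b x) \<longlonglongrightarrow> f x * indicator {a<..<b} x"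
        by (intro AE_I2 tendsto_intros bump_tendsto)
      show "AE x in lborel. norm (f x * bump (real (Suc n)) a b x) \<le> \<bar>indicator {a<..<b} x * f x\<bar>" for n
      proof (rule AE_I2)
        fix x
        have b: "0 \<le> bump (real (Suc n)) a b x" "bump (real (Suc n)) a b x \<le> indicator {a<..<b} x"
          by (rule bump_bounds, simp)+
        have "norm (f x * bump (real (Suc n)) a b x) = bump (real (Suc n)) a b x * \<bar>f x\<bar>"
          using b(1) unfolding real_norm_def abs_mult by (simp only: abs_of_nonneg mult.commute)
        also have "\<dots> \<le> indicator {a<..<b} x * \<bar>f x\<bar>"
          using b(2) by (rule mult_right_mono) simp
        finally show "norm (f x * bump (real (Suc n)) a b x) \<le> \<bar>indicator {a<..<b} x * f x\<bar>"
          by (simp add: abs_mult)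
      qed
      show "(\<lambda>x. f x * bump (real (Suc n)) a b x) \<in> borel_measurable lborel" for n
        using test_fun_measurable[OF test_fun_bump[of "real (Suc n)" a b]] by simp
    qed measurable
    moreover have "(LINT x|lborel. f x * bump (real (Suc n)) a b x) = 0" for n
      by (intro 0 test_fun_bump) simp
    ultimately show ?thesis
      by (simp add: LIMSEQ_const_iff mult.commute)
  qed
  have "AE x in lborel. indicator {- real N<..<real N} x * f x = 0" for N
  proof (rule AE_eq_0_if_interval_integrals)
    fix a
    have "(LINT x|lborel. indicator {a<..} x * (indicator {- real N<..<real N} x * f x))
      = (LINT x|lborel. indicator {max a (- real N)<..<real N} x * f x)"
      by (intro Bochner_Integration.integral_cong) (auto simp: indicator_def)
    then show "(LINT x|lborel. indicator {a<..} x * (indicator {- real N<..<real N} x * f x)) = 0"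
      by (simp add: intab0)
  qed (rule intab)
  then have "AE x in lborel. \<forall>N. indicator {- real N<..<real N} x * f x = 0"
    unfolding AE_all_countable by blast
  then show ?thesis
  proof eventually_elim
    fix x assume *: "\<forall>N. indicator {- real N<..<real N} x * f x = 0"
    obtain N where "real N > \<bar>x\<bar>"
      using reals_Archimedean2 by blast
    with *[rule_format, of N] show "f x = 0"
      by (auto simp: indicator_def abs_less_iff)
  qed
qed

lemma fundamental_lemma:
  fixes f :: "real \<Rightarrow> complex"
  assumes [measurable]: "f \<in> borel_measurable borel"
    and int: "\<And>p. test_fun p \<Longrightarrow> integrable lborel (\<lambda>x. f x * complex_of_real (p x))"
    and 0: "\<And>p. test_fun p \<Longrightarrow> (LINT x|lborel. f x * complex_of_real (p x)) = 0"
  shows "AE x in lborel. f x = 0"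
proof -
  have Re: "integrable lborel (\<lambda>x. Re (f x) * p x) \<and> (LINT x|lborel. Re (f x) * p x) = 0" if "test_fun p" for p
    using integrable_Re[OF int[OF that]] integral_Re[OF int[OF that]] 0[OF that] by simp
  have Im: "integrable lborel (\<lambda>x. Im (f x) * p x) \<and> (LINT x|lborel. Im (f x) * p x) = 0" if "test_fun p" for p
    using integrable_Im[OF int[OF that]] integral_Im[OF int[OF that]] 0[OF that] by simp
  have "AE x in lborel. Re (f x) = 0"
    by (rule fundamental_lemma_real) (use Re in auto)
  moreover have "AE x in lborel. Im (f x) = 0"
    by (rule fundamental_lemma_real) (use Im in auto)
  ultimately show ?thesis
    by eventually_elim (simp add: complex_eq_iff)
qed

section \<open>The Fourier transform\<close>

lemma borel_measurable_cis [measurable]: "cis \<in> borel_measurable borel"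
  by (intro borel_measurable_continuous_onI continuous_intros)

lemma integrable_bmult:
  fixes h k :: "'a \<Rightarrow> complex"
  assumes h: "integrable M h" and [measurable]: "k \<in> borel_measurable M" and k: "\<And>x. cmod (k x) \<le> B"
  shows "integrable M (\<lambda>x. h x * k x)"
proof (rule Bochner_Integration.integrable_bound)
  show "integrable M (\<lambda>x. B * cmod (h x))"
    using h by simp
  have "cmod (h x * k x) \<le> B * cmod (h x)" for x
    using mult_left_mono[OF k[of x], of "cmod (h x)"] by (simp add: norm_mult mult.commute)
  moreover have "0 \<le> B"
    using order_trans[OF norm_ge_zero k] .
  ultimately show "AE x in M. norm (h x * k x) \<le> norm (B * cmod (h x))"
    by (simp add: abs_mult)
qed (use h in measurable)

lemma integral_norm_le:
  fixes f :: "'a \<Rightarrow> 'b::{banach, second_countable_topology}"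
  assumes "integrable M f" "integrable M g" "\<And>x. norm (f x) \<le> g x"
  shows "norm (integral\<^sup>L M f) \<le> integral\<^sup>L M g"
  using assms by (intro order_trans[OF integral_norm_bound integral_mono]) auto

text \<open>Two different measures are allowed because the kernel is used with Lebesgue measure on
  both sides as well as with a finite measure on one of them.\<close>

lemma (in pair_sigma_finite) fubini_kernel:
  fixes f :: "'a \<Rightarrow> complex" and g :: "'b \<Rightarrow> complex" and k :: "'a \<Rightarrow> 'b \<Rightarrow> complex"
  assumes f: "integrable M1 f" and g: "integrable M2 g"
    and [measurable]: "case_prod k \<in> borel_measurable (M1 \<Otimes>\<^sub>M M2)" and k: "\<And>x y. cmod (k x y) \<le> B"
  shows "(\<integral>x. f x * (\<integral>y. g y * k x y \<partial>M2) \<partial>M1) = (\<integral>y. g y * (\<integral>x. f x * k x y \<partial>M1) \<partial>M2)"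
proof -
  have [measurable]: "f \<in> borel_measurable M1" "g \<in> borel_measurable M2"
    using f g by auto
  have B: "0 \<le> B"
    using order_trans[OF norm_ge_zero k] .
  have gk: "integrable M2 (\<lambda>y. g y * k x y)" if "x \<in> space M1" for x
    by (rule integrable_bmult[OF g _ k]) (use that in measurable)
  have "integrable (M1 \<Otimes>\<^sub>M M2) (\<lambda>(x, y). f x * (g y * k x y))"
  proof (rule Fubini_integrable)
    show "integrable M1 (\<lambda>x. \<integral>y. norm (case (x, y) of (x, y) \<Rightarrow> f x * (g y * k x y)) \<partial>M2)"
    proof (rule Bochner_Integration.integrable_bound)
      show "integrable M1 (\<lambda>x. cmod (f x) * (B * (\<integral>y. cmod (g y) \<partial>M2)))"
        using f by simp
      show "AE x in M1. norm (\<integral>y. norm (case (x, y) of (x, y) \<Rightarrow> f x * (g y * k x y)) \<partial>M2)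
          \<le> norm (cmod (f x) * (B * (\<integral>y. cmod (g y) \<partial>M2)))"
      proof (rule AE_I2)
        fix x assume x: "x \<in> space M1"
        have "(\<integral>y. cmod (g y * k x y) \<partial>M2) \<le> (\<integral>y. B * cmod (g y) \<partial>M2)"
        proof (rule integral_mono)
          show "integrable M2 (\<lambda>y. cmod (g y * k x y))"
            using gk[OF x] by simp
          show "cmod (g y * k x y) \<le> B * cmod (g y)" for y
            using mult_left_mono[OF k[of x y], of "cmod (g y)"] by (simp add: norm_mult mult.commute)
        qed (use g in simp)
        then have "cmod (f x) * (\<integral>y. cmod (g y * k x y) \<partial>M2) \<le> cmod (f x) * (B * (\<integral>y. cmod (g y) \<partial>M2))"
          by (intro mult_left_mono) auto
        then show "norm (\<integral>y. norm (case (x, y) of (x, y) \<Rightarrow> f x * (g y * k x y)) \<partial>M2)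
          \<le> norm (cmod (f x) * (B * (\<integral>y. cmod (g y) \<partial>M2)))"
          using B by (simp add: norm_mult abs_mult)
      qed
    qed measurable
    show "AE x in M1. integrable M2 (\<lambda>y. case (x, y) of (x, y) \<Rightarrow> f x * (g y * k x y))"
      using gk by (auto intro!: AE_I2)
  qed measurable
  from Fubini_integral[OF this]
  have "(\<integral>x. (\<integral>y. f x * (g y * k x y) \<partial>M2) \<partial>M1) = (\<integral>y. (\<integral>x. f x * (g y * k x y) \<partial>M1) \<partial>M2)"
    by simp
  also have "\<dots> = (\<integral>y. (\<integral>x. g y * (f x * k x y) \<partial>M1) \<partial>M2)"
    by (intro Bochner_Integration.integral_cong refl) (simp add: mult_ac)
  finally show ?thesis
    by (simp only: integral_mult_right_zero)
qed

definition ft :: "(real \<Rightarrow> complex) \<Rightarrow> real \<Rightarrow> complex" where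
  "ft h \<xi> = (LINT x|lborel. h x * cis (- (x * \<xi>)))"

definition ift :: "(real \<Rightarrow> complex) \<Rightarrow> real \<Rightarrow> complex" where
  "ift g x = complex_of_real (1 / (2 * pi)) * ft g (- x)"

lemma fourier_eq_ft: "fourier p = ft (\<lambda>x. complex_of_real (p x))"
  by (simp add: fun_eq_iff fourier_def ft_def)

lemma ft_measurable [measurable]:
  assumes [measurable]: "h \<in> borel_measurable borel"
  shows "ft h \<in> borel_measurable borel"
  unfolding ft_def by measurable

lemma ift_measurable [measurable]:
  assumes [measurable]: "h \<in> borel_measurable borel"
  shows "ift h \<in> borel_measurable borel"
  unfolding ift_def by measurable

lemma integrable_cis:
  assumes "integrable lborel h"
  shows "integrable lborel (\<lambda>x. h x * cis (c * x))" "integrable lborel (\<lambda>x. h x * cis (- (x * \<xi>)))"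
  by (rule integrable_bmult[OF assms, where B = 1]; simp)+

lemma ft_add: "integrable lborel f \<Longrightarrow> integrable lborel g \<Longrightarrow> ft (\<lambda>x. f x + g x) \<xi> = ft f \<xi> + ft g \<xi>"
  unfolding ft_def by (simp add: distrib_right integrable_cis)

lemma ft_diff: "integrable lborel f \<Longrightarrow> integrable lborel g \<Longrightarrow> ft (\<lambda>x. f x - g x) \<xi> = ft f \<xi> - ft g \<xi>"
  unfolding ft_def by (simp add: left_diff_distrib integrable_cis)

lemma ft_cmult: "ft (\<lambda>x. c * f x) \<xi> = c * ft f \<xi>"
  unfolding ft_def by (simp add: mult.assoc)

lemma ft_bound: "cmod (ft h \<xi>) \<le> (LINT x|lborel. cmod (h x))"
proof -
  have "cmod (ft h \<xi>) \<le> (LINT x|lborel. cmod (h x * cis (- (x * \<xi>))))"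
    unfolding ft_def by (rule integral_norm_bound)
  then show ?thesis by (simp add: norm_mult)
qed

lemma ft_cong_AE:
  assumes "f \<in> borel_measurable borel" "g \<in> borel_measurable borel" "AE x in lborel. f x = g x"
  shows "ft f = ft g"
proof
  fix \<xi>
  show "ft f \<xi> = ft g \<xi>"
    unfolding ft_def using assms by (intro integral_cong_AE) auto
qed

lemma ft_cnj: "ft (\<lambda>x. cnj (h x)) \<xi> = cnj (ft h (- \<xi>))"
proof -
  have "ft (\<lambda>x. cnj (h x)) \<xi> = (LINT x|lborel. cnj (h x * cis (- (x * - \<xi>))))"
    unfolding ft_def by (simp add: cis_cnj)
  then show ?thesis
    unfolding ft_def Bochner_Integration.integral_cnj .
qed

lemma ft_reflect: "ft (\<lambda>x. h (- x)) \<xi> = ft h (- \<xi>)"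
  unfolding ft_def using lborel_integral_real_affine[of "-1" "\<lambda>x. h x * cis (- (x * - \<xi>))" 0] by simp

lemma ft_continuous:
  assumes "integrable lborel h"
  shows "isCont (ft h) \<xi>"
  unfolding continuous_at_sequentially comp_def
proof (intro allI impI)
  fix X assume X: "X \<longlonglongrightarrow> \<xi>"
  have [measurable]: "h \<in> borel_measurable borel"
    using assms by auto
  show "(\<lambda>n. ft h (X n)) \<longlonglongrightarrow> ft h \<xi>"
    unfolding ft_def
  proof (rule integral_dominated_convergence)
    show "integrable lborel (\<lambda>x. cmod (h x))"
      using assms by simp
    show "AE x in lborel. (\<lambda>n. h x * cis (- (x * X n))) \<longlonglongrightarrow> h x * cis (- (x * \<xi>))"
      by (intro AE_I2 tendsto_intros X)
  qed (auto simp: norm_mult)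
qed

lemma ift_continuous:
  assumes "integrable lborel g"
  shows "isCont (ift g) x"
  unfolding ift_def
  by (intro continuous_intros continuous_at_compose[of x uminus "ft g", unfolded comp_def] ft_continuous assms)

lemma ft_multiplication:
  assumes "integrable lborel f" "integrable lborel g"
  shows "(LINT x|lborel. f x * ft g x) = (LINT y|lborel. g y * ft f y)"
proof -
  have "(LINT x|lborel. f x * (LINT y|lborel. g y * cis (- (y * x)))) = (LINT y|lborel. g y * (LINT x|lborel. f x * cis (- (y * x))))"
    by (rule lborel_pair.fubini_kernel[OF assms, where B = 1]) auto
  then show ?thesis
    unfolding ft_def by (simp add: mult.commute)
qed

subsection \<open>Gaussian damping and inversion\<close>

text \<open>As \<open>\<epsilon>\<close> tends to 0 this damping disappears, while its transform,
  \<open>2 * pi\<close> times the normal density with deviation \<open>\<epsilon>\<close>,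
  concentrates at the origin.\<close>

definition gk :: "real \<Rightarrow> real \<Rightarrow> real" where
  "gk \<epsilon> \<xi> = exp (- (\<epsilon> * \<xi>)\<^sup>2 / 2)"

lemma gk_measurable [measurable]: "gk \<epsilon> \<in> borel_measurable borel"
  unfolding gk_def by measurable

lemma gk_bounds: "0 < gk \<epsilon> \<xi>" "gk \<epsilon> \<xi> \<le> 1"
  by (auto simp: gk_def)

lemma gk_std: "gk 1 z = sqrt (2 * pi) * std_normal_density z"
  by (simp add: gk_def std_normal_density_def)

lemma gk_scale: "gk \<epsilon> \<xi> = gk 1 (\<epsilon> * \<xi>)"
  by (simp add: gk_def)

lemma gk_integrable: "\<epsilon> > 0 \<Longrightarrow> integrable lborel (gk \<epsilon>)"
proof -
  assume "\<epsilon> > 0"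
  have "integrable lborel (gk 1)"
    unfolding gk_std[abs_def] by simp
  from lborel_integrable_real_affine[OF this, of \<epsilon> 0] \<open>\<epsilon> > 0\<close> show ?thesis
    by (subst gk_scale[abs_def]) simp
qed

lemma gk_tendsto: "X \<longlonglongrightarrow> 0 \<Longrightarrow> (\<lambda>n. gk (X n) \<xi>) \<longlonglongrightarrow> 1"
proof -
  assume X: "X \<longlonglongrightarrow> 0"
  have "(\<lambda>n. gk (X n) \<xi>) \<longlonglongrightarrow> exp (- (0 * \<xi>)\<^sup>2 / 2)"
    unfolding gk_def by (intro tendsto_intros X) simp
  then show ?thesis by simp
qed

lemma ft_std_normal: "ft (\<lambda>z. complex_of_real (std_normal_density z)) t = complex_of_real (exp (- t\<^sup>2 / 2))"
proof -
  \<comment> \<open>The characteristic function carries the opposite sign in its exponent, hence the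
    argument \<open>- t\<close>.\<close>
  have "complex_of_real (exp (- (- t)\<^sup>2 / 2)) = char std_normal_distribution (- t)"
    by (simp add: char_std_normal_distribution)
  also have "\<dots> = (LINT z|lborel. std_normal_density z *\<^sub>R iexp (- t * z))"
    unfolding char_def by (intro integral_density) auto
  also have "\<dots> = ft (\<lambda>z. complex_of_real (std_normal_density z)) t"
    unfolding ft_def by (simp add: cis_conv_exp scaleR_conv_of_real mult_ac)
  finally show ?thesis by simp
qed

lemma ft_gk:
  assumes "\<epsilon> > 0"
  shows "ft (\<lambda>\<xi>. complex_of_real (gk \<epsilon> \<xi>)) y = complex_of_real (2 * pi * normal_density 0 \<epsilon> y)"
proof -
  have "ft (\<lambda>\<xi>. complex_of_real (gk \<epsilon> \<xi>)) y
      = (1 / \<epsilon>) *\<^sub>R (LINT z|lborel. complex_of_real (gk \<epsilon> (z / \<epsilon>)) * cis (- (z / \<epsilon> * y)))"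
    unfolding ft_def
    using lborel_integral_real_affine[of "1 / \<epsilon>" "\<lambda>\<xi>. complex_of_real (gk \<epsilon> \<xi>) * cis (- (\<xi> * y))" 0] assms
    by simp
  also have "\<dots> = (1 / \<epsilon>) *\<^sub>R (LINT z|lborel. complex_of_real (sqrt (2 * pi)) * (complex_of_real (std_normal_density z) * cis (- (z * (y / \<epsilon>)))))"
    using assms by (simp add: gk_scale[of \<epsilon>] gk_std mult_ac)
  also have "\<dots> = (1 / \<epsilon>) *\<^sub>R (complex_of_real (sqrt (2 * pi)) * ft (\<lambda>z. complex_of_real (std_normal_density z)) (y / \<epsilon>))"
    unfolding ft_def by simp
  also have "\<dots> = complex_of_real (1 / \<epsilon> * sqrt (2 * pi) * exp (- (y / \<epsilon>)\<^sup>2 / 2))"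
    unfolding ft_std_normal by (simp add: scaleR_conv_of_real)
  also have "1 / \<epsilon> * sqrt (2 * pi) * exp (- (y / \<epsilon>)\<^sup>2 / 2) = 2 * pi * normal_density 0 \<epsilon> y"
  proof -
    have "sqrt (2 * pi) * sqrt (2 * pi) = 2 * pi" by simp
    then have "sqrt (2 * pi) = 2 * pi / sqrt (2 * pi)" by (simp add: field_simps)
    then show ?thesis
      using assms unfolding normal_density_def
      by (simp add: real_sqrt_mult power_divide field_simps)
  qed
  finally show ?thesis .
qed

text \<open>The multiplication formula for a Gaussian times a character; the character merely
  translates the normal density to \<open>x\<close>.\<close>

lemma damped_inversion:
  assumes h: "integrable lborel h" and \<epsilon>: "\<epsilon> > 0"
  shows "(LINT \<xi>|lborel. ft h \<xi> * (complex_of_real (gk \<epsilon> \<xi>) * cis (x * \<xi>)))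
     = (LINT y|lborel. h y * complex_of_real (2 * pi * normal_density x \<epsilon> y))"
proof -
  have "ft (\<lambda>\<xi>. complex_of_real (gk \<epsilon> \<xi>) * cis (x * \<xi>)) y = complex_of_real (2 * pi * normal_density x \<epsilon> y)" for y
  proof -
    have "ft (\<lambda>\<xi>. complex_of_real (gk \<epsilon> \<xi>) * cis (x * \<xi>)) y = ft (\<lambda>\<xi>. complex_of_real (gk \<epsilon> \<xi>)) (y - x)"
    proof -
      have "cis (x * \<xi>) * cis (- (\<xi> * y)) = cis (- (\<xi> * (y - x)))" for \<xi>
        by (simp add: cis_mult algebra_simps)
      then show ?thesis
        unfolding ft_def by (simp only: mult.assoc)
    qed
    then show ?thesis
      by (simp add: ft_gk[OF \<epsilon>] normal_density_def)
  qed
  moreover have "integrable lborel (\<lambda>\<xi>. complex_of_real (gk \<epsilon> \<xi>) * cis (x * \<xi>))"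
    by (intro integrable_cis integrable_of_real gk_integrable \<epsilon>)
  ultimately show ?thesis
    using ft_multiplication[OF _ h, of "\<lambda>\<xi>. complex_of_real (gk \<epsilon> \<xi>) * cis (x * \<xi>)"]
    by (simp add: mult.commute)
qed

lemma normal_density_sym: "normal_density x \<epsilon> y = normal_density y \<epsilon> x"
  by (simp add: normal_density_def power2_commute)

lemma normal_density_bound: "\<epsilon> > 0 \<Longrightarrow> normal_density x \<epsilon> y \<le> 1 / sqrt (2 * pi * \<epsilon>\<^sup>2)"
  unfolding normal_density_def by (intro mult_left_le) auto

lemma gaussian_kernel_bound:
  assumes "\<epsilon> > 0"
  shows "cmod (complex_of_real (2 * pi * normal_density x \<epsilon> y)) \<le> 2 * pi * (1 / sqrt (2 * pi * \<epsilon>\<^sup>2))"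
  unfolding norm_of_real using mult_left_mono[OF normal_density_bound[OF assms], of "2 * pi" x y]
  by (simp add: abs_mult)

lemma normal_density_measurable2 [measurable]:
  assumes [measurable]: "f \<in> borel_measurable M" "g \<in> borel_measurable M"
  shows "(\<lambda>x. normal_density (f x) \<epsilon> (g x)) \<in> borel_measurable M"
  unfolding normal_density_def by measurable

text \<open>Gaussian averages of a merely integrable \<open>h\<close> are hard to control pointwise.
  Testing with \<open>p\<close> shifts the average onto \<open>p\<close>, which is bounded and
  continuous, and the fundamental lemma recovers the identity almost everywhere.\<close>

lemma ft_inversion:
  assumes h: "integrable lborel h" and fh: "integrable lborel (ft h)"
  shows "AE x in lborel. h x = ift (ft h) x"
proof -
  have [measurable]: "h \<in> borel_measurable borel"
    using h by auto
  define e where "e n = inverse (real (Suc n))" for n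
  have e: "e n > 0" "e \<longlonglongrightarrow> 0" for n
    unfolding e_def using LIMSEQ_inverse_real_of_nat by auto
  have e1: "e n \<le> 1" for n
    by (simp add: e_def inverse_eq_divide)
  have ift_bound: "cmod (ift (ft h) x) \<le> 1 / (2 * pi) * (LINT x|lborel. cmod (ft h x))" for x
    unfolding ift_def norm_mult using ft_bound[of "ft h" "- x"] by (intro mult_mono) (auto simp: norm_divide norm_mult)
  have test: "integrable lborel (\<lambda>x. (h x - ift (ft h) x) * complex_of_real (p x)) \<and>
    (LINT x|lborel. (h x - ift (ft h) x) * complex_of_real (p x)) = 0" if p: "test_fun p" for p
  proof -
    note [measurable] = test_fun_measurable[OF p]
    obtain B where B: "B > 0" "\<And>x. \<bar>p x\<bar> \<le> B"
      using test_fun_bounded[OF p] by blast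
    have pint: "integrable lborel (\<lambda>x. complex_of_real (p x))"
      using test_fun_integrable[OF p] by simp
    \<comment> \<open>The limit of this quantity is computed twice: dominated convergence in the
      frequency variable gives the inverse transform, while \<open>damped_inversion\<close> rewrites
      the quantity as a Gaussian average.\<close>
    define A where "A n = (LINT x|lborel. complex_of_real (p x) * (LINT \<xi>|lborel. ft h \<xi> * (complex_of_real (gk (e n) \<xi>) * cis (x * \<xi>))))" for n
    have "A \<longlonglongrightarrow> (LINT x|lborel. complex_of_real (p x) * (LINT \<xi>|lborel. ft h \<xi> * cis (x * \<xi>)))"
      unfolding A_def
    proof (rule integral_dominated_convergence)
      show "integrable lborel (\<lambda>x. \<bar>p x\<bar> * (LINT \<xi>|lborel. cmod (ft h \<xi>)))"
        using test_fun_integrable[OF p] by simp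
      show "AE x in lborel. (\<lambda>n. complex_of_real (p x) * (LINT \<xi>|lborel. ft h \<xi> * (complex_of_real (gk (e n) \<xi>) * cis (x * \<xi>))))
          \<longlonglongrightarrow> complex_of_real (p x) * (LINT \<xi>|lborel. ft h \<xi> * cis (x * \<xi>))"
      proof (intro AE_I2 tendsto_mult_left)
        fix x
        show "(\<lambda>n. LINT \<xi>|lborel. ft h \<xi> * (complex_of_real (gk (e n) \<xi>) * cis (x * \<xi>))) \<longlonglongrightarrow> (LINT \<xi>|lborel. ft h \<xi> * cis (x * \<xi>))"
        proof (rule integral_dominated_convergence)
          show "integrable lborel (\<lambda>\<xi>. cmod (ft h \<xi>))"
            using fh by simp
          have "(\<lambda>n. ft h \<xi> * (complex_of_real (gk (e n) \<xi>) * cis (x * \<xi>))) \<longlonglongrightarrow> ft h \<xi> * (complex_of_real 1 * cis (x * \<xi>))" for \<xi>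
            by (intro tendsto_intros gk_tendsto e)
          then show "AE \<xi> in lborel. (\<lambda>n. ft h \<xi> * (complex_of_real (gk (e n) \<xi>) * cis (x * \<xi>))) \<longlonglongrightarrow> ft h \<xi> * cis (x * \<xi>)"
            by simp
          show "AE \<xi> in lborel. norm (ft h \<xi> * (complex_of_real (gk (e n) \<xi>) * cis (x * \<xi>))) \<le> cmod (ft h \<xi>)" for n
            using gk_bounds by (auto simp: norm_mult abs_of_pos intro!: mult_left_le)
        qed measurable
      qed
      show "AE x in lborel. norm (complex_of_real (p x) * (LINT \<xi>|lborel. ft h \<xi> * (complex_of_real (gk (e n) \<xi>) * cis (x * \<xi>))))
          \<le> \<bar>p x\<bar> * (LINT \<xi>|lborel. cmod (ft h \<xi>))" for n
      proof (rule AE_I2)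
        fix x
        have "cmod (LINT \<xi>|lborel. ft h \<xi> * (complex_of_real (gk (e n) \<xi>) * cis (x * \<xi>)))
           \<le> (LINT \<xi>|lborel. cmod (ft h \<xi>))"
          using gk_bounds fh by (intro integral_norm_le)
            (auto simp: norm_mult abs_of_pos intro!: mult_left_le integrable_bmult[where B = 1])
        then show "norm (complex_of_real (p x) * (LINT \<xi>|lborel. ft h \<xi> * (complex_of_real (gk (e n) \<xi>) * cis (x * \<xi>))))
          \<le> \<bar>p x\<bar> * (LINT \<xi>|lborel. cmod (ft h \<xi>))"
          unfolding norm_mult by (intro mult_mono) auto
      qed
    qed measurable
    moreover have "A \<longlonglongrightarrow> (LINT y|lborel. h y * complex_of_real (2 * pi * p y))"
    proof -
      \<comment> \<open>After rescaling, the Gaussian is fixed and \<open>n\<close> appears only in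
        the argument of \<open>p\<close>, so continuity of \<open>p\<close> and dominated
        convergence give the limit.\<close>
      define c where "c n y = (LINT z|lborel. complex_of_real (p (y + e n * z)) * complex_of_real (2 * pi * std_normal_density z))" for n y
      have An: "A n = (LINT y|lborel. h y * c n y)" for n
      proof -
        have inner: "(LINT x|lborel. complex_of_real (p x) * complex_of_real (2 * pi * normal_density x (e n) y)) = c n y" for y
        proof -
          have "e n *\<^sub>R (complex_of_real (p (y + e n * z)) * complex_of_real (2 * pi * normal_density (y + e n * z) (e n) y))
             = complex_of_real (p (y + e n * z)) * complex_of_real (2 * pi * std_normal_density z)" for z
          proof -
            have "normal_density (y + e n * z) (e n) y = std_normal_density z / e n"
              using e(1)[of n] by (simp add: normal_density_def power_mult_distrib real_sqrt_mult)
            then show ?thesis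
              using e(1)[of n] by (simp add: scaleR_conv_of_real)
          qed
          then show ?thesis
            unfolding c_def
            using lborel_integral_real_affine[of "e n" "\<lambda>x. complex_of_real (p x) * complex_of_real (2 * pi * normal_density x (e n) y)" y] e(1)[of n]
            by (simp flip: integral_scaleR_right)
        qed
        have "A n = (LINT x|lborel. complex_of_real (p x) * (LINT y|lborel. h y * complex_of_real (2 * pi * normal_density x (e n) y)))"
          unfolding A_def using e(1) by (simp only: damped_inversion[OF h])
        also have "\<dots> = (LINT y|lborel. h y * (LINT x|lborel. complex_of_real (p x) * complex_of_real (2 * pi * normal_density x (e n) y)))"
          by (rule lborel_pair.fubini_kernel[OF pint h _ gaussian_kernel_bound[OF e(1)[of n]]]) measurable
        also have "\<dots> = (LINT y|lborel. h y * c n y)"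
          by (simp only: inner)
        finally show ?thesis .
      qed
      have cb: "cmod (c n y) \<le> 2 * pi * B" for n y
      proof -
        have "cmod (c n y) \<le> (LINT z|lborel. 2 * pi * B * std_normal_density z)"
          unfolding c_def
        proof (rule integral_norm_le)
          show "integrable lborel (\<lambda>z. 2 * pi * B * std_normal_density z)" by simp
          have "integrable lborel (\<lambda>z. complex_of_real (2 * pi * std_normal_density z) * complex_of_real (p (y + e n * z)))"
            by (rule integrable_bmult[where B = B]) (use B in auto)
          then show "integrable lborel (\<lambda>z. complex_of_real (p (y + e n * z)) * complex_of_real (2 * pi * std_normal_density z))"
            by (simp only: mult.commute)
          show "norm (complex_of_real (p (y + e n * z)) * complex_of_real (2 * pi * std_normal_density z)) \<le> 2 * pi * B * std_normal_density z" for z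
            using mult_right_mono[OF B(2)[of "y + e n * z"], of "2 * pi * std_normal_density z"]
            by (simp add: norm_mult abs_mult mult_ac)
        qed
        then show ?thesis by simp
      qed
      have "(\<lambda>n. LINT y|lborel. h y * c n y) \<longlonglongrightarrow> (LINT y|lborel. h y * complex_of_real (2 * pi * p y))"
      proof (rule integral_dominated_convergence)
        show "integrable lborel (\<lambda>y. cmod (h y) * (2 * pi * B))"
          using h by simp
        show "AE y in lborel. (\<lambda>n. h y * c n y) \<longlonglongrightarrow> h y * complex_of_real (2 * pi * p y)"
        proof (intro AE_I2 tendsto_mult_left)
          fix y
          have "(\<lambda>n. c n y) \<longlonglongrightarrow> (LINT z|lborel. complex_of_real (p y) * complex_of_real (2 * pi * std_normal_density z))"
            unfolding c_def
          proof (rule integral_dominated_convergence)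
            show "integrable lborel (\<lambda>z. 2 * pi * B * std_normal_density z)" by simp
            have "(\<lambda>n. p (y + e n * z)) \<longlonglongrightarrow> p y" for z
            proof (rule isCont_tendsto_compose[OF test_fun_isCont[OF p]])
              have "(\<lambda>n. y + e n * z) \<longlonglongrightarrow> y + 0 * z"
                by (intro tendsto_intros e)
              then show "(\<lambda>n. y + e n * z) \<longlonglongrightarrow> y" by simp
            qed
            then show "AE z in lborel. (\<lambda>n. complex_of_real (p (y + e n * z)) * complex_of_real (2 * pi * std_normal_density z))
                \<longlonglongrightarrow> complex_of_real (p y) * complex_of_real (2 * pi * std_normal_density z)"
              by (intro AE_I2 tendsto_intros)
            show "AE z in lborel. norm (complex_of_real (p (y + e n * z)) * complex_of_real (2 * pi * std_normal_density z)) \<le> 2 * pi * B * std_normal_density z" for n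
            proof (rule AE_I2)
              fix z
              show "norm (complex_of_real (p (y + e n * z)) * complex_of_real (2 * pi * std_normal_density z)) \<le> 2 * pi * B * std_normal_density z"
                using mult_right_mono[OF B(2)[of "y + e n * z"], of "2 * pi * std_normal_density z"]
                by (simp add: norm_mult abs_mult mult_ac)
            qed
          qed measurable
          then show "(\<lambda>n. c n y) \<longlonglongrightarrow> complex_of_real (2 * pi * p y)"
            by (simp add: mult_ac)
        qed
        show "AE y in lborel. norm (h y * c n y) \<le> cmod (h y) * (2 * pi * B)" for n
          unfolding norm_mult using cb by (intro AE_I2 mult_left_mono) auto
        show "(\<lambda>y. h y * c n y) \<in> borel_measurable lborel" for n
          unfolding c_def by measurable
      qed measurable
      then show ?thesis by (simp add: An[abs_def])
    qed
    ultimately have eq: "(LINT x|lborel. complex_of_real (p x) * (LINT \<xi>|lborel. ft h \<xi> * cis (x * \<xi>)))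
        = (LINT y|lborel. h y * complex_of_real (2 * pi * p y))"
      by (rule LIMSEQ_unique)
    have i1: "integrable lborel (\<lambda>x. h x * complex_of_real (p x))"
      by (rule integrable_bmult[OF h, where B = B]) (use B in auto)
    have i2: "integrable lborel (\<lambda>x. ift (ft h) x * complex_of_real (p x))"
      using integrable_bmult[OF pint _ ift_bound] by (simp add: mult.commute)
    have "(LINT x|lborel. ift (ft h) x * complex_of_real (p x))
       = complex_of_real (1 / (2 * pi)) * (LINT x|lborel. complex_of_real (p x) * (LINT \<xi>|lborel. ft h \<xi> * cis (x * \<xi>)))"
      unfolding integral_mult_right_zero[symmetric]
      by (intro Bochner_Integration.integral_cong) (auto simp: ift_def ft_def mult_ac)
    also have "\<dots> = (LINT y|lborel. h y * complex_of_real (p y))"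
    proof -
      have "(LINT y|lborel. h y * complex_of_real (2 * pi * p y)) = complex_of_real (2 * pi) * (LINT y|lborel. h y * complex_of_real (p y))"
        unfolding integral_mult_right_zero[symmetric]
        by (intro Bochner_Integration.integral_cong refl) (simp add: mult_ac)
      then show ?thesis
        unfolding eq by simp
    qed
    finally show ?thesis
      using i1 i2 by (simp add: left_diff_distrib)
  qed
  have "AE x in lborel. h x - ift (ft h) x = 0"
    by (rule fundamental_lemma) (use test in auto)
  then show ?thesis by simp
qed

subsection \<open>The Plancherel inequality\<close>

text \<open>The inequality suffices here, in both directions of the transform. It comes from damping
  \<open>ft h\<close> by a Gaussian, which turns the left-hand side into a double integral against a Gaussian
  kernel, and \<open>2 |h(x)| |h(y)| \<le> |h(x)|\<^sup>2 + |h(y)|\<^sup>2\<close>.\<close>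

lemma nn_integral_normal_density: "\<epsilon> > 0 \<Longrightarrow> (\<integral>\<^sup>+y. ennreal (normal_density x \<epsilon> y) \<partial>lborel) = 1"
  by (subst nn_integral_eq_integral) auto

lemma plancherel_le:
  assumes h: "integrable lborel h" and sq: "sq_int h"
  shows "sq_int (ft h)" and "norm (L2_of (ft h)) \<le> sqrt (2 * pi) * norm (L2_of h)"
proof -
  have [measurable]: "h \<in> borel_measurable borel"
    using h by auto
  define I where "I = (LINT x|lborel. (cmod (h x))\<^sup>2)"
  have damped: "(\<integral>\<^sup>+\<xi>. ennreal ((cmod (ft h \<xi>))\<^sup>2 * gk \<epsilon> \<xi>) \<partial>lborel) \<le> ennreal (2 * pi * I)" if \<epsilon>: "\<epsilon> > 0" for \<epsilon>
  proof -
    define K where "K x = (LINT y|lborel. h y * complex_of_real (2 * pi * normal_density x \<epsilon> y))" for x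
    have gint: "integrable lborel (\<lambda>\<xi>. cnj (ft h \<xi>) * complex_of_real (gk \<epsilon> \<xi>))"
      using integrable_bmult[OF integrable_of_real[OF gk_integrable[OF \<epsilon>]], of "\<lambda>\<xi>. cnj (ft h \<xi>)" "LINT x|lborel. cmod (h x)"] ft_bound[of h]
      by (simp add: mult.commute)
    have ftK: "ft (\<lambda>\<xi>. cnj (ft h \<xi>) * complex_of_real (gk \<epsilon> \<xi>)) x = cnj (K x)" for x
    proof -
      have "K x = (LINT \<xi>|lborel. ft h \<xi> * (complex_of_real (gk \<epsilon> \<xi>) * cis (x * \<xi>)))"
        unfolding K_def by (rule damped_inversion[OF h \<epsilon>, symmetric])
      then have "cnj (K x) = (LINT \<xi>|lborel. cnj (ft h \<xi> * (complex_of_real (gk \<epsilon> \<xi>) * cis (x * \<xi>))))"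
        by (simp only: Bochner_Integration.integral_cnj)
      then show ?thesis
        unfolding ft_def by (simp add: cis_cnj mult_ac)
    qed
    have "complex_of_real (LINT \<xi>|lborel. (cmod (ft h \<xi>))\<^sup>2 * gk \<epsilon> \<xi>) = (LINT \<xi>|lborel. (cnj (ft h \<xi>) * complex_of_real (gk \<epsilon> \<xi>)) * ft h \<xi>)"
      unfolding integral_complex_of_real[symmetric]
      by (intro Bochner_Integration.integral_cong refl) (simp only: of_real_mult complex_norm_square mult_ac)
    also have "\<dots> = (LINT x|lborel. h x * cnj (K x))"
      by (subst ft_multiplication[OF gint h]) (simp only: ftK)
    finally have eq: "complex_of_real (LINT \<xi>|lborel. (cmod (ft h \<xi>))\<^sup>2 * gk \<epsilon> \<xi>) = (LINT x|lborel. h x * cnj (K x))" .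
    have Kint: "integrable lborel (\<lambda>y. h y * complex_of_real (2 * pi * normal_density x \<epsilon> y))" for x
      by (rule integrable_bmult[OF h _ gaussian_kernel_bound[OF \<epsilon>]]) measurable
    have "(\<integral>\<^sup>+x. ennreal (cmod (h x * cnj (K x))) \<partial>lborel)
      \<le> (\<integral>\<^sup>+x. \<integral>\<^sup>+y. ennreal (2 * pi * (cmod (h x) * cmod (h y) * normal_density x \<epsilon> y)) \<partial>lborel \<partial>lborel)"
    proof (rule nn_integral_mono)
      fix x
      have "ennreal (cmod (K x)) \<le> (\<integral>\<^sup>+y. ennreal (cmod (h y * complex_of_real (2 * pi * normal_density x \<epsilon> y))) \<partial>lborel)"
        unfolding K_def by (rule integral_norm_bound_ennreal[OF Kint])
      then have "ennreal (cmod (h x)) * ennreal (cmod (K x))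
          \<le> ennreal (cmod (h x)) * (\<integral>\<^sup>+y. ennreal (cmod (h y * complex_of_real (2 * pi * normal_density x \<epsilon> y))) \<partial>lborel)"
        by (rule mult_left_mono) simp
      also have "\<dots> = (\<integral>\<^sup>+y. ennreal (cmod (h x)) * ennreal (cmod (h y * complex_of_real (2 * pi * normal_density x \<epsilon> y))) \<partial>lborel)"
        by (rule nn_integral_cmult[symmetric]) measurable
      also have "\<dots> = (\<integral>\<^sup>+y. ennreal (2 * pi * (cmod (h x) * cmod (h y) * normal_density x \<epsilon> y)) \<partial>lborel)"
        by (intro nn_integral_cong) (auto simp: norm_mult abs_mult mult_ac simp flip: ennreal_mult')
      finally show "ennreal (cmod (h x * cnj (K x))) \<le> (\<integral>\<^sup>+y. ennreal (2 * pi * (cmod (h x) * cmod (h y) * normal_density x \<epsilon> y)) \<partial>lborel)"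
        by (simp add: norm_mult ennreal_mult')
    qed
    also have "\<dots> \<le> (\<integral>\<^sup>+x. \<integral>\<^sup>+y. ennreal (pi * (cmod (h x))\<^sup>2 * normal_density x \<epsilon> y) + ennreal (pi * (cmod (h y))\<^sup>2 * normal_density y \<epsilon> x) \<partial>lborel \<partial>lborel)"
    proof (intro nn_integral_mono)
      fix x y
      have "2 * (cmod (h x) * cmod (h y)) \<le> (cmod (h x))\<^sup>2 + (cmod (h y))\<^sup>2"
        using sum_squares_bound[of "cmod (h x)" "cmod (h y)"] by simp
      then have "(2 * (cmod (h x) * cmod (h y))) * (pi * normal_density x \<epsilon> y) \<le> ((cmod (h x))\<^sup>2 + (cmod (h y))\<^sup>2) * (pi * normal_density x \<epsilon> y)"
        by (intro mult_right_mono) auto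
      then have "ennreal (2 * pi * (cmod (h x) * cmod (h y) * normal_density x \<epsilon> y))
          \<le> ennreal (pi * (cmod (h x))\<^sup>2 * normal_density x \<epsilon> y + pi * (cmod (h y))\<^sup>2 * normal_density y \<epsilon> x)"
        unfolding normal_density_sym[of y \<epsilon> x] by (intro ennreal_leI) (simp add: algebra_simps)
      also have "\<dots> = ennreal (pi * (cmod (h x))\<^sup>2 * normal_density x \<epsilon> y) + ennreal (pi * (cmod (h y))\<^sup>2 * normal_density y \<epsilon> x)"
        by (rule ennreal_plus) auto
      finally show "ennreal (2 * pi * (cmod (h x) * cmod (h y) * normal_density x \<epsilon> y)) \<le> ennreal (pi * (cmod (h x))\<^sup>2 * normal_density x \<epsilon> y) + ennreal (pi * (cmod (h y))\<^sup>2 * normal_density y \<epsilon> x)" .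
    qed
    also have "\<dots> = (\<integral>\<^sup>+x. \<integral>\<^sup>+y. ennreal (pi * (cmod (h x))\<^sup>2 * normal_density x \<epsilon> y) \<partial>lborel \<partial>lborel)
        + (\<integral>\<^sup>+x. \<integral>\<^sup>+y. ennreal (pi * (cmod (h y))\<^sup>2 * normal_density y \<epsilon> x) \<partial>lborel \<partial>lborel)"
      by (simp add: nn_integral_add)
    also have "(\<integral>\<^sup>+x. \<integral>\<^sup>+y. ennreal (pi * (cmod (h y))\<^sup>2 * normal_density y \<epsilon> x) \<partial>lborel \<partial>lborel)
       = (\<integral>\<^sup>+y. \<integral>\<^sup>+x. ennreal (pi * (cmod (h y))\<^sup>2 * normal_density y \<epsilon> x) \<partial>lborel \<partial>lborel)"
      by (rule lborel_pair.Fubini') measurable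
    also have "(\<integral>\<^sup>+x. \<integral>\<^sup>+y. ennreal (pi * (cmod (h x))\<^sup>2 * normal_density x \<epsilon> y) \<partial>lborel \<partial>lborel) = ennreal (pi * I)"
    proof -
      have "(\<integral>\<^sup>+y. ennreal (pi * (cmod (h x))\<^sup>2 * normal_density x \<epsilon> y) \<partial>lborel) = ennreal (pi * (cmod (h x))\<^sup>2)" for x
        using nn_integral_normal_density[OF \<epsilon>, of x] by (simp add: ennreal_mult' nn_integral_cmult)
      then show ?thesis
        using sq_intD[OF sq] by (simp add: nn_integral_eq_integral I_def)
    qed
    finally have "(\<integral>\<^sup>+x. ennreal (cmod (h x * cnj (K x))) \<partial>lborel) \<le> ennreal (pi * I) + ennreal (pi * I)" .
    moreover have I0: "0 \<le> I" by (simp add: I_def)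
    ultimately have le: "(\<integral>\<^sup>+x. ennreal (cmod (h x * cnj (K x))) \<partial>lborel) \<le> ennreal (2 * pi * I)"
      by (simp add: mult_ac flip: ennreal_plus)
    have [measurable]: "K \<in> borel_measurable borel"
      unfolding K_def by measurable
    have hK: "integrable lborel (\<lambda>x. h x * cnj (K x))"
      by (rule integrableI_bounded) (use le in \<open>auto intro: le_less_trans\<close>)
    have "ennreal (LINT \<xi>|lborel. (cmod (ft h \<xi>))\<^sup>2 * gk \<epsilon> \<xi>) \<le> ennreal (cmod (LINT x|lborel. h x * cnj (K x)))"
      unfolding eq[symmetric] by (auto intro: ennreal_leI)
    also have "\<dots> \<le> (\<integral>\<^sup>+x. ennreal (cmod (h x * cnj (K x))) \<partial>lborel)"
      by (rule integral_norm_bound_ennreal[OF hK])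
    also note le
    also have "ennreal (LINT \<xi>|lborel. (cmod (ft h \<xi>))\<^sup>2 * gk \<epsilon> \<xi>) = (\<integral>\<^sup>+\<xi>. ennreal ((cmod (ft h \<xi>))\<^sup>2 * gk \<epsilon> \<xi>) \<partial>lborel)"
    proof (rule nn_integral_eq_integral[symmetric])
      show "integrable lborel (\<lambda>\<xi>. (cmod (ft h \<xi>))\<^sup>2 * gk \<epsilon> \<xi>)"
      proof (rule Bochner_Integration.integrable_bound)
        show "integrable lborel (\<lambda>\<xi>. (LINT x|lborel. cmod (h x))\<^sup>2 * gk \<epsilon> \<xi>)"
          using gk_integrable[OF \<epsilon>] by simp
        show "AE \<xi> in lborel. norm ((cmod (ft h \<xi>))\<^sup>2 * gk \<epsilon> \<xi>) \<le> norm ((LINT x|lborel. cmod (h x))\<^sup>2 * gk \<epsilon> \<xi>)"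
          using gk_bounds(1)[of \<epsilon>] ft_bound[of h] by (auto simp: abs_mult less_imp_le intro!: mult_right_mono power_mono)
      qed measurable
    qed (use gk_bounds in \<open>auto simp: less_imp_le\<close>)
    finally show ?thesis .
  qed
  \<comment> \<open>Along this sequence Fatou's lemma removes the damping, which also yields the
    square integrability of \<open>ft h\<close>.\<close>
  define e where "e n = inverse (real (Suc n))" for n
  have e: "e n > 0" "e \<longlonglongrightarrow> 0" for n
    unfolding e_def using LIMSEQ_inverse_real_of_nat by auto
  have "(\<integral>\<^sup>+\<xi>. ennreal ((cmod (ft h \<xi>))\<^sup>2) \<partial>lborel) = (\<integral>\<^sup>+\<xi>. liminf (\<lambda>n. ennreal ((cmod (ft h \<xi>))\<^sup>2 * gk (e n) \<xi>)) \<partial>lborel)"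
  proof (rule nn_integral_cong)
    fix \<xi>
    have "(\<lambda>n. ennreal ((cmod (ft h \<xi>))\<^sup>2 * gk (e n) \<xi>)) \<longlonglongrightarrow> ennreal ((cmod (ft h \<xi>))\<^sup>2 * 1)"
      by (intro tendsto_intros gk_tendsto e)
    then show "ennreal ((cmod (ft h \<xi>))\<^sup>2) = liminf (\<lambda>n. ennreal ((cmod (ft h \<xi>))\<^sup>2 * gk (e n) \<xi>))"
      by (intro lim_imp_Liminf[symmetric]) auto
  qed
  also have "\<dots> \<le> liminf (\<lambda>n. \<integral>\<^sup>+\<xi>. ennreal ((cmod (ft h \<xi>))\<^sup>2 * gk (e n) \<xi>) \<partial>lborel)"
    by (rule nn_integral_liminf) measurable
  also have "\<dots> \<le> ennreal (2 * pi * I)"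
    by (rule Liminf_le) (use damped e in auto)
  finally have le: "(\<integral>\<^sup>+\<xi>. ennreal ((cmod (ft h \<xi>))\<^sup>2) \<partial>lborel) \<le> ennreal (2 * pi * I)" .
  show sqf: "sq_int (ft h)"
    unfolding sq_int_def
  proof
    show "integrable lborel (\<lambda>\<xi>. (cmod (ft h \<xi>))\<^sup>2)"
      by (rule integrableI_bounded) (use le in \<open>auto intro: le_less_trans\<close>)
  qed measurable
  have "ennreal ((norm (L2_of (ft h)))\<^sup>2) \<le> ennreal (2 * pi * I)"
    using le nn_integral_eq_integral[OF sq_intD[OF sqf]] by (simp add: norm_L2_of_sq[OF sqf])
  then have "(norm (L2_of (ft h)))\<^sup>2 \<le> 2 * pi * I"
    by (subst (asm) ennreal_le_iff) (auto simp: I_def)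
  also have "\<dots> = (sqrt (2 * pi) * norm (L2_of h))\<^sup>2"
    by (simp add: power_mult_distrib norm_L2_of_sq[OF sq] I_def)
  finally show "norm (L2_of (ft h)) \<le> sqrt (2 * pi) * norm (L2_of h)"
    by (rule power2_le_imp_le) simp
qed

text \<open>Plancherel's bound gives the factor \<open>1 / sqrt (2 * pi)\<close>; the weaker factor
  1 keeps constants out of the later estimates of \<open>U\<close>.\<close>

lemma ift_sq_int:
  assumes "integrable lborel g" "sq_int g"
  shows "sq_int (ift g)" and "norm (L2_of (ift g)) \<le> norm (L2_of g)"
proof -
  have r: "sq_int (\<lambda>x. ft g (- x))"
    by (intro sq_int_reflect plancherel_le assms)
  then show sq: "sq_int (ift g)"
    unfolding ift_def by (rule sq_int_cmult)
  have "norm (L2_of (\<lambda>x. ft g (- x))) = norm (L2_of (ft g))"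
    unfolding norm_L2_of[OF r] norm_L2_of[OF plancherel_le(1)[OF assms]]
    using lborel_integral_real_affine[of "-1" "\<lambda>x. (cmod (ft g x))\<^sup>2" 0] by simp
  then have "norm (L2_of (ift g)) \<le> 1 / (2 * pi) * norm (L2_of (ft g))"
    using norm_L2_of_mono[OF sq r, of "1 / (2 * pi)"] by (simp add: ift_def norm_mult norm_divide)
  also have "\<dots> \<le> 1 / (2 * pi) * (sqrt (2 * pi) * norm (L2_of g))"
    by (intro mult_left_mono plancherel_le assms) auto
  also have "\<dots> \<le> 1 * norm (L2_of g)"
    unfolding mult.assoc[symmetric]
  proof (intro mult_right_mono)
    have "sqrt (2 * pi) \<le> 2 * pi"
      using pi_ge_two by (intro real_le_lsqrt) (auto simp: power2_eq_square)
    then show "1 / (2 * pi) * sqrt (2 * pi) \<le> 1" by simp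
  qed auto
  finally show "norm (L2_of (ift g)) \<le> norm (L2_of g)" by simp
qed

subsection \<open>The Fourier transform on \<open>L2\<close>\<close>

definition trunc :: "nat \<Rightarrow> L2 \<Rightarrow> real \<Rightarrow> complex" where
  "trunc n w x = fn_of w x * indicator {- real n..real n} x"

lemma trunc_sq_int: "sq_int (trunc n w)"
  unfolding trunc_def by (intro sq_int_indicator) auto

lemma trunc_integrable: "integrable lborel (trunc n w)"
  unfolding trunc_def by (intro truncate_integrable sq_int_fn)

lemma trunc_tendsto: "(\<lambda>n. L2_of (trunc n w)) \<longlonglongrightarrow> w"
  using L2_of_approx_truncate[OF sq_int_fn[of w]] unfolding trunc_def by simp

lemma L2_of_ft_diff_le:
  assumes "integrable lborel f" "sq_int f" "integrable lborel g" "sq_int g"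
  shows "norm (L2_of (ft f) - L2_of (ft g)) \<le> sqrt (2 * pi) * norm (L2_of f - L2_of g)"
proof -
  have "L2_of (ft f) - L2_of (ft g) = L2_of (ft (\<lambda>x. f x - g x))"
    using assms by (simp add: L2_of_diff[symmetric] plancherel_le(1) ft_diff[symmetric])
  moreover have "norm (L2_of (ft (\<lambda>x. f x - g x))) \<le> sqrt (2 * pi) * norm (L2_of (\<lambda>x. f x - g x))"
    using assms by (intro plancherel_le sq_int_diff) auto
  ultimately show ?thesis
    using assms by (simp add: L2_of_diff)
qed

text \<open>The integral defining \<open>ft\<close> takes the default value 0 for a function that is
  not integrable, so the transform is extended by continuity along truncations, which lie in both
  \<open>L\<^sup>1\<close> and \<open>L\<^sup>2\<close>.\<close>

definition FT :: "L2 \<Rightarrow> L2" where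
  "FT w = lim (\<lambda>n. L2_of (ft (trunc n w)))"

lemma FT_LIMSEQ: "(\<lambda>n. L2_of (ft (trunc n w))) \<longlonglongrightarrow> FT w"
proof -
  have C: "Cauchy (\<lambda>n. L2_of (trunc n w))"
    using trunc_tendsto LIMSEQ_imp_Cauchy by blast
  have "Cauchy (\<lambda>n. L2_of (ft (trunc n w)))"
    unfolding Cauchy_iff
  proof (intro allI impI)
    fix e :: real assume "e > 0"
    then have "e / sqrt (2 * pi) > 0" by simp
    then obtain N where N: "\<And>i j. i \<ge> N \<Longrightarrow> j \<ge> N \<Longrightarrow> norm (L2_of (trunc i w) - L2_of (trunc j w)) < e / sqrt (2 * pi)"
      using C unfolding Cauchy_iff by blast
    have "norm (L2_of (ft (trunc i w)) - L2_of (ft (trunc j w))) < e" if "i \<ge> N" "j \<ge> N" for i j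
    proof -
      have "norm (L2_of (ft (trunc i w)) - L2_of (ft (trunc j w))) \<le> sqrt (2 * pi) * norm (L2_of (trunc i w) - L2_of (trunc j w))"
        by (intro L2_of_ft_diff_le trunc_sq_int trunc_integrable)
      also have "\<dots> < sqrt (2 * pi) * (e / sqrt (2 * pi))"
        by (intro mult_strict_left_mono N that) auto
      finally show ?thesis by simp
    qed
    then show "\<exists>M. \<forall>m\<ge>M. \<forall>n\<ge>M. norm (L2_of (ft (trunc m w)) - L2_of (ft (trunc n w))) < e" by blast
  qed
  then show ?thesis
    unfolding FT_def by (simp add: Cauchy_convergent_iff convergent_LIMSEQ_iff)
qed

lemma norm_FT: "norm (FT w) \<le> sqrt (2 * pi) * norm w"
proof (rule LIMSEQ_le)
  show "(\<lambda>n. norm (L2_of (ft (trunc n w)))) \<longlonglongrightarrow> norm (FT w)"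
    by (intro tendsto_norm FT_LIMSEQ)
  show "(\<lambda>n. sqrt (2 * pi) * norm (L2_of (trunc n w))) \<longlonglongrightarrow> sqrt (2 * pi) * norm w"
    by (intro tendsto_intros trunc_tendsto)
  show "\<exists>N. \<forall>n\<ge>N. norm (L2_of (ft (trunc n w))) \<le> sqrt (2 * pi) * norm (L2_of (trunc n w))"
    by (intro exI allI impI plancherel_le trunc_sq_int trunc_integrable)
qed

lemma bounded_linear_FT: "bounded_linear FT"
proof (rule bounded_linear_intro)
  fix v w :: L2 and r :: real
  have "L2_of (ft (trunc n (v + w))) = L2_of (ft (trunc n v)) + L2_of (ft (trunc n w))" for n
  proof -
    have "ft (trunc n (v + w)) = ft (\<lambda>x. trunc n v x + trunc n w x)"
      unfolding trunc_def by (rule ft_cong_AE; measurable?)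
        (use fn_add[of v w] in eventually_elim, simp add: distrib_right)
    also have "\<dots> = (\<lambda>\<xi>. ft (trunc n v) \<xi> + ft (trunc n w) \<xi>)"
      by (intro ext ft_add trunc_integrable)
    finally show ?thesis
      by (simp add: L2_of_add plancherel_le trunc_sq_int trunc_integrable)
  qed
  then have "(\<lambda>n. L2_of (ft (trunc n (v + w)))) \<longlonglongrightarrow> FT v + FT w"
    by (simp add: tendsto_add FT_LIMSEQ)
  then show "FT (v + w) = FT v + FT w"
    by (rule LIMSEQ_unique[OF FT_LIMSEQ])
  have "L2_of (ft (trunc n (r *\<^sub>R v))) = r *\<^sub>R L2_of (ft (trunc n v))" for n
  proof -
    have "ft (trunc n (r *\<^sub>R v)) = ft (\<lambda>x. complex_of_real r * trunc n v x)"
      unfolding trunc_def by (rule ft_cong_AE; measurable?)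
        (use fn_scaleR[of r v] in eventually_elim, simp add: scaleR_conv_of_real)
    also have "\<dots> = (\<lambda>\<xi>. r *\<^sub>R ft (trunc n v) \<xi>)"
      by (simp add: ft_cmult scaleR_conv_of_real fun_eq_iff)
    finally show ?thesis
      by (simp add: L2_of_scaleR plancherel_le trunc_sq_int trunc_integrable)
  qed
  then have "(\<lambda>n. L2_of (ft (trunc n (r *\<^sub>R v)))) \<longlonglongrightarrow> r *\<^sub>R FT v"
    by (simp add: tendsto_scaleR FT_LIMSEQ)
  then show "FT (r *\<^sub>R v) = r *\<^sub>R FT v"
    by (rule LIMSEQ_unique[OF FT_LIMSEQ])
  show "norm (FT v) \<le> norm v * sqrt (2 * pi)"
    using norm_FT[of v] by (simp add: mult.commute)
qed

lemma pairing_tendsto: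
  assumes X: "X \<longlonglongrightarrow> w" and g: "sq_int g"
  shows "(\<lambda>n. LINT x|lborel. fn_of (X n) x * g x) \<longlonglongrightarrow> (LINT x|lborel. fn_of w x * g x)"
proof -
  have [measurable]: "g \<in> borel_measurable borel"
    using g by (rule sq_int_measurable)
  have "norm ((LINT x|lborel. fn_of (X n) x * g x) - (LINT x|lborel. fn_of w x * g x)) \<le> norm (X n - w) * norm (L2_of g)" for n
  proof -
    have "(LINT x|lborel. fn_of (X n) x * g x) - (LINT x|lborel. fn_of w x * g x)
        = (LINT x|lborel. fn_of (X n) x * g x - fn_of w x * g x)"
      by (intro Bochner_Integration.integral_diff[symmetric] integrable_sq_int_mult g sq_int_fn)
    also have "\<dots> = (LINT x|lborel. fn_of (X n - w) x * g x)"
      by (rule integral_cong_AE; measurable?)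
        (use fn_diff[of "X n" w] in eventually_elim, simp add: left_diff_distrib)
    finally show ?thesis
      using cauchy_schwarz_integral[OF sq_int_fn[of "X n - w"] g] by simp
  qed
  then have "\<forall>\<^sub>F n in sequentially. norm ((LINT x|lborel. fn_of (X n) x * g x) - (LINT x|lborel. fn_of w x * g x)) \<le> norm (X n - w) * norm (L2_of g)"
    by (intro always_eventually allI)
  moreover have "(\<lambda>n. norm (X n - w) * norm (L2_of g)) \<longlonglongrightarrow> 0"
    by (intro tendsto_mult_left_zero tendsto_norm_zero LIM_zero X)
  ultimately have "(\<lambda>n. (LINT x|lborel. fn_of (X n) x * g x) - (LINT x|lborel. fn_of w x * g x)) \<longlonglongrightarrow> 0"
    by (rule Lim_null_comparison)
  then show ?thesis
    by (rule LIM_zero_cancel)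
qed

text \<open>Both sides are continuous in \<open>w\<close>, and for truncations this is the
  multiplication formula. Through this identity \<open>FT\<close> can be used without returning to
  the limit in its definition.\<close>

lemma FT_pairing:
  assumes g: "integrable lborel g" "sq_int g"
  shows "(LINT \<xi>|lborel. fn_of (FT w) \<xi> * g \<xi>) = (LINT x|lborel. fn_of w x * ft g x)"
proof (rule LIMSEQ_unique[OF pairing_tendsto[OF FT_LIMSEQ g(2)]])
  have [measurable]: "g \<in> borel_measurable borel"
    using g by auto
  have "(LINT x|lborel. fn_of (L2_of (ft (trunc n w))) x * g x) = (LINT x|lborel. fn_of (L2_of (trunc n w)) x * ft g x)" for n
  proof -
    note [measurable] = sq_int_measurable[OF trunc_sq_int[of n w]]
    have "(LINT x|lborel. fn_of (L2_of (ft (trunc n w))) x * g x) = (LINT x|lborel. ft (trunc n w) x * g x)"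
      by (rule integral_cong_AE; measurable?)
        (use fn_of_L2[OF plancherel_le(1)[OF trunc_integrable trunc_sq_int, of n w]] in eventually_elim, simp)
    also have "\<dots> = (LINT x|lborel. trunc n w x * ft g x)"
      using ft_multiplication[OF g(1) trunc_integrable, of n w] by (simp add: mult.commute)
    also have "\<dots> = (LINT x|lborel. fn_of (L2_of (trunc n w)) x * ft g x)"
      by (rule integral_cong_AE; measurable?)
        (use fn_of_L2[OF trunc_sq_int, of n w] in eventually_elim, simp)
    finally show ?thesis .
  qed
  then show "(\<lambda>n. LINT x|lborel. fn_of (L2_of (ft (trunc n w))) x * g x) \<longlonglongrightarrow> (LINT x|lborel. fn_of w x * ft g x)"
    using pairing_tendsto[OF trunc_tendsto plancherel_le(1)[OF g], of w] by simp
qed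

subsection \<open>Derivatives\<close>

text \<open>\<open>Hs_deriv_on\<close> is stated with difference quotients, and this form of the
  derivative matches it.\<close>

lemma has_vector_derivative_quotient:
  "(f has_vector_derivative D) (at x within S) \<longleftrightarrow>
     ((\<lambda>y. norm ((1 / (y - x)) *\<^sub>R (f y - f x) - D)) \<longlongrightarrow> 0) (at x within S)"
proof -
  have "norm ((1 / norm (y - x)) *\<^sub>R (f y - (f x + (y - x) *\<^sub>R D))) = norm ((1 / (y - x)) *\<^sub>R (f y - f x) - D)"
    if "y \<noteq> x" for y
  proof -
    have "(1 / (y - x)) *\<^sub>R (f y - f x) - D = (1 / (y - x)) *\<^sub>R (f y - (f x + (y - x) *\<^sub>R D))"
      using that by (simp add: scaleR_diff_right scaleR_add_right)
    then show ?thesis by simp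
  qed
  then have "((\<lambda>y. norm ((1 / norm (y - x)) *\<^sub>R (f y - (f x + (y - x) *\<^sub>R D)))) \<longlongrightarrow> 0) (at x within S) \<longleftrightarrow>
     ((\<lambda>y. norm ((1 / (y - x)) *\<^sub>R (f y - f x) - D)) \<longlongrightarrow> 0) (at x within S)"
    by (intro tendsto_cong) (auto simp: eventually_at_filter)
  then show ?thesis
    unfolding has_vector_derivative_def has_derivative_within tendsto_norm_zero_iff
    by (simp add: bounded_linear_scaleR_left)
qed

lemma cis_lipschitz: "cmod (cis a - cis b) \<le> \<bar>a - b\<bar>"
proof -
  have "cis a - cis b = cis b * (cis (a - b) - 1)"
    by (simp add: algebra_simps cis_mult)
  then have "cmod (cis a - cis b) = cmod (iexp (a - b) - 1)"
    by (simp add: norm_mult cis_conv_exp)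
  then show ?thesis
    using iexp_approx1[of "a - b" 0] by simp
qed

text \<open>The difference quotients of the character are bounded by \<open>\<bar>x\<bar>\<close>,
  so \<open>x h\<close> dominates and the derivative passes under the integral.\<close>

lemma ft_DERIV:
  assumes h: "integrable lborel h" and xh: "integrable lborel (\<lambda>x. complex_of_real x * h x)"
  shows "(ft h has_vector_derivative ft (\<lambda>x. - \<i> * (complex_of_real x * h x)) \<xi>) (at \<xi>)"
proof -
  have [measurable]: "h \<in> borel_measurable borel"
    using h by auto
  define q where "q x y = (1 / (y - \<xi>)) *\<^sub>R (cis (- (x * y)) - cis (- (x * \<xi>)))" for x y
  have q_lim: "(q x \<longlongrightarrow> - \<i> * complex_of_real x * cis (- (x * \<xi>))) (at \<xi>)" for x
  proof -
    have "((\<lambda>y. cis (- (x * y))) has_vector_derivative (- \<i> * complex_of_real x * cis (- (x * \<xi>)))) (at \<xi>)"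
      unfolding has_vector_derivative_def
      by (auto intro!: derivative_eq_intros simp: fun_eq_iff scaleR_conv_of_real)
    then show ?thesis
      unfolding has_vector_derivative_quotient tendsto_norm_zero_iff q_def by (rule LIM_zero_cancel)
  qed
  have q_bd: "cmod (q x y) \<le> \<bar>x\<bar>" if "y \<noteq> \<xi>" for x y
  proof -
    have "cmod (q x y) = cmod (cis (- (x * y)) - cis (- (x * \<xi>))) / \<bar>y - \<xi>\<bar>"
      by (simp add: q_def)
    also have "\<dots> \<le> \<bar>x * \<xi> - x * y\<bar> / \<bar>y - \<xi>\<bar>"
      using cis_lipschitz[of "- (x * y)" "- (x * \<xi>)"] by (intro divide_right_mono) auto
    also have "\<dots> = \<bar>x\<bar>"
      using that by (simp add: right_diff_distrib[symmetric] abs_mult abs_minus_commute)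
    finally show ?thesis .
  qed
  have quot: "(1 / (y - \<xi>)) *\<^sub>R (ft h y - ft h \<xi>) = (LINT x|lborel. h x * q x y)" for y
  proof -
    have "ft h y - ft h \<xi> = (LINT x|lborel. h x * cis (- (x * y)) - h x * cis (- (x * \<xi>)))"
      unfolding ft_def by (intro Bochner_Integration.integral_diff[symmetric] integrable_cis h)
    then show ?thesis
      unfolding q_def by (simp only: integral_scaleR_right[symmetric] right_diff_distrib mult_scaleR_right scaleR_diff_right)
  qed
  have "((\<lambda>y. (1 / (y - \<xi>)) *\<^sub>R (ft h y - ft h \<xi>)) \<longlongrightarrow> ft (\<lambda>x. - \<i> * (complex_of_real x * h x)) \<xi>) (at \<xi>)"
    unfolding quot tendsto_at_iff_sequentially comp_def
  proof (intro allI impI)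
    fix X :: "nat \<Rightarrow> real" assume X: "\<forall>i. X i \<in> UNIV - {\<xi>}" "X \<longlonglongrightarrow> \<xi>"
    show "(\<lambda>n. LINT x|lborel. h x * q x (X n)) \<longlonglongrightarrow> ft (\<lambda>x. - \<i> * (complex_of_real x * h x)) \<xi>"
      unfolding ft_def
    proof (rule integral_dominated_convergence)
      show "integrable lborel (\<lambda>x. cmod (complex_of_real x * h x))"
        using xh by simp
      show "AE x in lborel. (\<lambda>n. h x * q x (X n)) \<longlonglongrightarrow> - \<i> * (complex_of_real x * h x) * cis (- (x * \<xi>))"
      proof (rule AE_I2)
        fix x
        have "(\<lambda>n. q x (X n)) \<longlonglongrightarrow> - \<i> * complex_of_real x * cis (- (x * \<xi>))"
          using q_lim[of x] X unfolding tendsto_at_iff_sequentially comp_def by blast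
        then have "(\<lambda>n. h x * q x (X n)) \<longlonglongrightarrow> h x * (- \<i> * complex_of_real x * cis (- (x * \<xi>)))"
          by (intro tendsto_intros)
        then show "(\<lambda>n. h x * q x (X n)) \<longlonglongrightarrow> - \<i> * (complex_of_real x * h x) * cis (- (x * \<xi>))"
          by (simp add: mult_ac)
      qed
      show "AE x in lborel. norm (h x * q x (X n)) \<le> cmod (complex_of_real x * h x)" for n
      proof (rule AE_I2)
        fix x
        have "cmod (h x) * cmod (q x (X n)) \<le> cmod (h x) * \<bar>x\<bar>"
          using X by (intro mult_left_mono q_bd) auto
        then show "norm (h x * q x (X n)) \<le> cmod (complex_of_real x * h x)"
          by (simp add: norm_mult mult.commute)
      qed
    qed (auto simp: q_def)
  qed
  then show ?thesis
    unfolding has_vector_derivative_quotient tendsto_norm_zero_iff by (rule LIM_zero)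
qed

text \<open>The integral of \<open>G(x + 1) - G(x)\<close> vanishes by translation invariance, and equals the integral
  of \<open>G'\<close> by Fubini.\<close>

lemma integral_derivative_eq_0:
  fixes G :: "real \<Rightarrow> complex"
  assumes G: "integrable lborel G" and G': "integrable lborel G'"
    and d: "\<And>x. (G has_vector_derivative G' x) (at x)"
  shows "(LINT x|lborel. G' x) = 0"
proof -
  have [measurable]: "G \<in> borel_measurable borel" "G' \<in> borel_measurable borel"
    using G G' by auto
  define f where "f y x = indicat_real {0..1} y *\<^sub>R G' (x + y)" for y x :: real
  have [measurable]: "case_prod f \<in> borel_measurable (lborel \<Otimes>\<^sub>M lborel)"
    unfolding f_def by measurable
  have shift: "integrable lborel (\<lambda>x. G' (x + y))" "(LINT x|lborel. G' (x + y)) = (LINT x|lborel. G' x)"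
    "(LINT x|lborel. cmod (G' (x + y))) = (LINT x|lborel. cmod (G' x))" for y
    using lborel_integrable_real_affine[OF G', of 1 y] lborel_integral_real_affine[of 1 G' y]
      lborel_integral_real_affine[of 1 "\<lambda>x. cmod (G' x)" y] by (simp_all add: add.commute)
  have "integrable (lborel \<Otimes>\<^sub>M lborel) (case_prod f)"
  proof (rule lborel_pair.Fubini_integrable)
    show "integrable lborel (\<lambda>y. LINT x|lborel. norm (case_prod f (y, x)))"
      by (simp add: f_def shift integrable_real_indicator)
    show "AE y in lborel. integrable lborel (\<lambda>x. case_prod f (y, x))"
      by (simp add: f_def shift)
  qed measurable
  then have "(LINT x|lborel. LINT y|lborel. f y x) = (LINT y|lborel. LINT x|lborel. f y x)"
    by (rule lborel_pair.Fubini_integral)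
  also have "\<dots> = (LINT x|lborel. G' x)"
    by (simp add: f_def shift)
  also have "(\<lambda>x. LINT y|lborel. f y x) = (\<lambda>x. G (x + 1) - G x)"
  proof
    fix x
    show "(LINT y|lborel. f y x) = G (x + 1) - G x"
    proof -
    have "(G' has_integral (G (x + 1) - G x)) {x..x + 1}"
      by (rule fundamental_theorem_of_calculus) (use d in \<open>auto intro: has_vector_derivative_at_within\<close>)
    moreover have "set_integrable lborel {x..x + 1} G'"
      unfolding set_integrable_def by (rule integrable_mult_indicator) (use G' in auto)
    ultimately have "(LINT y:{x..x + 1}|lborel. G' y) = G (x + 1) - G x"
      using set_borel_integral_eq_integral(2) by (metis integral_unique)
    moreover have "(LINT y:{x..x + 1}|lborel. G' y) = (LINT y|lborel. indicator {x..x + 1} (x + y) *\<^sub>R G' (x + y))"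
      unfolding set_lebesgue_integral_def
      using lborel_integral_real_affine[of 1 "\<lambda>y. indicator {x..x + 1} y *\<^sub>R G' y" x] by simp
    moreover have "indicator {x..x + 1} (x + y) = (indicator {0..1} y :: real)" for y
      by (simp add: indicator_def)
    ultimately show ?thesis by (simp add: f_def)
    qed
  qed
  also have "(LINT x|lborel. G (x + 1) - G x) = 0"
    using lborel_integrable_real_affine[OF G, of 1 1] lborel_integral_real_affine[of 1 G 1] G
    by (simp add: add.commute)
  finally show ?thesis ..
qed

text \<open>The derivative of \<open>h\<close> times a character has integral 0; integrability of
  \<open>h\<close> and \<open>h'\<close> replaces any assumption on boundary values.\<close>

lemma ft_derivative:
  assumes h: "integrable lborel h" and h': "integrable lborel h'"
    and d: "\<And>x. (h has_vector_derivative h' x) (at x)"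
  shows "ft h' \<xi> = \<i> * complex_of_real \<xi> * ft h \<xi>"
proof -
  let ?G' = "\<lambda>x. h' x * cis (- (x * \<xi>)) - \<i> * complex_of_real \<xi> * (h x * cis (- (x * \<xi>)))"
  have "(LINT x|lborel. ?G' x) = 0"
  proof (rule integral_derivative_eq_0)
    show "integrable lborel (\<lambda>x. h x * cis (- (x * \<xi>)))"
      by (intro integrable_cis h)
    show "integrable lborel ?G'"
      by (intro Bochner_Integration.integrable_diff integrable_mult_right integrable_cis h h')
    fix x
    have "((\<lambda>x. cis (- (x * \<xi>))) has_vector_derivative (- \<i> * complex_of_real \<xi> * cis (- (x * \<xi>)))) (at x)"
      unfolding has_vector_derivative_def
      by (auto intro!: derivative_eq_intros simp: fun_eq_iff scaleR_conv_of_real)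
    from has_vector_derivative_mult[OF d this]
    show "((\<lambda>x. h x * cis (- (x * \<xi>))) has_vector_derivative ?G' x) (at x)"
      by (simp add: algebra_simps)
  qed
  moreover have "(LINT x|lborel. ?G' x) = ft h' \<xi> - \<i> * complex_of_real \<xi> * ft h \<xi>"
    unfolding ft_def using h h' by (simp add: integrable_cis)
  ultimately show ?thesis by simp
qed

subsection \<open>Transforms of test functions\<close>

abbreviation cr :: "(real \<Rightarrow> real) \<Rightarrow> real \<Rightarrow> complex" where
  "cr p \<equiv> (\<lambda>x. complex_of_real (p x))"

lemma sq_int_cr_measurable [measurable_dest]:
  assumes "sq_int (cr u)"
  shows "u \<in> borel_measurable borel"
proof -
  note [measurable] = sq_int_measurable[OF assms]
  have "(\<lambda>x. Re (cr u x)) \<in> borel_measurable borel" by measurable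
  then show ?thesis by simp
qed

lemma test_fun_cr:
  assumes "test_fun p"
  shows "integrable lborel (cr p)" "sq_int (cr p)" "(cr p has_vector_derivative cr (deriv p) x) (at x)"
  using assms test_fun_sq_int test_fun_integrable[OF assms] test_fun_DERIV[OF assms, of x]
  by (auto simp: has_real_derivative_iff_has_vector_derivative intro: has_vector_derivative_of_real)

lemma integrable_inverse_quadratic: "integrable lborel (\<lambda>x::real. 1 / (1 + x\<^sup>2))"
  using integrable_inverse_1_plus_square by (simp add: set_integrable_def inverse_eq_divide)

text \<open>Two derivatives give quadratic decay, which makes the transform of a test function
  integrable, as inversion requires.\<close>

lemma ft_test_fun_decay:
  assumes p: "test_fun p"
  obtains K where "K \<ge> 0" "\<And>\<xi>. cmod (ft (cr p) \<xi>) \<le> K / (1 + \<xi>\<^sup>2)"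
proof -
  note p' = test_fun_deriv[OF p] and p'' = test_fun_deriv[OF test_fun_deriv[OF p]]
  have "ft (cr (deriv (deriv p))) \<xi> = - (complex_of_real (\<xi>\<^sup>2) * ft (cr p) \<xi>)" for \<xi>
  proof -
    have "ft (cr (deriv p)) \<xi> = \<i> * complex_of_real \<xi> * ft (cr p) \<xi>"
      by (intro ft_derivative test_fun_cr p p')
    moreover have "ft (cr (deriv (deriv p))) \<xi> = \<i> * complex_of_real \<xi> * ft (cr (deriv p)) \<xi>"
      by (intro ft_derivative test_fun_cr p' p'')
    ultimately show ?thesis
      by (simp add: power2_eq_square mult_ac)
  qed
  then have 2: "\<xi>\<^sup>2 * cmod (ft (cr p) \<xi>) \<le> (LINT x|lborel. cmod (cr (deriv (deriv p)) x))" for \<xi>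
    using ft_bound[of "cr (deriv (deriv p))" \<xi>] by (simp add: norm_mult norm_power)
  define K where "K = (LINT x|lborel. cmod (cr p x)) + (LINT x|lborel. cmod (cr (deriv (deriv p)) x))"
  show ?thesis
  proof
    show "0 \<le> K" by (simp add: K_def)
    fix \<xi>
    have "(1 + \<xi>\<^sup>2) * cmod (ft (cr p) \<xi>) \<le> K"
      using 2[of \<xi>] ft_bound[of "cr p" \<xi>] by (simp add: K_def distrib_right)
    moreover have "0 < 1 + \<xi>\<^sup>2" by (simp add: add_pos_nonneg)
    ultimately show "cmod (ft (cr p) \<xi>) \<le> K / (1 + \<xi>\<^sup>2)"
      by (simp add: field_simps)
  qed
qed

lemma ft_test_fun:
  assumes p: "test_fun p"
  shows "integrable lborel (ft (cr p))" "sq_int (ft (cr p))"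
    "integrable lborel (ift (cr p))" "sq_int (ift (cr p))"
proof -
  obtain K where K: "K \<ge> 0" "\<And>\<xi>. cmod (ft (cr p) \<xi>) \<le> K / (1 + \<xi>\<^sup>2)"
    using ft_test_fun_decay[OF p] by blast
  have [measurable]: "p \<in> borel_measurable borel"
    by (rule test_fun_measurable[OF p])
  have "integrable lborel (\<lambda>x. K * (1 / (1 + x\<^sup>2)))"
    using integrable_inverse_quadratic by (intro integrable_mult_right)
  then show i: "integrable lborel (ft (cr p))"
    by (rule Bochner_Integration.integrable_bound) (use K in \<open>auto intro: order_trans[OF _ abs_ge_self]\<close>)
  show "sq_int (ft (cr p))" "sq_int (ift (cr p))"
    by (intro plancherel_le ift_sq_int test_fun_cr p)+
  show "integrable lborel (ift (cr p))"
    using lborel_integrable_real_affine[OF i, of "-1" 0] unfolding ift_def by simp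
qed

lemma ft_ift_test:
  assumes p: "test_fun p"
  shows "AE x in lborel. ft (ift (cr p)) x = cr p x"
proof -
  have "ft (ift (cr p)) x = ift (ft (cr p)) x" for x
    unfolding ift_def ft_cmult ft_reflect ..
  then show ?thesis
    using ft_inversion[OF test_fun_cr(1)[OF p] ft_test_fun(1)[OF p]] by auto
qed

text \<open>A test function \<open>p\<close> is almost everywhere the transform of
  \<open>ift p\<close>, so by duality an element with vanishing transform pairs to 0 with every test
  function.\<close>

lemma FT_inj:
  assumes "FT v = FT w"
  shows "v = w"
proof -
  have z: "FT (v - w) = 0"
    using assms by (simp add: linear_diff bounded_linear.linear[OF bounded_linear_FT])
  have "AE x in lborel. fn_of (v - w) x = 0"
  proof (rule fundamental_lemma)
    fix p assume p: "test_fun p"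
    have [measurable]: "p \<in> borel_measurable borel"
      by (rule test_fun_measurable[OF p])
    show "integrable lborel (\<lambda>x. fn_of (v - w) x * cr p x)"
      by (intro integrable_sq_int_mult sq_int_fn test_fun_cr p)
    have "(LINT x|lborel. fn_of (v - w) x * cr p x) = (LINT x|lborel. fn_of (v - w) x * ft (ift (cr p)) x)"
      by (rule integral_cong_AE; measurable?) (use ft_ift_test[OF p] in eventually_elim, simp)
    also have "\<dots> = (LINT x|lborel. fn_of (FT (v - w)) x * ift (cr p) x)"
      by (rule FT_pairing[symmetric]) (intro ft_test_fun p)+
    also have "\<dots> = (LINT x|(lborel::real measure). 0)"
      unfolding z by (rule integral_cong_AE; measurable?) (use fn_0 in eventually_elim, simp)
    finally show "(LINT x|lborel. fn_of (v - w) x * cr p x) = 0" by simp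
  qed measurable
  then have "AE x in lborel. fn_of (v - w) x = fn_of 0 x"
    using fn_0 by (auto elim: eventually_elim2)
  then show ?thesis
    using L2_eqI by (metis eq_iff_diff_eq_0)
qed

text \<open>\<open>ift g\<close> need not be integrable, so \<open>ft_inversion\<close> cannot be
  applied to \<open>g\<close> itself; duality transfers it to test functions.\<close>

lemma FT_ift:
  assumes g: "integrable lborel g" "sq_int g"
  shows "FT (L2_of (ift g)) = L2_of g"
proof (rule L2_eqI)
  have [measurable]: "g \<in> borel_measurable borel"
    using g by auto
  have "AE \<xi> in lborel. fn_of (FT (L2_of (ift g))) \<xi> - g \<xi> = 0"
  proof (rule fundamental_lemma)
    fix p assume p: "test_fun p"
    have [measurable]: "p \<in> borel_measurable borel"
      by (rule test_fun_measurable[OF p])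
    have int: "integrable lborel (\<lambda>x. fn_of (FT (L2_of (ift g))) x * cr p x)" "integrable lborel (\<lambda>x. g x * cr p x)"
      by (intro integrable_sq_int_mult sq_int_fn test_fun_cr p g)+
    then show "integrable lborel (\<lambda>x. (fn_of (FT (L2_of (ift g))) x - g x) * cr p x)"
      by (simp add: left_diff_distrib)
    have "(LINT x|lborel. fn_of (FT (L2_of (ift g))) x * cr p x) = (LINT x|lborel. fn_of (L2_of (ift g)) x * ft (cr p) x)"
      by (intro FT_pairing test_fun_cr p)
    also have "\<dots> = (LINT x|lborel. ift g x * ft (cr p) x)"
      by (rule integral_cong_AE; measurable?) (use fn_of_L2[OF ift_sq_int(1)[OF g]] in eventually_elim, simp)
    also have "\<dots> = (LINT x|lborel. ft g x * ift (cr p) x)"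
      using lborel_integral_real_affine[of "-1" "\<lambda>x. ift g x * ft (cr p) x" 0] by (simp add: ift_def mult_ac)
    also have "\<dots> = (LINT x|lborel. g x * ft (ift (cr p)) x)"
      using ft_multiplication[OF ft_test_fun(3)[OF p] g(1)] by (simp add: mult.commute)
    also have "\<dots> = (LINT x|lborel. g x * cr p x)"
      by (rule integral_cong_AE; measurable?) (use ft_ift_test[OF p] in eventually_elim, simp)
    finally show "(LINT x|lborel. (fn_of (FT (L2_of (ift g))) x - g x) * cr p x) = 0"
      using int by (simp add: left_diff_distrib)
  qed measurable
  then show "AE \<xi> in lborel. fn_of (FT (L2_of (ift g))) \<xi> = fn_of (L2_of g) \<xi>"
    using fn_of_L2[OF g(2)] by eventually_elim simp
qed

lemma is_fourier_FT:
  assumes u: "sq_int (cr u)"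
  shows "is_fourier u (fn_of (FT (L2_of (cr u))))"
  unfolding is_fourier_def
proof (intro conjI allI impI)
  fix p assume p: "test_fun p"
  show "integrable lborel (\<lambda>x. cr u x * fourier p x)"
    unfolding fourier_eq_ft by (intro integrable_sq_int_mult u ft_test_fun p)
  show "integrable lborel (\<lambda>x. fn_of (FT (L2_of (cr u))) x * cr p x)"
    by (intro integrable_sq_int_mult sq_int_fn test_fun_cr p)
  note [measurable] = sq_int_cr_measurable[OF u] test_fun_measurable[OF p]
  have "(LINT x|lborel. cr u x * fourier p x) = (LINT x|lborel. fn_of (L2_of (cr u)) x * fourier p x)"
    unfolding fourier_eq_ft
    by (rule integral_cong_AE; measurable?) (use fn_of_L2[OF u] in eventually_elim, simp)
  also have "\<dots> = (LINT x|lborel. fn_of (FT (L2_of (cr u))) x * cr p x)"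
    unfolding fourier_eq_ft by (intro FT_pairing[symmetric] test_fun_cr p)
  finally show "(LINT x|lborel. cr u x * fourier p x) = (LINT x|lborel. fn_of (FT (L2_of (cr u))) x * cr p x)" .
qed auto

text \<open>This makes the choice in \<open>fourier_rep\<close> harmless: two candidates differ on a
  null set only.\<close>

lemma is_fourier_unique:
  assumes "is_fourier u g" "is_fourier u g'"
  shows "AE \<xi> in lborel. g \<xi> = g' \<xi>"
proof -
  have "AE \<xi> in lborel. g \<xi> - g' \<xi> = 0"
    by (rule fundamental_lemma) (use assms in \<open>auto simp: is_fourier_def left_diff_distrib\<close>)
  then show ?thesis by simp
qed

text \<open>Neither \<open>h\<close> nor \<open>h'\<close> need be integrable, but their products
  with transforms of test functions are. Integration by parts moves the derivative to
  \<open>ft p\<close>, where it becomes multiplication of \<open>p\<close> by the variable.\<close>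

lemma FT_derivative:
  assumes h: "sq_int (cr h)" and h': "sq_int (cr h')"
    and d: "\<And>x. (h has_real_derivative h' x) (at x)"
  shows "AE \<xi> in lborel. fn_of (FT (L2_of (cr h'))) \<xi> = \<i> * complex_of_real \<xi> * fn_of (FT (L2_of (cr h))) \<xi>"
proof -
  have "AE \<xi> in lborel. fn_of (FT (L2_of (cr h'))) \<xi> - \<i> * complex_of_real \<xi> * fn_of (FT (L2_of (cr h))) \<xi> = 0"
  proof (rule fundamental_lemma)
    fix p assume p: "test_fun p"
    let ?q = "\<lambda>x. x * p x"
    note q = test_fun_times_id[OF p]
    note [measurable] = sq_int_cr_measurable[OF h] sq_int_cr_measurable[OF h'] test_fun_measurable[OF p]
    have FTp: "(LINT \<xi>|lborel. fn_of (FT (L2_of (cr k))) \<xi> * cr r \<xi>) = (LINT x|lborel. cr k x * ft (cr r) x)"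
      if k: "sq_int (cr k)" and r: "test_fun r" for k r
    proof -
      note [measurable] = sq_int_cr_measurable[OF k] test_fun_measurable[OF r]
      have "(LINT \<xi>|lborel. fn_of (FT (L2_of (cr k))) \<xi> * cr r \<xi>) = (LINT x|lborel. fn_of (L2_of (cr k)) x * ft (cr r) x)"
        by (intro FT_pairing test_fun_cr r)
      also have "\<dots> = (LINT x|lborel. cr k x * ft (cr r) x)"
        by (rule integral_cong_AE; measurable?) (use fn_of_L2[OF k] in eventually_elim, simp)
      finally show ?thesis .
    qed
    have int: "integrable lborel (\<lambda>\<xi>. fn_of (FT (L2_of (cr h'))) \<xi> * cr p \<xi>)"
      "integrable lborel (\<lambda>\<xi>. fn_of (FT (L2_of (cr h))) \<xi> * cr ?q \<xi>)"
      by (intro integrable_sq_int_mult sq_int_fn test_fun_cr p q)+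
    have eq: "(fn_of (FT (L2_of (cr h'))) \<xi> - \<i> * complex_of_real \<xi> * fn_of (FT (L2_of (cr h))) \<xi>) * cr p \<xi>
       = fn_of (FT (L2_of (cr h'))) \<xi> * cr p \<xi> - \<i> * (fn_of (FT (L2_of (cr h))) \<xi> * cr ?q \<xi>)" for \<xi>
      by (simp add: algebra_simps)
    show "integrable lborel (\<lambda>\<xi>. (fn_of (FT (L2_of (cr h'))) \<xi> - \<i> * complex_of_real \<xi> * fn_of (FT (L2_of (cr h))) \<xi>) * cr p \<xi>)"
      unfolding eq using int by simp
    let ?G' = "\<lambda>x. cr h' x * ft (cr p) x - \<i> * (cr h x * ft (cr ?q) x)"
    have int2: "integrable lborel (\<lambda>x. cr h' x * ft (cr p) x)" "integrable lborel (\<lambda>x. cr h x * ft (cr ?q) x)"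
      by (intro integrable_sq_int_mult h h' ft_test_fun p q)+
    have "(LINT x|lborel. ?G' x) = 0"
    proof (rule integral_derivative_eq_0)
      show "integrable lborel (\<lambda>x. cr h x * ft (cr p) x)"
        by (intro integrable_sq_int_mult h ft_test_fun p)
      show "integrable lborel ?G'"
        using int2 by simp
      fix x
      have 1: "(cr h has_vector_derivative cr h' x) (at x)"
        using d by (auto simp: has_real_derivative_iff_has_vector_derivative intro: has_vector_derivative_of_real)
      have 2: "(ft (cr p) has_vector_derivative - \<i> * ft (cr ?q) x) (at x)"
        using ft_DERIV[OF test_fun_cr(1)[OF p], of x] test_fun_cr(1)[OF q] unfolding ft_cmult by simp
      from has_vector_derivative_mult[OF 1 2]
      show "((\<lambda>x. cr h x * ft (cr p) x) has_vector_derivative ?G' x) (at x)"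
        by (simp add: algebra_simps)
    qed
    then have "(LINT x|lborel. cr h' x * ft (cr p) x) = \<i> * (LINT x|lborel. cr h x * ft (cr ?q) x)"
      using int2 by simp
    then show "(LINT \<xi>|lborel. (fn_of (FT (L2_of (cr h'))) \<xi> - \<i> * complex_of_real \<xi> * fn_of (FT (L2_of (cr h))) \<xi>) * cr p \<xi>) = 0"
      unfolding eq using int FTp[OF h' p] FTp[OF h q] by simp
  qed measurable
  then show ?thesis by simp
qed

subsection \<open>Sobolev weights\<close>

text \<open>A power of the Japanese bracket; with the exponent halved, its square is the weight in
  \<open>in_Hs\<close> and \<open>Hs_norm\<close>.\<close>

definition jb :: "real \<Rightarrow> real \<Rightarrow> real" where
  "jb \<sigma> \<xi> = (1 + \<xi>\<^sup>2) powr (\<sigma> / 2)"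

lemma jb_measurable [measurable]: "jb \<sigma> \<in> borel_measurable borel"
  unfolding jb_def by measurable

lemma jb_pos [simp]: "0 < jb \<sigma> \<xi>"
proof -
  have "0 < 1 + \<xi>\<^sup>2" by (simp add: add_pos_nonneg)
  then show ?thesis by (simp add: jb_def)
qed

lemma jb_nonneg [simp]: "0 \<le> jb \<sigma> \<xi>"
  by (simp add: less_imp_le)

lemma jb_nz [simp]: "jb \<sigma> \<xi> \<noteq> 0"
  using jb_pos[of \<sigma> \<xi>] by linarith

lemma jb_add: "jb (\<sigma> + \<tau>) \<xi> = jb \<sigma> \<xi> * jb \<tau> \<xi>"
  by (simp add: jb_def add_divide_distrib powr_add)

lemma jb_0 [simp]: "jb 0 \<xi> = 1"
proof -
  have "1 + \<xi>\<^sup>2 \<noteq> 0" using zero_le_power2[of \<xi>] by linarith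
  then show ?thesis by (simp add: jb_def)
qed

lemma jb_cancel [simp]: "jb \<sigma> \<xi> * jb (- \<sigma>) \<xi> = 1" "jb (- \<sigma>) \<xi> * jb \<sigma> \<xi> = 1"
  by (simp_all flip: jb_add)

lemma jb_mono: "\<sigma> \<le> \<tau> \<Longrightarrow> jb \<sigma> \<xi> \<le> jb \<tau> \<xi>"
  unfolding jb_def by (intro powr_mono) auto

lemma jb_sq: "(jb \<sigma> \<xi>)\<^sup>2 = (1 + \<xi>\<^sup>2) powr \<sigma>"
  by (simp add: power2_eq_square jb_def powr_add[symmetric])

lemma jb_2: "jb 2 \<xi> = 1 + \<xi>\<^sup>2"
  by (simp add: jb_def add_pos_nonneg)

lemma jb_minus [simp]: "jb \<sigma> (- \<xi>) = jb \<sigma> \<xi>"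
  by (simp add: jb_def)

lemma abs_power_le_jb: "\<bar>\<xi>\<bar> ^ j \<le> jb (real j) \<xi>"
proof -
  have "\<bar>\<xi>\<bar> = sqrt (\<xi>\<^sup>2)" by simp
  also have "\<dots> \<le> sqrt (1 + \<xi>\<^sup>2)" by (intro real_sqrt_le_mono) simp
  finally have "\<bar>\<xi>\<bar> ^ j \<le> sqrt (1 + \<xi>\<^sup>2) ^ j" by (intro power_mono) auto
  also have "\<dots> = jb (real j) \<xi>"
  proof -
    have "0 < 1 + \<xi>\<^sup>2" by (simp add: add_pos_nonneg)
    then show ?thesis
      unfolding jb_def by (simp add: powr_half_sqrt[symmetric] powr_realpow[symmetric] powr_powr)
  qed
  finally show ?thesis .
qed

text \<open>A weight of integer order is controlled by the function itself and its derivative of top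
  order; intermediate derivatives do not enter.\<close>

lemma jb_le_power: "jb (real m) \<xi> \<le> 2 ^ m * (1 + \<bar>\<xi>\<bar> ^ m)"
proof -
  have p: "0 < 1 + \<xi>\<^sup>2" by (simp add: add_pos_nonneg)
  have "jb (real m) \<xi> = sqrt (1 + \<xi>\<^sup>2) ^ m"
    using p unfolding jb_def by (simp add: powr_half_sqrt[symmetric] powr_realpow[symmetric] powr_powr)
  also have "\<dots> \<le> (1 + \<bar>\<xi>\<bar>) ^ m"
    by (intro power_mono real_le_lsqrt) (auto simp: power2_sum)
  also have "\<dots> \<le> (2 * max 1 \<bar>\<xi>\<bar>) ^ m"
    by (intro power_mono) auto
  also have "\<dots> \<le> 2 ^ m * (1 + \<bar>\<xi>\<bar> ^ m)"
    unfolding power_mult_distrib by (intro mult_left_mono) (auto simp: max_def)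
  finally show ?thesis .
qed

text \<open>The source of the hypothesis \<open>s > 1 / 2\<close>: outside \<open>{-1..1}\<close>
  the weight is compared with \<open>\<bar>x\<bar>\<close> to the power
  \<open>- 2 \<sigma>\<close>.\<close>

lemma weight_integrable:
  assumes "\<sigma> > 1 / 2"
  shows "integrable lborel (\<lambda>x::real. (1 + x\<^sup>2) powr (- \<sigma>))"
proof -
  define F where "F x = indicator {1..} x * x powr (- (2 * \<sigma>))" for x :: real
  have [measurable]: "F \<in> borel_measurable borel"
    unfolding F_def by measurable
  have "((\<lambda>x. if x \<in> {1..} then x powr (- (2 * \<sigma>)) else 0) has_integral -(1 powr (- (2 * \<sigma>) + 1)) / (- (2 * \<sigma>) + 1)) UNIV"
    unfolding has_integral_restrict_UNIV using assms by (intro has_integral_powr_to_inf) auto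
  moreover have "(\<lambda>x. if x \<in> {1..} then x powr (- (2 * \<sigma>)) else 0) = F"
    by (auto simp: F_def indicator_def)
  ultimately have hi: "(F has_integral -(1 powr (- (2 * \<sigma>) + 1)) / (- (2 * \<sigma>) + 1)) UNIV"
    by (simp only:)
  have "(\<integral>\<^sup>+x. ennreal (F x) \<partial>lborel) = ennreal (-(1 powr (- (2 * \<sigma>) + 1)) / (- (2 * \<sigma>) + 1))"
    by (rule nn_integral_has_integral_lborel[OF _ _ hi]) (measurable, simp add: F_def)
  then have F: "integrable lborel F"
    by (intro integrableI_nonneg) (auto simp: F_def)
  have "integrable lborel (\<lambda>x. indicator {-1..1} x + (F x + F (- x)))"
    using F lborel_integrable_real_affine[OF F, of "-1" 0]
    by (intro Bochner_Integration.integrable_add) (auto simp: integrable_real_indicator)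
  then show ?thesis
  proof (rule Bochner_Integration.integrable_bound)
    show "AE x in lborel. norm ((1 + x\<^sup>2) powr (- \<sigma>)) \<le> norm (indicator {-1..1} x + (F x + F (- x)))"
    proof (rule AE_I2)
      fix x :: real
      have F0: "0 \<le> F y" for y by (simp add: F_def)
      have "(1 + x\<^sup>2) powr (- \<sigma>) \<le> indicator {-1..1} x + (F x + F (- x))"
      proof (cases "\<bar>x\<bar> \<le> 1")
        case True
        have "(1 + x\<^sup>2) powr (- \<sigma>) \<le> 1 powr (- \<sigma>)"
          using assms by (intro powr_mono2') auto
        moreover have "x \<in> {-1..1}" using True by auto
        ultimately show ?thesis using F0[of x] F0[of "- x"] by simp
      next
        case False
        have "(1 + x\<^sup>2) powr (- \<sigma>) \<le> (\<bar>x\<bar> ^ 2) powr (- \<sigma>)"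
          using assms False by (intro powr_mono2') auto
        also have "\<dots> = \<bar>x\<bar> powr (- (2 * \<sigma>))"
        proof -
          have "\<bar>x\<bar> ^ 2 = \<bar>x\<bar> powr 2"
            using False powr_realpow[of "\<bar>x\<bar>" 2] by simp
          then show ?thesis by (simp only: powr_powr) simp
        qed
        also have "\<dots> \<le> F x + F (- x)"
          using False by (cases "x > 0") (auto simp: F_def)
        finally show ?thesis by (simp add: indicator_def)
      qed
      then show "norm ((1 + x\<^sup>2) powr (- \<sigma>)) \<le> norm (indicator {-1..1} x + (F x + F (- x)))"
        using F0[of x] F0[of "- x"] by simp
    qed
  qed measurable
qed

lemma jb_sq_int:
  assumes "\<sigma> > 1 / 2"
  shows "sq_int (cr (jb (- \<sigma>)))"
  unfolding sq_int_def using weight_integrable[OF assms] by (simp add: jb_sq)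

section \<open>A local Landau--Kolmogorov inequality\<close>

lemma max_attained_interval:
  fixes g :: "real \<Rightarrow> real"
  assumes "continuous_on {p..p+1} g"
  obtains x0 where "x0 \<in> {p..p+1}" "\<And>x. x \<in> {p..p+1} \<Longrightarrow> \<bar>g x\<bar> \<le> \<bar>g x0\<bar>"
proof -
  have "continuous_on {p..p+1} (\<lambda>x. \<bar>g x\<bar>)"
    using assms by (intro continuous_intros)
  from continuous_attains_sup[OF _ _ this] that show ?thesis by auto
qed

text \<open>A free scale \<open>h\<close> takes the place of the usual product of powers; the
  optimal scale is inserted later. The bound \<open>h \<le> 1\<close> keeps a step of length
  \<open>h / 2\<close> inside the unit window in one of the two directions. The constant depends on
  neither the window, nor the scale, nor the function.\<close>

definition interpolation_constant :: "nat \<Rightarrow> real \<Rightarrow> bool" where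
  "interpolation_constant m C \<longleftrightarrow> (\<forall>(D :: nat \<Rightarrow> real \<Rightarrow> real) p h a S. 0 < h \<longrightarrow> h \<le> 1 \<longrightarrow> 0 \<le> a \<longrightarrow> 0 \<le> S \<longrightarrow>
     (\<forall>k<m. \<forall>x. (D k has_real_derivative D (Suc k) x) (at x)) \<longrightarrow>
     (\<forall>x\<in>{p..p+1}. \<bar>D 0 x\<bar> \<le> a) \<longrightarrow> (\<forall>x\<in>{p..p+1}. \<bar>D m x\<bar> \<le> S) \<longrightarrow>
     (\<forall>k\<le>m. \<forall>x\<in>{p..p+1}. h ^ k * \<bar>D k x\<bar> \<le> C * (a + h ^ m * S)))"

lemma interpolation_constantD:
  assumes "interpolation_constant m C" "0 < h" "h \<le> 1" "0 \<le> a" "0 \<le> S"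
    "\<And>k x. k < m \<Longrightarrow> (D k has_real_derivative D (Suc k) x) (at x)"
    "\<And>x. x \<in> {p..p+1} \<Longrightarrow> \<bar>D 0 x\<bar> \<le> a" "\<And>x. x \<in> {p..p+1} \<Longrightarrow> \<bar>D m x\<bar> \<le> S"
    "k \<le> m" "x \<in> {p..p+1}"
  shows "h ^ k * \<bar>D k x\<bar> \<le> C * (a + h ^ m * S)"
  using assms(1)[unfolded interpolation_constant_def, rule_format, of h a S D p k x] assms(2-) by blast

text \<open>Induction step: let \<open>\<sigma>\<close> be the maximum of
  \<open>\<bar>D m\<bar>\<close> on the window. The mean value theorem over a step
  \<open>h / 2\<close> expresses a value of \<open>D m\<close> through values of
  \<open>D (m - 1)\<close>, and on that step \<open>D m\<close> varies by at most
  \<open>S h / 2\<close>. The induction hypothesis bounds \<open>D (m - 1)\<close> in terms of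
  \<open>\<sigma>\<close> again; at the smaller scale \<open>\<epsilon> h\<close> the coefficient of
  \<open>\<sigma>\<close> is small enough to be absorbed.\<close>

lemma landau_kolmogorov_local:
  assumes "m \<ge> 1"
  shows "\<exists>C\<ge>1. interpolation_constant m C"
  using assms
proof (induction m rule: dec_induct)
  case base
  have "interpolation_constant 1 1"
    unfolding interpolation_constant_def
  proof (intro allI impI ballI)
    fix D :: "nat \<Rightarrow> real \<Rightarrow> real" and p h a S x :: real and k :: nat
    assume *: "0 < h" "h \<le> 1" "0 \<le> a" "0 \<le> S"
      "\<forall>x\<in>{p..p+1}. \<bar>D 0 x\<bar> \<le> a" "\<forall>x\<in>{p..p+1}. \<bar>D 1 x\<bar> \<le> S" "k \<le> 1" "x \<in> {p..p+1}"
    then consider "k = 0" | "k = 1" by linarith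
    then show "h ^ k * \<bar>D k x\<bar> \<le> 1 * (a + h ^ 1 * S)"
    proof cases
      case 1
      with * have "\<bar>D k x\<bar> \<le> a" "0 \<le> h * S" by auto
      with 1 show ?thesis by simp
    next
      case 2
      from * have "h * \<bar>D 1 x\<bar> \<le> h * S" by (intro mult_left_mono) auto
      then have "h * \<bar>D 1 x\<bar> \<le> a + h * S" using * by linarith
      then show ?thesis by (simp only: 2 power_one_right mult_1)
    qed
  qed
  then show ?case by blast
next
  case (step m)
  then obtain C where C: "C \<ge> 1" "interpolation_constant m C" by blast
  \<comment> \<open>With \<open>C \<epsilon> = 1 / 8\<close> the term in \<open>\<sigma>\<close> on
    the right is a quarter of \<open>h ^ m * \<sigma>\<close>, against one half on the left.\<close>
  define \<epsilon> where "\<epsilon> = 1 / (8 * C)"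
  have \<epsilon>: "0 < \<epsilon>" "\<epsilon> \<le> 1" "8 * C * \<epsilon> = 1"
    using C by (auto simp: \<epsilon>_def)
  \<comment> \<open>The second entry is the coefficient of \<open>a\<close> that remains after
    absorption and multiplication by 4.\<close>
  define C1 where "C1 = max 1 (8 * C / \<epsilon> ^ (m - 1))"
  have C1: "C1 \<ge> 1" "8 * C / \<epsilon> ^ (m - 1) \<le> C1"
    by (auto simp: C1_def)
  obtain m' where m': "m = Suc m'"
    using step by (cases m) auto
  have "interpolation_constant (Suc m) (C * (1 + C1))"
    unfolding interpolation_constant_def
  proof (intro allI impI ballI)
    fix D :: "nat \<Rightarrow> real \<Rightarrow> real" and p h a S x :: real and k :: nat
    assume h: "0 < h" "h \<le> 1" and aS: "0 \<le> a" "0 \<le> S"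
      and D: "\<forall>k<Suc m. \<forall>x. (D k has_real_derivative D (Suc k) x) (at x)"
      and D0: "\<forall>x\<in>{p..p+1}. \<bar>D 0 x\<bar> \<le> a" and DS: "\<forall>x\<in>{p..p+1}. \<bar>D (Suc m) x\<bar> \<le> S"
      and k: "k \<le> Suc m" and x: "x \<in> {p..p+1}"
    have "continuous_on {p..p+1} (D m)"
      using D by (meson DERIV_isCont continuous_at_imp_continuous_on lessI)
    then obtain x0 where x0: "x0 \<in> {p..p+1}" "\<And>x. x \<in> {p..p+1} \<Longrightarrow> \<bar>D m x\<bar> \<le> \<bar>D m x0\<bar>"
      using max_attained_interval by blast
    define \<sigma> where "\<sigma> = \<bar>D m x0\<bar>"
    have IH: "h' ^ j * \<bar>D j y\<bar> \<le> C * (a + h' ^ m * \<sigma>)" if "0 < h'" "h' \<le> 1" "j \<le> m" "y \<in> {p..p+1}" for h' j y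
      by (rule interpolation_constantD[OF C(2), where p = p]) (use that D D0 x0 aS in \<open>auto simp: \<sigma>_def\<close>)
    \<comment> \<open>Since \<open>h \<le> 1\<close>, one of the two directions stays inside the
      window.\<close>
    define y where "y = (if x0 + h / 2 \<le> p + 1 then x0 + h / 2 else x0 - h / 2)"
    have y: "y \<in> {p..p+1}" "\<bar>y - x0\<bar> = h / 2"
      using x0(1) h by (auto simp: y_def)
    have Dm': "(D m' has_real_derivative D m x) (at x)" for x
      using D m' by auto
    have Dm: "(D m has_real_derivative D (Suc m) x) (at x)" for x
      using D by auto
    define T where "T = C * (a + (\<epsilon> * h) ^ m * \<sigma>) / (\<epsilon> * h) ^ m'"
    have T: "\<bar>D m' z\<bar> \<le> T" if "z \<in> {p..p+1}" for z
      using IH[of "\<epsilon> * h" m' z] that h \<epsilon> m' unfolding T_def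
      by (simp add: pos_le_divide_eq mult.commute mult_le_one)
    obtain z where z: "z \<in> {p..p+1}" "\<bar>z - x0\<bar> \<le> h / 2" "D m' y - D m' x0 = (y - x0) * D m z"
    proof (cases "x0 < y")
      case True
      obtain z where "x0 < z" "z < y" "D m' y - D m' x0 = (y - x0) * D m z"
        using MVT2[OF True, of "D m'" "D m"] Dm' by blast
      then show ?thesis
        using that[of z] x0(1) y True by auto
    next
      case False
      then have "y < x0" using y h by auto
      then obtain z where "y < z" "z < x0" "D m' x0 - D m' y = (x0 - y) * D m z"
        using MVT2[of y x0 "D m'" "D m"] Dm' by blast
      then show ?thesis
        using that[of z] x0(1) y by (auto simp: algebra_simps)
    qed
    have "\<bar>D m z - D m x0\<bar> \<le> S * \<bar>z - x0\<bar>"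
      using field_differentiable_bound[of "{p..p+1}" "D m" "D (Suc m)" S z x0] Dm DS z x0(1)
      by (auto intro: has_field_derivative_at_within)
    also have "\<dots> \<le> S * (h / 2)"
      using z aS by (intro mult_left_mono) auto
    finally have "\<sigma> \<le> \<bar>D m z\<bar> + S * (h / 2)"
      unfolding \<sigma>_def by linarith
    then have "h / 2 * \<sigma> \<le> h / 2 * (\<bar>D m z\<bar> + S * (h / 2))"
      using h by (intro mult_left_mono) auto
    also have "\<dots> = \<bar>(y - x0) * D m z\<bar> + h\<^sup>2 / 4 * S"
      unfolding abs_mult y(2) by (simp add: algebra_simps power2_eq_square)
    also have "\<bar>(y - x0) * D m z\<bar> \<le> 2 * T"
      using T[OF y(1)] T[OF x0(1)] z(3) by linarith
    finally have "h ^ m' * (h / 2 * \<sigma>) \<le> h ^ m' * (2 * T + h\<^sup>2 / 4 * S)"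
      using h by (intro mult_left_mono) auto
    moreover have "h ^ m' * T = C / \<epsilon> ^ m' * a + C * \<epsilon> * (h ^ m * \<sigma>)"
      using h \<epsilon> unfolding T_def m' by (simp add: power_mult_distrib field_simps)
    ultimately have "h ^ m * \<sigma> / 2 \<le> 2 * (C / \<epsilon> ^ m' * a) + 2 * (C * \<epsilon>) * (h ^ m * \<sigma>) + h ^ Suc m * S / 4"
      unfolding m' by (simp add: algebra_simps power2_eq_square)
    moreover have "C * \<epsilon> = 1 / 8"
      using \<epsilon> by simp
    ultimately have "h ^ m * \<sigma> \<le> 8 * C / \<epsilon> ^ m' * a + h ^ Suc m * S"
      by (simp add: field_simps)
    also have "\<dots> \<le> C1 * a + C1 * (h ^ Suc m * S)"
    proof (rule add_mono)
      show "8 * C / \<epsilon> ^ m' * a \<le> C1 * a"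
        using C1(2) aS m' by (intro mult_right_mono) auto
      have "0 \<le> h ^ Suc m * S"
        using h aS by simp
      from mult_right_mono[OF C1(1) this] show "h ^ Suc m * S \<le> C1 * (h ^ Suc m * S)" by simp
    qed
    finally have \<sigma>: "h ^ m * \<sigma> \<le> C1 * (a + h ^ Suc m * S)"
      by (simp add: algebra_simps)
    show "h ^ k * \<bar>D k x\<bar> \<le> C * (1 + C1) * (a + h ^ Suc m * S)"
    proof (cases "k \<le> m")
      case True
      have "h ^ k * \<bar>D k x\<bar> \<le> C * (a + h ^ m * \<sigma>)"
        using IH[of h k x] True h x by auto
      also have "\<dots> \<le> C * ((a + h ^ Suc m * S) + C1 * (a + h ^ Suc m * S))"
        using \<sigma> C h aS by (intro mult_left_mono add_mono) auto
      finally show ?thesis by (simp add: algebra_simps)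
    next
      case False
      then have "k = Suc m" using k by simp
      then have "h ^ k * \<bar>D k x\<bar> \<le> 1 * (a + h ^ Suc m * S)"
        using DS x h aS by (auto intro!: add_increasing mult_left_mono)
      also have "\<dots> \<le> C * (1 + C1) * (a + h ^ Suc m * S)"
      proof (rule mult_right_mono)
        have "1 * 1 \<le> C * (1 + C1)"
          using C C1 by (intro mult_mono) auto
        then show "1 \<le> C * (1 + C1)" by simp
      qed (use h aS in auto)
      finally show ?thesis .
    qed
  qed
  moreover have "C * (1 + C1) \<ge> 1 * 1"
    using C C1 by (intro mult_mono) auto
  ultimately show ?case by auto
qed

section \<open>Derivatives of compositions\<close>

text \<open>A list \<open>ks\<close> encodes the term \<open>f\<^bsup>(length ks)\<^esup>(u) * (\<Prod>k\<leftarrow>ks. u\<^bsup>(k)\<^esup>)\<close>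
  of Faa di Bruno's formula; \<open>incs\<close> differentiates the product.\<close>

fun incs :: "nat list \<Rightarrow> nat list list" where
  "incs [] = []"
| "incs (k # ks) = (Suc k # ks) # map ((#) k) (incs ks)"

fun fdb :: "nat \<Rightarrow> nat list list" where
  "fdb 0 = [[]]"
| "fdb (Suc j) = concat (map (\<lambda>ks. (1 # ks) # incs ks) (fdb j))"

definition dprod :: "(nat \<Rightarrow> real \<Rightarrow> real) \<Rightarrow> nat list \<Rightarrow> real \<Rightarrow> real" where
  "dprod D ks x = prod_list (map (\<lambda>k. D k x) ks)"

definition fdb_term :: "(nat \<Rightarrow> real \<Rightarrow> real) \<Rightarrow> (nat \<Rightarrow> real \<Rightarrow> real) \<Rightarrow> nat list \<Rightarrow> real \<Rightarrow> real" where
  "fdb_term F D ks x = F (length ks) (D 0 x) * dprod D ks x"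

definition comp_deriv :: "(nat \<Rightarrow> real \<Rightarrow> real) \<Rightarrow> (nat \<Rightarrow> real \<Rightarrow> real) \<Rightarrow> nat \<Rightarrow> real \<Rightarrow> real" where
  "comp_deriv F D j x = (\<Sum>ks\<leftarrow>fdb j. fdb_term F D ks x)"

lemma incs_props:
  "ls \<in> set (incs ks) \<Longrightarrow> length ls = length ks \<and> sum_list ls = Suc (sum_list ks) \<and> (0 \<notin> set ks \<longrightarrow> 0 \<notin> set ls)"
  by (induction ks arbitrary: ls) auto

lemma fdb_props: "ks \<in> set (fdb j) \<Longrightarrow> sum_list ks = j \<and> 0 \<notin> set ks"
  by (induction j arbitrary: ks) (use incs_props in fastforce)+

text \<open>All entries are positive and add up to \<open>j\<close>. That the list is nonempty for
  \<open>j \<ge> 1\<close> provides a factor containing a derivative of \<open>u\<close>, which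
  makes the term vanish for \<open>u = 0\<close> and leaves one linear factor in the growth
  estimate.\<close>

lemma fdb_bounds:
  assumes "ks \<in> set (fdb j)"
  shows "length ks \<le> j" "\<And>k. k \<in> set ks \<Longrightarrow> 1 \<le> k \<and> k \<le> j" "j \<ge> 1 \<Longrightarrow> ks \<noteq> []"
proof -
  note * = fdb_props[OF assms]
  have "length ks \<le> sum_list ks" if "0 \<notin> set ks" for ks :: "nat list"
    using that by (induction ks) auto
  with * show "length ks \<le> j" by metis
  show "1 \<le> k \<and> k \<le> j" if "k \<in> set ks" for k
  proof
    have "k \<noteq> 0" using * that by metis
    then show "1 \<le> k" by simp
    show "k \<le> j" using * member_le_sum_list[OF that] by simp
  qed
  show "j \<ge> 1 \<Longrightarrow> ks \<noteq> []"
    using * by auto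
qed

lemma dprod_DERIV:
  assumes "\<And>k. k \<in> set ks \<Longrightarrow> (D k has_real_derivative D (Suc k) x) (at x)"
  shows "(dprod D ks has_real_derivative (\<Sum>ls\<leftarrow>incs ks. dprod D ls x)) (at x)"
  using assms
proof (induction ks)
  case Nil
  then show ?case by (simp add: dprod_def[abs_def])
next
  case (Cons k ks)
  have "((\<lambda>x. D k x * dprod D ks x) has_real_derivative
      D (Suc k) x * dprod D ks x + (\<Sum>ls\<leftarrow>incs ks. dprod D ls x) * D k x) (at x)"
    using Cons by (intro DERIV_mult) auto
  then show ?case
    by (simp add: dprod_def[abs_def] o_def sum_list_const_mult mult.commute)
qed

lemma fdb_term_DERIV:
  assumes D: "\<And>k. k \<in> insert 0 (set ks) \<Longrightarrow> (D k has_real_derivative D (Suc k) x) (at x)"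
    and F: "\<And>y. (F (length ks) has_real_derivative F (Suc (length ks)) y) (at y)"
  shows "(fdb_term F D ks has_real_derivative (\<Sum>ls\<leftarrow>(1 # ks) # incs ks. fdb_term F D ls x)) (at x)"
proof -
  have "((\<lambda>x. F (length ks) (D 0 x) * dprod D ks x) has_real_derivative
    (F (Suc (length ks)) (D 0 x) * D (Suc 0) x) * dprod D ks x
      + (\<Sum>ls\<leftarrow>incs ks. dprod D ls x) * F (length ks) (D 0 x)) (at x)"
    using D by (intro DERIV_mult DERIV_chain2[OF F] dprod_DERIV) auto
  moreover have "(\<Sum>ls\<leftarrow>incs ks. dprod D ls x) * F (length ks) (D 0 x) = (\<Sum>ls\<leftarrow>incs ks. fdb_term F D ls x)"
  proof -
    have "map (\<lambda>ls. fdb_term F D ls x) (incs ks) = map (\<lambda>ls. dprod D ls x * F (length ks) (D 0 x)) (incs ks)"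
      by (intro map_cong) (auto simp: fdb_term_def mult.commute dest: incs_props)
    then show ?thesis
      by (simp only: sum_list_mult_const)
  qed
  ultimately show ?thesis
    by (simp add: fdb_term_def[abs_def] dprod_def mult.assoc)
qed

lemma sum_list_DERIV:
  assumes "\<And>k. k \<in> set ks \<Longrightarrow> (g k has_real_derivative g' k) (at x)"
  shows "((\<lambda>x. \<Sum>k\<leftarrow>ks. g k x) has_real_derivative (\<Sum>k\<leftarrow>ks. g' k)) (at x)"
  using assms by (induction ks) (auto intro!: derivative_eq_intros)

lemma comp_deriv_DERIV:
  assumes D: "\<And>k. k \<le> j \<Longrightarrow> (D k has_real_derivative D (Suc k) x) (at x)"
    and F: "\<And>i y. i \<le> j \<Longrightarrow> (F i has_real_derivative F (Suc i) y) (at y)"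
  shows "(comp_deriv F D j has_real_derivative comp_deriv F D (Suc j) x) (at x)"
proof -
  have "((\<lambda>x. \<Sum>ks\<leftarrow>fdb j. fdb_term F D ks x) has_real_derivative
     (\<Sum>ks\<leftarrow>fdb j. \<Sum>ls\<leftarrow>(1 # ks) # incs ks. fdb_term F D ls x)) (at x)"
    by (intro sum_list_DERIV fdb_term_DERIV D F) (auto dest: fdb_bounds)
  moreover have "(\<Sum>ks\<leftarrow>kss. \<Sum>ls\<leftarrow>(1 # ks) # incs ks. fdb_term F D ls x)
     = (\<Sum>ls\<leftarrow>concat (map (\<lambda>ks. (1 # ks) # incs ks) kss). fdb_term F D ls x)" for kss
    by (induction kss) auto
  ultimately show ?thesis
    by (simp add: comp_deriv_def[abs_def])
qed

lemma comp_deriv_0: "comp_deriv F D 0 x = F 0 (D 0 x)"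
  by (simp add: comp_deriv_def fdb_term_def dprod_def)

lemma abs_sum_list_le: "\<bar>\<Sum>k\<leftarrow>ks. g k\<bar> \<le> (\<Sum>k\<leftarrow>ks. \<bar>g k :: real\<bar>)"
  by (induction ks) auto

lemma dprod_bound:
  fixes K :: real
  assumes "\<And>k. k \<in> set ks \<Longrightarrow> \<bar>D k x\<bar> \<le> K" "0 \<le> K"
  shows "\<bar>dprod D ks x\<bar> \<le> K ^ length ks"
  using assms by (induction ks) (auto simp: dprod_def abs_mult intro!: mult_mono)

text \<open>Telescoping; \<open>1 \<le> K\<close> lets every summand be bounded with the same power
  of \<open>K\<close>.\<close>

lemma dprod_diff_bound:
  fixes K d :: real
  assumes "\<And>k. k \<in> set ks \<Longrightarrow> \<bar>D k x\<bar> \<le> K" "\<And>k. k \<in> set ks \<Longrightarrow> \<bar>E k x\<bar> \<le> K" "1 \<le> K"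
    and "\<And>k. k \<in> set ks \<Longrightarrow> \<bar>D k x - E k x\<bar> \<le> d"
  shows "\<bar>dprod D ks x - dprod E ks x\<bar> \<le> length ks * K ^ length ks * d"
  using assms
proof (induction ks)
  case Nil
  then show ?case by (simp add: dprod_def)
next
  case (Cons k ks)
  have d: "0 \<le> d" using Cons.prems(4)[of k] by (auto intro: order_trans[OF abs_ge_zero])
  have "dprod D (k # ks) x - dprod E (k # ks) x
     = (D k x - E k x) * dprod D ks x + E k x * (dprod D ks x - dprod E ks x)"
    by (simp add: dprod_def algebra_simps)
  also have "\<bar>\<dots>\<bar> \<le> \<bar>D k x - E k x\<bar> * \<bar>dprod D ks x\<bar> + \<bar>E k x\<bar> * \<bar>dprod D ks x - dprod E ks x\<bar>"
    unfolding abs_mult[symmetric] by (rule abs_triangle_ineq)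
  also have "\<dots> \<le> d * K ^ length ks + K * (length ks * K ^ length ks * d)"
  proof (intro add_mono mult_mono)
    show "\<bar>dprod D ks x\<bar> \<le> K ^ length ks"
      using Cons.prems by (intro dprod_bound) auto
    show "\<bar>dprod D ks x - dprod E ks x\<bar> \<le> length ks * K ^ length ks * d"
      using Cons.prems by (intro Cons.IH) auto
  qed (use Cons.prems d in auto)
  also have "\<dots> \<le> K * (d * K ^ length ks) + K * (length ks * K ^ length ks * d)"
  proof (rule add_right_mono)
    have "1 * (d * K ^ length ks) \<le> K * (d * K ^ length ks)"
      using Cons.prems(3) d by (intro mult_right_mono) auto
    then show "d * K ^ length ks \<le> K * (d * K ^ length ks)" by simp
  qed
  finally show ?case by (simp add: algebra_simps)
qed

text \<open>The bound is pointwise and linear in the differences, hence survives taking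
  \<open>L\<^sup>2\<close> norms. Lipschitz continuity of \<open>F i\<close> up to order
  \<open>m\<close> is what consumes one derivative of \<open>f\<close> beyond order
  \<open>m\<close>.\<close>

lemma comp_deriv_lipschitz:
  assumes "0 \<le> A" "1 \<le> K"
    and FA: "\<And>i y. i \<le> m \<Longrightarrow> \<bar>y\<bar> \<le> K \<Longrightarrow> \<bar>F i y\<bar> \<le> A"
    and FL: "\<And>i y z. i \<le> m \<Longrightarrow> \<bar>y\<bar> \<le> K \<Longrightarrow> \<bar>z\<bar> \<le> K \<Longrightarrow> \<bar>F i y - F i z\<bar> \<le> A * \<bar>y - z\<bar>"
  shows "\<exists>L\<ge>0. \<forall>D E x. (\<forall>k\<le>m. \<bar>D k x\<bar> \<le> K) \<longrightarrow> (\<forall>k\<le>m. \<bar>E k x\<bar> \<le> K) \<longrightarrow>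
     (\<forall>j\<le>m. \<bar>comp_deriv F D j x - comp_deriv F E j x\<bar> \<le> L * (\<Sum>k\<le>m. \<bar>D k x - E k x\<bar>))"
proof -
  define c where "c ks = A * K ^ length ks + A * (length ks * K ^ length ks)" for ks :: "nat list"
  have c0: "0 \<le> c ks" for ks
    using assms by (auto simp: c_def)
  define L where "L = (\<Sum>j\<le>m. \<Sum>ks\<leftarrow>fdb j. c ks)"
  have s0: "0 \<le> (\<Sum>ks\<leftarrow>kss. c ks)" for kss
    using c0 by (intro sum_list_nonneg) auto
  have "\<bar>comp_deriv F D j x - comp_deriv F E j x\<bar> \<le> L * (\<Sum>k\<le>m. \<bar>D k x - E k x\<bar>)"
    if D: "\<forall>k\<le>m. \<bar>D k x\<bar> \<le> K" and E: "\<forall>k\<le>m. \<bar>E k x\<bar> \<le> K" and j: "j \<le> m" for D E x j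
  proof -
    define d where "d = (\<Sum>k\<le>m. \<bar>D k x - E k x\<bar>)"
    have d: "0 \<le> d" "\<And>k. k \<le> m \<Longrightarrow> \<bar>D k x - E k x\<bar> \<le> d"
      unfolding d_def by (auto intro: sum_nonneg member_le_sum)
    have t: "\<bar>fdb_term F D ks x - fdb_term F E ks x\<bar> \<le> c ks * d" if "ks \<in> set (fdb j)" for ks
    proof -
      have ks: "length ks \<le> m" "\<And>k. k \<in> set ks \<Longrightarrow> k \<le> m"
        using fdb_bounds[OF that] j by force+
      have "fdb_term F D ks x - fdb_term F E ks x
        = (F (length ks) (D 0 x) - F (length ks) (E 0 x)) * dprod D ks x
          + F (length ks) (E 0 x) * (dprod D ks x - dprod E ks x)"
        by (simp add: fdb_term_def algebra_simps)
      also have "\<bar>\<dots>\<bar> \<le> \<bar>F (length ks) (D 0 x) - F (length ks) (E 0 x)\<bar> * \<bar>dprod D ks x\<bar>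
          + \<bar>F (length ks) (E 0 x)\<bar> * \<bar>dprod D ks x - dprod E ks x\<bar>"
        by (metis abs_mult abs_triangle_ineq)
      also have "\<dots> \<le> (A * d) * K ^ length ks + A * (length ks * K ^ length ks * d)"
      proof (intro add_mono mult_mono)
        show "\<bar>F (length ks) (D 0 x) - F (length ks) (E 0 x)\<bar> \<le> A * d"
          using FL[OF ks(1), of "D 0 x" "E 0 x"] D E d(2)[of 0] assms(1)
          by (auto intro: order_trans[OF _ mult_left_mono])
        show "\<bar>dprod D ks x\<bar> \<le> K ^ length ks"
          using D ks assms by (intro dprod_bound) auto
        show "\<bar>F (length ks) (E 0 x)\<bar> \<le> A"
          using FA ks E by auto
        show "\<bar>dprod D ks x - dprod E ks x\<bar> \<le> length ks * K ^ length ks * d"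
          using D E ks d assms by (intro dprod_diff_bound) auto
      qed (use assms d in auto)
      finally show ?thesis by (simp add: c_def algebra_simps)
    qed
    have "comp_deriv F D j x - comp_deriv F E j x = (\<Sum>ks\<leftarrow>fdb j. fdb_term F D ks x - fdb_term F E ks x)"
      by (simp add: comp_deriv_def sum_list_subtractf)
    also have "\<bar>\<dots>\<bar> \<le> (\<Sum>ks\<leftarrow>fdb j. \<bar>fdb_term F D ks x - fdb_term F E ks x\<bar>)"
      by (rule abs_sum_list_le)
    also have "\<dots> \<le> (\<Sum>ks\<leftarrow>fdb j. c ks * d)"
      using t by (intro sum_list_mono) auto
    also have "\<dots> = (\<Sum>ks\<leftarrow>fdb j. c ks) * d"
      by (simp add: sum_list_mult_const)
    also have "\<dots> \<le> L * d"
      unfolding L_def using j d s0 by (intro mult_right_mono member_le_sum) auto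
    finally show ?thesis by (simp add: d_def)
  qed
  moreover have "0 \<le> L"
    unfolding L_def using s0 by (intro sum_nonneg) auto
  ultimately show ?thesis by blast
qed

text \<open>The constant depends on the size of \<open>D\<close> only through \<open>M\<close>: all intermediate derivatives
  are interpolated between \<open>D 0\<close> and \<open>D m\<close> at the scale \<open>h\<close> with \<open>h\<^sup>m B = a\<close>.\<close>

lemma comp_deriv_moser:
  assumes "m \<ge> 1" "0 \<le> M" "0 \<le> A"
    and FA: "\<And>i y. i \<le> m \<Longrightarrow> \<bar>y\<bar> \<le> M \<Longrightarrow> \<bar>F i y\<bar> \<le> A"
  shows "\<exists>C\<ge>0. \<forall>D p B.
     (\<forall>k<m. \<forall>x. (D k has_real_derivative D (Suc k) x) (at x)) \<longrightarrow>
     (\<forall>x. \<bar>D 0 x\<bar> \<le> M) \<longrightarrow> (\<forall>x\<in>{p..p+1}. \<bar>D 0 x\<bar> \<le> B) \<longrightarrow> (\<forall>x\<in>{p..p+1}. \<bar>D m x\<bar> \<le> B) \<longrightarrow>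
     \<bar>comp_deriv F D m p\<bar> \<le> C * B"
proof -
  from landau_kolmogorov_local[OF \<open>m \<ge> 1\<close>] obtain C0 where C0: "C0 \<ge> 1"
    and LK: "interpolation_constant m C0" by blast
  define c where "c ks = A * ((2 * C0) ^ length ks * (M + 1) ^ (length ks - 1))" for ks :: "nat list"
  have c0: "0 \<le> c ks" for ks
    using assms C0 by (auto simp: c_def)
  define C where "C = (\<Sum>ks\<leftarrow>fdb m. c ks)"
  have C: "0 \<le> C"
    unfolding C_def using c0 by (intro sum_list_nonneg) auto
  have "\<bar>comp_deriv F D m p\<bar> \<le> C * B"
    if D: "\<forall>k<m. \<forall>x. (D k has_real_derivative D (Suc k) x) (at x)"
     and DM: "\<forall>x. \<bar>D 0 x\<bar> \<le> M" and DB: "\<forall>x\<in>{p..p+1}. \<bar>D 0 x\<bar> \<le> B" and DmB: "\<forall>x\<in>{p..p+1}. \<bar>D m x\<bar> \<le> B" for D p B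
  proof -
    have "continuous_on {p..p+1} (D 0)"
      using D assms(1) by (meson DERIV_isCont continuous_at_imp_continuous_on less_le_trans zero_less_one)
    then obtain x0 where x0: "x0 \<in> {p..p+1}" "\<And>x. x \<in> {p..p+1} \<Longrightarrow> \<bar>D 0 x\<bar> \<le> \<bar>D 0 x0\<bar>"
      using max_attained_interval by blast
    have B0: "0 \<le> B"
      using DB[rule_format, OF x0(1)] by linarith
    \<comment> \<open>Adding \<open>\<eta>\<close> to both sizes keeps them positive, so the
      quotient defining the scale makes sense even if \<open>D\<close> vanishes on the window;
      \<open>\<eta>\<close> tends to 0 at the end.\<close>
    have *: "\<bar>comp_deriv F D m p\<bar> \<le> C * (B + \<eta>)" if \<eta>: "0 < \<eta>" "\<eta> \<le> 1" for \<eta>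
    proof -
      define a where "a = \<bar>D 0 x0\<bar> + \<eta>"
      define B' where "B' = B + \<eta>"
      have a: "0 < a" "a \<le> M + 1" "a \<le> B'" "\<forall>x\<in>{p..p+1}. \<bar>D 0 x\<bar> \<le> a"
        using x0(2) DM[rule_format, of x0] DB[rule_format, OF x0(1)] \<eta> unfolding a_def B'_def
        by (linarith, linarith, linarith, force)
      have B': "0 < B'" "\<forall>x\<in>{p..p+1}. \<bar>D m x\<bar> \<le> B'"
        using B0 \<eta> DmB unfolding B'_def by (linarith, force)
      \<comment> \<open>This scale balances the two terms of the interpolation inequality, and
        \<open>a \<le> B'\<close> gives \<open>h \<le> 1\<close>.\<close>
      define h where "h = root m (a / B')"
      have h: "0 < h" "h \<le> 1" "h ^ m = a / B'"
        using a B' assms(1) by (auto simp: h_def real_root_gt_0_iff real_root_le_1_iff)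
      have bk: "h ^ k * \<bar>D k p\<bar> \<le> 2 * C0 * a" if "k \<le> m" for k
      proof -
        have "h ^ k * \<bar>D k p\<bar> \<le> C0 * (a + h ^ m * B')"
          by (rule interpolation_constantD[OF LK, where p = p]) (use h a B' D that in auto)
        also have "\<dots> = 2 * C0 * a"
          using h(3) B' by simp
        finally show ?thesis .
      qed
      have tm: "\<bar>fdb_term F D ks p\<bar> \<le> c ks * B'" if ks: "ks \<in> set (fdb m)" for ks
      proof -
        have "h ^ sum_list ls * \<bar>dprod D ls p\<bar> \<le> (2 * C0 * a) ^ length ls" if "\<forall>k\<in>set ls. k \<le> m" for ls
          using that
        proof (induction ls)
          case Nil
          then show ?case by (simp add: dprod_def)
        next
          case (Cons k ls)
          have "h ^ sum_list (k # ls) * \<bar>dprod D (k # ls) p\<bar>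
            = (h ^ k * \<bar>D k p\<bar>) * (h ^ sum_list ls * \<bar>dprod D ls p\<bar>)"
            by (simp add: dprod_def power_add abs_mult)
          also have "\<dots> \<le> (2 * C0 * a) * (2 * C0 * a) ^ length ls"
            by (rule mult_mono) (use Cons bk C0 a h in auto)
          finally show ?case by simp
        qed
        from this[of ks] fdb_bounds(2)[OF ks] fdb_props[OF ks]
        have "h ^ m * \<bar>dprod D ks p\<bar> \<le> (2 * C0 * a) ^ length ks" by auto
        also have "\<dots> = (2 * C0) ^ length ks * a ^ (length ks - 1) * a"
          using fdb_bounds(3)[OF ks assms(1)] by (cases ks) (auto simp: power_mult_distrib)
        also have "\<dots> \<le> (2 * C0) ^ length ks * (M + 1) ^ (length ks - 1) * a"
          using a C0 by (intro mult_right_mono mult_left_mono power_mono) auto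
        finally have "\<bar>dprod D ks p\<bar> \<le> (2 * C0) ^ length ks * (M + 1) ^ (length ks - 1) * B'"
          using h a B' by (simp add: field_simps)
        moreover have "\<bar>F (length ks) (D 0 p)\<bar> \<le> A"
          using FA fdb_bounds(1)[OF ks] DM by auto
        ultimately show ?thesis
          unfolding fdb_term_def abs_mult c_def mult.assoc using assms
          by (intro mult_mono) auto
      qed
      have "\<bar>comp_deriv F D m p\<bar> \<le> (\<Sum>ks\<leftarrow>fdb m. \<bar>fdb_term F D ks p\<bar>)"
        unfolding comp_deriv_def by (rule abs_sum_list_le)
      also have "\<dots> \<le> (\<Sum>ks\<leftarrow>fdb m. c ks * B')"
        using tm by (intro sum_list_mono) auto
      also have "\<dots> = C * B'"
        by (simp add: C_def sum_list_mult_const)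
      finally show ?thesis by (simp add: B'_def)
    qed
    have "((\<lambda>\<eta>. C * (B + \<eta>)) \<longlongrightarrow> C * (B + 0)) (at_right 0)"
      by (intro tendsto_intros)
    moreover have "\<forall>\<^sub>F \<eta> in at_right 0. \<bar>comp_deriv F D m p\<bar> \<le> C * (B + \<eta>)"
      using eventually_at_right_real[OF zero_less_one]
      by eventually_elim (use * in auto)
    ultimately show ?thesis
      using tendsto_lowerbound[of "\<lambda>\<eta>. C * (B + \<eta>)" "C * (B + 0)"] by simp
  qed
  with C show ?thesis by blast
qed

section \<open>Ordinary differential equations in Banach spaces\<close>

text \<open>The right-hand side \<open>Z\<close> of the integral inequality satisfies
  \<open>Z' = C y \<le> C Z\<close>, so \<open>Z\<close> times \<open>exp (- C t)\<close> does not
  increase.\<close>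

lemma gronwall:
  fixes y :: "real \<Rightarrow> real"
  assumes y: "continuous_on {0..T} y" and "0 \<le> C"
    and le: "\<And>t. t \<in> {0..T} \<Longrightarrow> y t \<le> a + C * integral {0..t} y"
    and t: "t \<in> {0..T}"
  shows "y t \<le> a * exp (C * t)"
proof -
  define Z where "Z r = a + C * integral {0..r} y" for r
  have Z: "(Z has_real_derivative C * y r) (at r)" if "0 < r" "r < T" for r
  proof -
    have "((\<lambda>u. integral {0..u} y) has_vector_derivative y r) (at r within {0..T})"
      using that by (intro integral_has_vector_derivative y) auto
    then have "((\<lambda>u. integral {0..u} y) has_real_derivative y r) (at r)"
      using that by (simp add: has_real_derivative_iff_has_vector_derivative at_within_interior[of r "{0..T}"])
    then show ?thesis
      unfolding Z_def by (auto intro!: derivative_eq_intros)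
  qed
  have Zc: "continuous_on {0..T} Z"
    unfolding Z_def by (intro continuous_intros indefinite_integral_continuous_1 integrable_continuous_real y)
  have "Z 0 * exp (- C * 0) \<ge> Z t * exp (- C * t)"
  proof (rule DERIV_nonpos_imp_decreasing_open[of 0 t])
    fix r assume r: "0 < r" "r < t"
    have "((\<lambda>r. Z r * exp (- C * r)) has_real_derivative (C * y r - C * Z r) * exp (- C * r)) (at r)"
      using r t by (auto intro!: derivative_eq_intros Z simp: algebra_simps)
    moreover have "(C * y r - C * Z r) * exp (- C * r) \<le> 0"
      using le[of r] r t \<open>0 \<le> C\<close> unfolding Z_def[symmetric]
      by (intro mult_nonpos_nonneg) (auto intro: mult_left_mono)
    ultimately show "\<exists>d. ((\<lambda>r. Z r * exp (- C * r)) has_real_derivative d) (at r) \<and> d \<le> 0" by blast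
  next
    show "continuous_on {0..t} (\<lambda>r. Z r * exp (- C * r))"
      using t by (intro continuous_intros continuous_on_subset[OF Zc]) auto
  qed (use t in auto)
  then have "Z t \<le> a * exp (C * t)"
    by (simp add: Z_def exp_minus field_simps)
  with le[OF t] show ?thesis
    by (simp add: Z_def)
qed

text \<open>Serves for growth, uniqueness, continuous dependence and, with \<open>C = 0\<close>, for
  the invariance of the Hermitian subspace. Derivatives are taken in the open interval, because the
  equation is imposed for positive times only.\<close>

lemma exp_growth:
  fixes y :: "real \<Rightarrow> 'a::banach"
  assumes y: "continuous_on {0..T} y" and "0 \<le> C"
    and d: "\<And>t. 0 < t \<Longrightarrow> t < T \<Longrightarrow> (y has_vector_derivative y' t) (at t)"
    and le: "\<And>t. 0 < t \<Longrightarrow> t < T \<Longrightarrow> norm (y' t) \<le> C * norm (y t)"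
    and t: "t \<in> {0..T}"
  shows "norm (y t) \<le> norm (y 0) * exp (C * t)"
proof (rule gronwall[where y = "\<lambda>t. norm (y t)", OF _ \<open>0 \<le> C\<close> _ t])
  show cn: "continuous_on {0..T} (\<lambda>t. norm (y t))"
    by (intro continuous_intros y)
  fix t assume t: "t \<in> {0..T}"
  \<comment> \<open>\<open>y'\<close> is arbitrary at the end points, so it is replaced by 0 there;
    the fundamental theorem looks at interior derivatives only.\<close>
  define z where "z r = (if 0 < r \<and> r < t then y' r else 0)" for r
  have "(z has_integral (y t - y 0)) {0..t}"
    using t by (intro fundamental_theorem_of_calculus_interior continuous_on_subset[OF y]) (auto simp: z_def d)
  then have z: "z integrable_on {0..t}" "y t = y 0 + integral {0..t} z"
    by (auto simp: has_integral_iff algebra_simps)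
  have "norm (integral {0..t} z) \<le> integral {0..t} (\<lambda>r. C * norm (y r))"
  proof (rule integral_norm_bound_integral[OF z(1)])
    show "(\<lambda>r. C * norm (y r)) integrable_on {0..t}"
      using t by (intro integrable_continuous_real continuous_intros continuous_on_subset[OF y]) auto
    show "norm (z r) \<le> C * norm (y r)" for r
      using le[of r] t \<open>0 \<le> C\<close> by (auto simp: z_def)
  qed
  also have "\<dots> = C * integral {0..t} (\<lambda>r. norm (y r))"
    by simp
  finally show "norm (y t) \<le> norm (y 0) + C * integral {0..t} (\<lambda>r. norm (y r))"
    using norm_triangle_ineq[of "y 0" "integral {0..t} z"] z(2) by simp
qed

text \<open>\<open>T L \<le> 1 / 2\<close> makes the Picard operator a contraction, and
  \<open>T K \<le> 1\<close> together with the margin 1 between \<open>norm y0\<close> and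
  \<open>R\<close> keeps its values in the ball of radius \<open>R\<close>.\<close>

lemma picard:
  fixes G :: "'a::banach \<Rightarrow> 'a" and y0 :: 'a
  assumes R: "norm y0 + 1 \<le> R" and "0 \<le> L" "0 < T"
    and lip: "\<And>x y. norm x \<le> R \<Longrightarrow> norm y \<le> R \<Longrightarrow> norm (G x - G y) \<le> L * norm (x - y)"
    and bnd: "\<And>x. norm x \<le> R \<Longrightarrow> norm (G x) \<le> K"
    and TL: "T * L \<le> 1 / 2" and TK: "T * K \<le> 1"
  shows "\<exists>y. continuous_on {0..T} y \<and> y 0 = y0 \<and> (\<forall>t\<in>{0..T}. norm (y t) \<le> R) \<and>
     (\<forall>t\<in>{0..T}. (y has_vector_derivative G (y t)) (at t within {0..T}))"
proof -
  \<comment> \<open>Clamping the time to \<open>{0..T}\<close> lets the operator act on bounded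
    continuous functions on the whole line, a complete space.\<close>
  define c where "c t = max 0 (min T t)" for t
  have c: "c t \<in> {0..T}" for t
    using \<open>0 < T\<close> by (auto simp: c_def)
  have cc: "continuous_on UNIV c"
    unfolding c_def by (intro continuous_intros)
  have c_id: "t \<in> {0..T} \<Longrightarrow> c t = t" for t
    by (auto simp: c_def)
  define S where "S = PiC UNIV (\<lambda>_::real. cball (0::'a) R)"
  have S_iff: "g \<in> S \<longleftrightarrow> (\<forall>t. norm (apply_bcontfun g t) \<le> R)" for g
    by (auto simp: S_def mem_PiC_iff Pi_iff)
  have R0: "0 \<le> R"
    using R norm_ge_zero[of y0] by linarith
  have K0: "0 \<le> K"
    using bnd[of 0] R0 by (auto intro: order_trans[OF norm_ge_zero])
  have Gc: "continuous_on (cball 0 R) G"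
  proof (rule continuous_onI)
    fix x :: 'a and e :: real assume "x \<in> cball 0 R" "0 < e"
    show "\<exists>d>0. \<forall>x'\<in>cball 0 R. dist x' x < d \<longrightarrow> dist (G x') (G x) \<le> e"
    proof (intro exI[of _ "e / (L + 1)"] conjI ballI impI)
      fix x' assume x': "x' \<in> cball 0 R" "dist x' x < e / (L + 1)"
      have "dist (G x') (G x) \<le> L * dist x' x"
        using lip[of x' x] x' \<open>x \<in> _\<close> by (simp add: dist_norm)
      also have "\<dots> \<le> (L + 1) * (e / (L + 1))"
        using x' \<open>0 \<le> L\<close> by (intro mult_mono) auto
      finally show "dist (G x') (G x) \<le> e" using \<open>0 \<le> L\<close> by simp
    qed (use \<open>0 < e\<close> \<open>0 \<le> L\<close> in auto)
  qed
  have Ggc: "continuous_on A (\<lambda>r. G (apply_bcontfun g r))" if "g \<in> S" for g A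
    using that by (intro continuous_on_compose2[OF Gc]) (auto simp: S_iff intro: continuous_on_apply_bcontfun)
  define P0 where "P0 g t = y0 + integral {0..c t} (\<lambda>r. G (apply_bcontfun g r))" for g t
  have P0_R: "norm (P0 g t) \<le> R" if g: "g \<in> S" for g t
  proof -
    have "norm (integral {0..c t} (\<lambda>r. G (apply_bcontfun g r))) \<le> K * (c t - 0)"
      using c[of t] g by (intro integral_bound Ggc bnd) (auto simp: S_iff)
    also have "\<dots> \<le> K * T"
      using c[of t] K0 by (intro mult_left_mono) auto
    also have "\<dots> \<le> 1" using TK by (simp add: mult.commute)
    finally show ?thesis
      using R norm_triangle_ineq[of y0 "integral {0..c t} (\<lambda>r. G (apply_bcontfun g r))"] unfolding P0_def by linarith
  qed
  have P0_b: "P0 g \<in> bcontfun" if g: "g \<in> S" for g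
  proof (rule bcontfun_normI[OF _ P0_R[OF g]])
    have "continuous_on {0..T} (\<lambda>u. integral {0..u} (\<lambda>r. G (apply_bcontfun g r)))"
      by (intro indefinite_integral_continuous_1 integrable_continuous_real Ggc g)
    then have "continuous_on UNIV (\<lambda>t. integral {0..c t} (\<lambda>r. G (apply_bcontfun g r)))"
      by (rule continuous_on_compose2[OF _ cc]) (use c in auto)
    then show "continuous_on UNIV (P0 g)"
      unfolding P0_def by (intro continuous_intros)
  qed
  define P where "P g = Bcontfun (P0 g)" for g
  have P: "apply_bcontfun (P g) = P0 g" if "g \<in> S" for g
    using P0_b[OF that] by (simp add: P_def Bcontfun_inverse)
  have "\<exists>!g\<in>S. P g = g"
  proof (rule Banach_fix[where c = "1 / 2", OF complete_eq_closed[THEN iffD2]])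
    show "closed S"
      unfolding S_def by (intro closed_PiC) auto
    show "S \<noteq> {}"
    proof -
      have "const_bcontfun 0 \<in> S"
        using R0 by (auto simp: S_iff)
      then show ?thesis by blast
    qed
    show "P ` S \<subseteq> S"
      using P P0_R by (auto simp: S_iff)
    fix g h assume g: "g \<in> S" and h: "h \<in> S"
    show "dist (P g) (P h) \<le> 1 / 2 * dist g h"
    proof (rule dist_bound)
      fix t
      have "dist (apply_bcontfun (P g) t) (apply_bcontfun (P h) t)
         = norm (integral {0..c t} (\<lambda>r. G (apply_bcontfun g r) - G (apply_bcontfun h r)))"
        using P g h by (simp add: P0_def dist_norm Henstock_Kurzweil_Integration.integral_diff integrable_continuous_real Ggc)
      also have "\<dots> \<le> (L * dist g h) * (c t - 0)"
      proof (rule integral_bound)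
        show "continuous_on {0..c t} (\<lambda>r. G (apply_bcontfun g r) - G (apply_bcontfun h r))"
          by (intro continuous_intros Ggc g h)
        fix r
        have "norm (G (apply_bcontfun g r) - G (apply_bcontfun h r)) \<le> L * norm (apply_bcontfun g r - apply_bcontfun h r)"
          using g h by (intro lip) (auto simp: S_iff)
        also have "\<dots> \<le> L * dist g h"
          using dist_bounded[of g r h] \<open>0 \<le> L\<close> by (intro mult_left_mono) (auto simp: dist_norm)
        finally show "norm (G (apply_bcontfun g r) - G (apply_bcontfun h r)) \<le> L * dist g h" .
      qed (use c in auto)
      also have "\<dots> \<le> (L * dist g h) * T"
        using c[of t] \<open>0 \<le> L\<close> by (intro mult_left_mono) auto
      also have "\<dots> = (T * L) * dist g h" by simp
      also have "\<dots> \<le> 1 / 2 * dist g h"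
        using TL by (intro mult_right_mono) auto
      finally show "dist (apply_bcontfun (P g) t) (apply_bcontfun (P h) t) \<le> 1 / 2 * dist g h" .
    qed
  qed auto
  then obtain g where g: "g \<in> S" "P g = g" by blast
  define y where "y = apply_bcontfun g"
  have y: "y t = y0 + integral {0..t} (\<lambda>r. G (y r))" if "t \<in> {0..T}" for t
    using P[OF g(1)] g(2) that unfolding y_def P0_def by (metis c_id)
  have "(y has_vector_derivative G (y t)) (at t within {0..T})" if t: "t \<in> {0..T}" for t
  proof -
    have "((\<lambda>u. integral {0..u} (\<lambda>r. G (y r))) has_vector_derivative G (y t)) (at t within {0..T})"
      unfolding y_def by (intro integral_has_vector_derivative Ggc g t)
    then have "((\<lambda>u. y0 + integral {0..u} (\<lambda>r. G (y r))) has_vector_derivative G (y t)) (at t within {0..T})"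
      by (auto intro!: derivative_eq_intros)
    then show ?thesis
      by (rule has_vector_derivative_transform[OF t, rotated]) (simp add: y)
  qed
  moreover have "y 0 = y0"
    using y[of 0] \<open>0 < T\<close> by simp
  moreover have "continuous_on {0..T} y"
    unfolding y_def by simp
  moreover have "norm (y t) \<le> R" for t
    using g(1) by (simp add: y_def S_iff)
  ultimately show ?thesis by blast
qed

section \<open>Norm bounds from pointwise domination by finite sums\<close>

lemma sq_int_sum:
  assumes "finite I" "\<And>i. i \<in> I \<Longrightarrow> sq_int (f i)"
  shows "sq_int (\<lambda>x. \<Sum>i\<in>I. f i x)" "L2_of (\<lambda>x. \<Sum>i\<in>I. f i x) = (\<Sum>i\<in>I. L2_of (f i))"
proof -
  have "sq_int (\<lambda>x. \<Sum>i\<in>I. f i x) \<and> L2_of (\<lambda>x. \<Sum>i\<in>I. f i x) = (\<Sum>i\<in>I. L2_of (f i))"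
    using assms by (induction I) (auto simp: sq_int_add L2_of_add zero_L2_def)
  then show "sq_int (\<lambda>x. \<Sum>i\<in>I. f i x)" "L2_of (\<lambda>x. \<Sum>i\<in>I. f i x) = (\<Sum>i\<in>I. L2_of (f i))" by auto
qed

lemma norm_L2_of_le_sum:
  assumes [measurable]: "f \<in> borel_measurable borel" and g: "finite I" "\<And>i. i \<in> I \<Longrightarrow> sq_int (g i)"
    and le: "AE x in lborel. cmod (f x) \<le> c * (\<Sum>i\<in>I. cmod (g i x))" and "0 \<le> c"
  shows "sq_int f" "norm (L2_of f) \<le> c * (\<Sum>i\<in>I. norm (L2_of (g i)))"
proof -
  let ?g = "\<lambda>i x. complex_of_real (cmod (g i x))"
  have sg: "sq_int (?g i)" if "i \<in> I" for i
    using g(2)[OF that] by (rule sq_int_norm)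
  let ?S = "\<lambda>x. \<Sum>i\<in>I. ?g i x"
  have S: "sq_int ?S" "L2_of ?S = (\<Sum>i\<in>I. L2_of (?g i))"
    using sq_int_sum[of I ?g] g sg by auto
  have eq: "cmod (?S x) = (\<Sum>i\<in>I. cmod (g i x))" for x
    by (simp add: sum_nonneg flip: of_real_sum)
  have le': "AE x in lborel. cmod (f x) \<le> c * cmod (?S x)"
    using le unfolding eq .
  show f: "sq_int f"
  proof (rule sq_int_bound)
    show "integrable lborel (\<lambda>x. c\<^sup>2 * (cmod (?S x))\<^sup>2)"
      using sq_intD[OF S(1)] by (rule integrable_mult_right)
    show "AE x in lborel. (cmod (f x))\<^sup>2 \<le> c\<^sup>2 * (cmod (?S x))\<^sup>2"
      using le' by eventually_elim (auto simp: power_mult_distrib[symmetric] intro!: power_mono)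
  qed measurable
  have "norm (L2_of f) \<le> c * norm (L2_of ?S)"
    by (rule norm_L2_of_le[OF f S(1) le' \<open>0 \<le> c\<close>])
  also have "norm (L2_of ?S) \<le> (\<Sum>i\<in>I. norm (L2_of (?g i)))"
    unfolding S(2) by (rule norm_sum)
  also have "(\<Sum>i\<in>I. norm (L2_of (?g i))) = (\<Sum>i\<in>I. norm (L2_of (g i)))"
    by (rule sum.cong) (use g sg in \<open>auto simp: norm_L2_of\<close>)
  finally show "norm (L2_of f) \<le> c * (\<Sum>i\<in>I. norm (L2_of (g i)))"
    using \<open>0 \<le> c\<close> by (simp add: mult_left_mono)
qed

subsection \<open>Unit window averages\<close>

text \<open>The minimum of \<open>\<bar>g\<bar>\<close> over the unit window is at most its mean,
  and moving from the minimum point to any other point changes \<open>g\<close> by at most the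
  integral of \<open>\<bar>g'\<bar>\<close>.\<close>

lemma sup_le_window_integral:
  fixes g g' :: "real \<Rightarrow> real"
  assumes d: "\<And>x. (g has_real_derivative g' x) (at x)" and c: "continuous_on UNIV g'"
    and z: "z \<in> {p..p+1}"
  shows "\<bar>g z\<bar> \<le> integral {p..p+1} (\<lambda>x. \<bar>g x\<bar> + \<bar>g' x\<bar>)"
proof -
  have gc: "continuous_on A g" for A
    using d by (meson DERIV_isCont continuous_at_imp_continuous_on)
  have g'c: "continuous_on A (\<lambda>x. \<bar>g' x\<bar>)" for A
    by (intro continuous_intros continuous_on_subset[OF c]) auto
  have "continuous_on {p..p+1} (\<lambda>x. \<bar>g x\<bar>)"
    by (intro continuous_intros gc)
  from continuous_attains_inf[OF _ _ this] obtain y where y: "y \<in> {p..p+1}" "\<And>x. x \<in> {p..p+1} \<Longrightarrow> \<bar>g y\<bar> \<le> \<bar>g x\<bar>"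
    by auto
  have "\<bar>g y\<bar> = integral {p..p+1} (\<lambda>x. \<bar>g y\<bar>)"
    by simp
  also have "\<dots> \<le> integral {p..p+1} (\<lambda>x. \<bar>g x\<bar>)"
    by (intro integral_le integrable_continuous_real continuous_intros gc y)
  finally have 1: "\<bar>g y\<bar> \<le> integral {p..p+1} (\<lambda>x. \<bar>g x\<bar>)" .
  have "\<bar>g b - g a\<bar> \<le> integral {p..p+1} (\<lambda>x. \<bar>g' x\<bar>)" if "a \<in> {p..p+1}" "b \<in> {p..p+1}" "a \<le> b" for a b
  proof -
    have "(g' has_integral (g b - g a)) {a..b}"
      using that d by (intro fundamental_theorem_of_calculus)
        (auto simp: has_real_derivative_iff_has_vector_derivative[symmetric] intro: has_field_derivative_at_within)
    then have "\<bar>g b - g a\<bar> = norm (integral {a..b} g')"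
      by (simp add: integral_unique)
    also have "\<dots> \<le> integral {a..b} (\<lambda>x. \<bar>g' x\<bar>)"
      by (intro integral_norm_bound_integral integrable_continuous_real g'c continuous_on_subset[OF c]) auto
    also have "\<dots> \<le> integral {p..p+1} (\<lambda>x. \<bar>g' x\<bar>)"
      using that by (intro integral_subset_le integrable_continuous_real g'c) auto
    finally show ?thesis .
  qed
  from this[of y z] this[of z y] y(1) z have "\<bar>g z - g y\<bar> \<le> integral {p..p+1} (\<lambda>x. \<bar>g' x\<bar>)"
    by (cases "y \<le> z") (auto simp: abs_minus_commute)
  with 1 have "\<bar>g z\<bar> \<le> integral {p..p+1} (\<lambda>x. \<bar>g x\<bar>) + integral {p..p+1} (\<lambda>x. \<bar>g' x\<bar>)"
    by linarith
  also have "\<dots> = integral {p..p+1} (\<lambda>x. \<bar>g x\<bar> + \<bar>g' x\<bar>)"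
    by (intro Henstock_Kurzweil_Integration.integral_add[symmetric] integrable_continuous_real g'c continuous_intros gc)
  finally show ?thesis .
qed

text \<open>Averaging is convolution with a kernel of mass 1: Cauchy-Schwarz on the window, then
  Tonelli and translation invariance.\<close>

lemma window_average:
  fixes S :: "real \<Rightarrow> real"
  assumes c: "continuous_on UNIV S" and S: "sq_int (cr S)" and S0: "\<And>x. 0 \<le> S x"
  shows "sq_int (cr (\<lambda>x. integral {x..x+1} S))"
    and "norm (L2_of (cr (\<lambda>x. integral {x..x+1} S))) \<le> norm (L2_of (cr S))"
proof -
  have [measurable]: "S \<in> borel_measurable borel"
    using c by (rule borel_measurable_continuous_onI)
  have B: "integral {x..x+1} S = (LINT y|lborel. indicator {0..1} y * S (x + y))" for x
  proof -
    have "set_integrable lborel {x..x+1} S"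
      by (intro borel_integrable_atLeastAtMost') (rule continuous_on_subset[OF c], simp)
    then have "integral {x..x+1} S = (LINT y:{x..x+1}|lborel. S y)"
      by (simp add: set_borel_integral_eq_integral(2))
    also have "\<dots> = (LINT y|lborel. indicator {x..x+1} (x + y) * S (x + y))"
      unfolding set_lebesgue_integral_def
      using lborel_integral_real_affine[of 1 "\<lambda>y. indicator {x..x + 1} y *\<^sub>R S y" x] by simp
    also have "\<dots> = (LINT y|lborel. indicator {0..1} y * S (x + y))"
      by (intro Bochner_Integration.integral_cong) (auto simp: indicator_def)
    finally show ?thesis .
  qed
  have [measurable]: "(\<lambda>x. integral {x..x+1} S) \<in> borel_measurable borel"
    unfolding B by measurable
  have B2: "ennreal ((integral {x..x+1} S)\<^sup>2) \<le> (\<integral>\<^sup>+y. indicator {0..1::real} y * ennreal ((S (x + y))\<^sup>2) \<partial>lborel)" for x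
  proof -
    have i: "integrable lborel (\<lambda>y. indicator {0..1} y * S (x + y))"
    proof -
      have "set_integrable lborel {0..1} (\<lambda>y. S (x + y))"
        by (intro borel_integrable_atLeastAtMost' continuous_on_compose2[OF c] continuous_intros) auto
      then show ?thesis by (simp add: set_integrable_def)
    qed
    have "ennreal ((integral {x..x+1} S)\<^sup>2) = (ennreal (LINT y|lborel. indicator {0..1} y * S (x + y)))\<^sup>2"
      unfolding B by (intro ennreal_power[symmetric] integral_nonneg) (auto simp: S0)
    also have "ennreal (LINT y|lborel. indicator {0..1} y * S (x + y)) = (\<integral>\<^sup>+y. indicator {0..1::real} y * (indicator {0..1} y * ennreal (S (x + y))) \<partial>lborel)"
      using i by (subst nn_integral_eq_integral[symmetric]) (auto simp: S0 indicator_def intro!: nn_integral_cong)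
    also have "(\<dots>)\<^sup>2 \<le> (\<integral>\<^sup>+y. (indicator {0..1::real} y)\<^sup>2 \<partial>lborel) * (\<integral>\<^sup>+y. (indicator {0..1::real} y * ennreal (S (x + y)))\<^sup>2 \<partial>lborel)"
      by (rule Cauchy_Schwarz_nn_integral) measurable
    also have "(\<integral>\<^sup>+y. (indicator {0..1::real} y)\<^sup>2 \<partial>lborel) = (\<integral>\<^sup>+y. indicator {0..1::real} y \<partial>lborel)"
      by (intro nn_integral_cong) (auto simp: indicator_def)
    also have "\<dots> = 1" by simp
    also have "(\<integral>\<^sup>+y. (indicator {0..1::real} y * ennreal (S (x + y)))\<^sup>2 \<partial>lborel) = (\<integral>\<^sup>+y. indicator {0..1::real} y * ennreal ((S (x + y))\<^sup>2) \<partial>lborel)"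
      by (intro nn_integral_cong) (auto simp: indicator_def ennreal_power S0)
    finally show ?thesis by simp
  qed
  have "(\<integral>\<^sup>+x. ennreal ((integral {x..x+1} S)\<^sup>2) \<partial>lborel) \<le> (\<integral>\<^sup>+x. \<integral>\<^sup>+y. indicator {0..1::real} y * ennreal ((S (x + y))\<^sup>2) \<partial>lborel \<partial>lborel)"
    by (intro nn_integral_mono B2)
  also have "\<dots> = (\<integral>\<^sup>+y. \<integral>\<^sup>+x. indicator {0..1} y * ennreal ((S (x + y))\<^sup>2) \<partial>lborel \<partial>lborel)"
    by (rule lborel_pair.Fubini') measurable
  also have "\<dots> = (\<integral>\<^sup>+y. indicator {0..1::real} y * ennreal (LINT x|lborel. (S x)\<^sup>2) \<partial>lborel)"
  proof (rule nn_integral_cong)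
    fix y :: real
    have "(\<integral>\<^sup>+x. indicator {0..1} y * ennreal ((S (x + y))\<^sup>2) \<partial>lborel) = indicator {0..1} y * (\<integral>\<^sup>+x. ennreal ((S (x + y))\<^sup>2) \<partial>lborel)"
      by (rule nn_integral_cmult) measurable
    also have "(\<integral>\<^sup>+x. ennreal ((S (x + y))\<^sup>2) \<partial>lborel) = (\<integral>\<^sup>+x. ennreal ((S x)\<^sup>2) \<partial>lborel)"
      using nn_integral_real_affine[of "\<lambda>x. ennreal ((S x)\<^sup>2)" 1 y] by (simp add: add.commute)
    also have "\<dots> = ennreal (LINT x|lborel. (S x)\<^sup>2)"
      using sq_intD[OF S] by (intro nn_integral_eq_integral) auto
    finally show "(\<integral>\<^sup>+x. indicator {0..1} y * ennreal ((S (x + y))\<^sup>2) \<partial>lborel) = indicator {0..1} y * ennreal (LINT x|lborel. (S x)\<^sup>2)" .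
  qed
  also have "\<dots> = ennreal (LINT x|lborel. (S x)\<^sup>2)"
    by (simp add: nn_integral_multc)
  finally have le: "(\<integral>\<^sup>+x. ennreal ((integral {x..x+1} S)\<^sup>2) \<partial>lborel) \<le> ennreal (LINT x|lborel. (S x)\<^sup>2)" .
  show sq: "sq_int (cr (\<lambda>x. integral {x..x+1} S))"
    unfolding sq_int_def
  proof
    show "integrable lborel (\<lambda>x. (cmod (cr (\<lambda>x. integral {x..x+1} S) x))\<^sup>2)"
      by (rule integrableI_bounded) (use le in \<open>auto intro: le_less_trans\<close>)
  qed measurable
  have "ennreal (LINT x|lborel. (integral {x..x+1} S)\<^sup>2) = (\<integral>\<^sup>+x. ennreal ((integral {x..x+1} S)\<^sup>2) \<partial>lborel)"
    using sq_intD[OF sq] by (intro nn_integral_eq_integral[symmetric]) auto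
  with le have "ennreal (LINT x|lborel. (integral {x..x+1} S)\<^sup>2) \<le> ennreal (LINT x|lborel. (S x)\<^sup>2)"
    by (simp only:)
  then have "(LINT x|lborel. (integral {x..x+1} S)\<^sup>2) \<le> (LINT x|lborel. (S x)\<^sup>2)"
    by (subst (asm) ennreal_le_iff) auto
  then show "norm (L2_of (cr (\<lambda>x. integral {x..x+1} S))) \<le> norm (L2_of (cr S))"
    using S sq by (simp add: norm_L2_of)
qed

section \<open>The nonlinearity in Sobolev spaces\<close>

text \<open>An element \<open>w\<close> of \<open>L2\<close> represents the real function \<open>U 0 w\<close> whose Fourier transform is
  (the Hermitian part of) \<open>(1 + \<xi>\<^sup>2)\<^bsup>- s / 2\<^esup> w(\<xi>)\<close>; \<open>U j w\<close> is its \<open>j\<close>-th derivative. Since the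
  equation gains two derivatives, \<open>f\<close> only has to be controlled in the integer order \<open>m \<ge> s - 2\<close>.\<close>

locale nemytskii =
  fixes s :: real and m :: nat and F :: "nat \<Rightarrow> real \<Rightarrow> real"
  assumes s: "s > 1 / 2" and ms: "s - 2 \<le> real m" and m: "m = 0 \<or> real m + 1 < s"
    and F_DERIV: "\<And>i y. i \<le> m \<Longrightarrow> (F i has_real_derivative F (Suc i) y) (at y)"
    and F_cont: "continuous_on UNIV (F (Suc m))" and F_0: "F 0 0 = 0"
begin

definition gw :: "nat \<Rightarrow> L2 \<Rightarrow> real \<Rightarrow> complex" where
  "gw j w \<xi> = (\<i> * complex_of_real \<xi>) ^ j * (complex_of_real (jb (- s) \<xi>) * fn_of w \<xi>)"

definition U :: "nat \<Rightarrow> L2 \<Rightarrow> real \<Rightarrow> real" where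
  "U j w x = Re (ift (gw j w) x)"

lemma gw_measurable [measurable]: "gw j w \<in> borel_measurable borel"
  unfolding gw_def by measurable

lemma U_measurable [measurable]: "U j w \<in> borel_measurable borel"
  unfolding U_def by measurable

lemma order: "j \<le> m \<Longrightarrow> s - real j > 1 / 2"
  using s m by (cases "m = 0") auto

lemma gw_bound: "cmod (gw j w \<xi>) \<le> jb (- (s - real j)) \<xi> * cmod (fn_of w \<xi>)"
proof -
  have "cmod (gw j w \<xi>) = (\<bar>\<xi>\<bar> ^ j * jb (- s) \<xi>) * cmod (fn_of w \<xi>)"
    by (simp add: gw_def norm_mult norm_power abs_of_pos)
  also have "\<dots> \<le> (jb (real j) \<xi> * jb (- s) \<xi>) * cmod (fn_of w \<xi>)"
    by (intro mult_right_mono abs_power_le_jb) auto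
  also have "jb (real j) \<xi> * jb (- s) \<xi> = jb (- (s - real j)) \<xi>"
    by (simp flip: jb_add)
  finally show ?thesis .
qed

lemma gw_sq_int:
  assumes "real j \<le> s"
  shows "sq_int (gw j w)" "norm (L2_of (gw j w)) \<le> norm w"
proof -
  have b: "cmod (gw j w \<xi>) \<le> 1 * cmod (fn_of w \<xi>)" for \<xi>
  proof -
    have "jb (- (s - real j)) \<xi> * cmod (fn_of w \<xi>) \<le> 1 * cmod (fn_of w \<xi>)"
      using jb_mono[of "- (s - real j)" 0 \<xi>] assms by (intro mult_right_mono) auto
    with gw_bound[of j w \<xi>] show ?thesis by linarith
  qed
  show sq: "sq_int (gw j w)"
    by (rule sq_int_mono[OF sq_int_fn _ b]) measurable
  show "norm (L2_of (gw j w)) \<le> norm w"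
    using norm_L2_of_mono[OF sq sq_int_fn b] by simp
qed

text \<open>A constant for the Sobolev embedding, summed over \<open>j\<close> so that it serves all
  derivatives up to order \<open>m\<close>.\<close>

definition cK :: real where
  "cK = (\<Sum>j\<le>m. norm (L2_of (cr (jb (- (s - real j))))))"

lemma cK_nonneg: "0 \<le> cK"
  by (simp add: cK_def sum_nonneg)

text \<open>The Sobolev embedding on the Fourier side: \<open>jb (- (s - j))\<close> is square
  integrable because \<open>s - j > 1 / 2\<close>, so Cauchy-Schwarz makes the transform integrable
  and thereby \<open>U j w\<close> bounded and continuous.\<close>

lemma gw_integrable:
  assumes "j \<le> m"
  shows "integrable lborel (gw j w)" "(LINT \<xi>|lborel. cmod (gw j w \<xi>)) \<le> cK * norm w"
proof -
  note sq = jb_sq_int[OF order[OF assms]]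
  let ?b = "\<lambda>\<xi>. cmod (cr (jb (- (s - real j))) \<xi>) * cmod (fn_of w \<xi>)"
  have b: "cmod (gw j w \<xi>) \<le> ?b \<xi>" for \<xi>
    using gw_bound[of j w \<xi>] by (simp add: abs_of_pos)
  have bi: "integrable lborel ?b"
    using integrable_norm[OF integrable_sq_int_mult[OF sq sq_int_fn[of w]]] by (simp add: norm_mult)
  show i: "integrable lborel (gw j w)"
    by (rule Bochner_Integration.integrable_bound[OF bi]) (use b in \<open>auto intro: order_trans[OF _ abs_ge_self]\<close>)
  have "(LINT \<xi>|lborel. cmod (gw j w \<xi>)) \<le> (LINT \<xi>|lborel. ?b \<xi>)"
    by (rule integral_mono) (use i bi b in auto)
  also have "\<dots> \<le> norm (L2_of (cr (jb (- (s - real j))))) * norm (L2_of (fn_of w))"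
    by (rule cauchy_schwarz_L2[OF sq sq_int_fn])
  also have "\<dots> \<le> cK * norm w"
    unfolding L2_of_fn cK_def
    by (rule mult_right_mono) (use assms in \<open>auto intro!: member_le_sum\<close>)
  finally show "(LINT \<xi>|lborel. cmod (gw j w \<xi>)) \<le> cK * norm w" .
qed

lemma ift_norm_bound: "cmod (ift g x) \<le> (LINT \<xi>|lborel. cmod (g \<xi>))"
proof -
  have "1 / (2 * pi) \<le> 1" using pi_ge_two by simp
  then have "1 / (2 * pi) * cmod (ft g (- x)) \<le> 1 * (LINT \<xi>|lborel. cmod (g \<xi>))"
    by (intro mult_mono ft_bound) auto
  then show ?thesis
    unfolding ift_def norm_mult by (simp add: norm_divide)
qed

lemma U_bound:
  assumes "j \<le> m"
  shows "\<bar>U j w x\<bar> \<le> cK * norm w"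
proof -
  have "\<bar>U j w x\<bar> \<le> cmod (ift (gw j w) x)"
    unfolding U_def by (rule abs_Re_le_cmod)
  also note ift_norm_bound
  also note gw_integrable(2)[OF assms]
  finally show ?thesis .
qed

lemma U_sq_int:
  assumes "integrable lborel (gw j w)" "real j \<le> s"
  shows "sq_int (cr (U j w))" "norm (L2_of (cr (U j w))) \<le> norm w"
proof -
  note g = ift_sq_int[OF assms(1) gw_sq_int(1)[OF assms(2)]]
  have b: "cmod (cr (U j w) x) \<le> 1 * cmod (ift (gw j w) x)" for x
    using abs_Re_le_cmod by (simp add: U_def)
  show sq: "sq_int (cr (U j w))"
    by (rule sq_int_mono[OF g(1) _ b]) measurable
  have "norm (L2_of (cr (U j w))) \<le> 1 * norm (L2_of (ift (gw j w)))"
    by (rule norm_L2_of_mono[OF sq g(1) b]) simp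
  with g(2) gw_sq_int(2)[OF assms(2), of w] show "norm (L2_of (cr (U j w))) \<le> norm w"
    by linarith
qed

lemma U_sq_int':
  assumes "j \<le> m"
  shows "sq_int (cr (U j w))" "norm (L2_of (cr (U j w))) \<le> norm w"
  using U_sq_int[OF gw_integrable(1)[OF assms]] order[OF assms] by auto

lemma U_diff:
  assumes "j \<le> m"
  shows "U j (v - w) x = U j v x - U j w x"
proof -
  have "ft (gw j (v - w)) = ft (\<lambda>\<xi>. gw j v \<xi> - gw j w \<xi>)"
    unfolding gw_def by (rule ft_cong_AE; measurable?) (use fn_diff[of v w] in eventually_elim, simp only: right_diff_distrib)
  also have "\<dots> = (\<lambda>\<xi>. ft (gw j v) \<xi> - ft (gw j w) \<xi>)"
    by (intro ext ft_diff gw_integrable assms)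
  finally show ?thesis
    by (simp add: U_def ift_def algebra_simps)
qed

lemma U_0: "j \<le> m \<Longrightarrow> U j 0 x = 0"
  using U_diff[of j 0 0 x] by simp

lemma ift_DERIV:
  assumes g: "integrable lborel g" and xg: "integrable lborel (\<lambda>x. \<i> * complex_of_real x * g x)"
  shows "(ift g has_vector_derivative ift (\<lambda>x. \<i> * complex_of_real x * g x) x) (at x)"
proof -
  have xg': "integrable lborel (\<lambda>x. complex_of_real x * g x)"
    using integrable_mult_right[OF xg, of "- \<i>"] by (simp add: mult.assoc)
  have "(uminus has_vector_derivative (-1 :: real)) (at x)"
    by (auto intro!: derivative_eq_intros)
  from vector_diff_chain_at[OF this ft_DERIV[OF g xg', of "- x"]]
  have "((\<lambda>x. ft g (- x)) has_vector_derivative (\<i> * ft (\<lambda>x. complex_of_real x * g x) (- x))) (at x)"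
    by (simp add: o_def ft_cmult[of "- \<i>", simplified])
  then have "((\<lambda>x. complex_of_real (1 / (2 * pi)) * ft g (- x)) has_vector_derivative
      complex_of_real (1 / (2 * pi)) * (\<i> * ft (\<lambda>x. complex_of_real x * g x) (- x))) (at x)"
    by (intro has_vector_derivative_mult_right)
  then show ?thesis
    unfolding ift_def[abs_def] by (simp add: ft_cmult mult.assoc)
qed

lemma gw_Suc: "gw (Suc j) w = (\<lambda>\<xi>. \<i> * complex_of_real \<xi> * gw j w \<xi>)"
  by (simp add: gw_def fun_eq_iff mult.assoc)

lemma U_DERIV:
  assumes "integrable lborel (gw j w)" "integrable lborel (gw (Suc j) w)"
  shows "(U j w has_real_derivative U (Suc j) w x) (at x)"
proof -
  have "(ift (gw j w) has_vector_derivative ift (gw (Suc j) w) x) (at x)"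
    using ift_DERIV[OF assms(1), of x] assms(2) unfolding gw_Suc by simp
  then show ?thesis
    unfolding U_def has_real_derivative_iff_has_vector_derivative
    by (rule bounded_linear.has_vector_derivative[OF bounded_linear_Re])
qed

lemma U_DERIV': "j < m \<Longrightarrow> (U j w has_real_derivative U (Suc j) w x) (at x)"
  by (intro U_DERIV gw_integrable) auto

lemma U_continuous: "integrable lborel (gw j w) \<Longrightarrow> continuous_on A (U j w)"
  unfolding U_def
  by (intro continuous_intros continuous_at_imp_continuous_on ballI ift_continuous)

section \<open>The composition with f and its derivatives\<close>

definition H :: "nat \<Rightarrow> L2 \<Rightarrow> real \<Rightarrow> real" where
  "H j w = comp_deriv F (\<lambda>k. U k w) j"

lemma H_0: "H 0 w x = F 0 (U 0 w x)"
  by (simp add: H_def comp_deriv_0)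

lemma H_DERIV: "j < m \<Longrightarrow> (H j w has_real_derivative H (Suc j) w x) (at x)"
  unfolding H_def by (intro comp_deriv_DERIV U_DERIV' F_DERIV) auto

text \<open>Here \<open>f(0) = 0\<close> enters, for \<open>j = 0\<close>; for larger
  \<open>j\<close> every term has a factor \<open>U k 0 = 0\<close>. Comparison with
  \<open>w = 0\<close> in \<open>H_lipschitz\<close> then shows that \<open>H j w\<close> is square
  integrable.\<close>

lemma H_zero: "j \<le> m \<Longrightarrow> H j 0 x = 0"
proof -
  assume j: "j \<le> m"
  have "fdb_term F (\<lambda>k. U k 0) ks x = 0" if ks: "ks \<in> set (fdb j)" for ks
  proof (cases "j = 0")
    case True
    with ks show ?thesis by (simp add: fdb_term_def dprod_def U_0 F_0)
  next
    case False
    then obtain k where "k \<in> set ks" "k \<le> j"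
      using fdb_bounds[OF ks] by (cases ks) auto
    then have "dprod (\<lambda>k. U k 0) ks x = 0"
      using j U_0[of k x] by (auto simp: dprod_def prod_list_zero_iff image_iff intro!: bexI[of _ k])
    then show ?thesis by (simp add: fdb_term_def)
  qed
  then have "map (\<lambda>ks. fdb_term F (\<lambda>k. U k 0) ks x) (fdb j) = map (\<lambda>_. 0) (fdb j)"
    by (intro map_cong) auto
  then show ?thesis
    unfolding H_def comp_deriv_def by (simp only: sum_list_0)
qed

lemma F_continuous:
  assumes "i \<le> Suc m"
  shows "continuous_on A (F i)"
proof (cases "i = Suc m")
  case True
  then show ?thesis using continuous_on_subset[OF F_cont] by auto
next
  case False
  with assms have "isCont (F i) x" for x
    using F_DERIV[of i x] by (intro DERIV_isCont) auto
  then show ?thesis by (intro continuous_at_imp_continuous_on) auto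
qed

lemma U_m_continuous: "k \<le> m \<Longrightarrow> continuous_on A (U k w)"
  by (intro U_continuous gw_integrable)

lemma H_measurable [measurable]:
  assumes "j \<le> m"
  shows "H j w \<in> borel_measurable borel"
proof (rule borel_measurable_continuous_onI)
  have dp: "continuous_on UNIV (dprod (\<lambda>k. U k w) ks)" if "\<forall>k\<in>set ks. k \<le> m" for ks
    using that by (induction ks) (auto simp: dprod_def[abs_def] intro!: continuous_intros U_m_continuous)
  have "continuous_on UNIV (\<lambda>x. \<Sum>ks\<leftarrow>kss. fdb_term F (\<lambda>k. U k w) ks x)" if "set kss \<subseteq> set (fdb j)" for kss
    using that
  proof (induction kss)
    case (Cons ks kss)
    then have "ks \<in> set (fdb j)" by simp
    note b = fdb_bounds[OF this]
    have "continuous_on UNIV (fdb_term F (\<lambda>k. U k w) ks)"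
      unfolding fdb_term_def[abs_def] using b assms
      by (intro continuous_intros dp continuous_on_compose2[OF F_continuous[of _ UNIV] U_m_continuous[of 0]]) force+
    with Cons show ?case by (auto intro: continuous_on_add)
  qed simp
  then show "continuous_on UNIV (H j w)"
    unfolding H_def comp_deriv_def[abs_def] by blast
qed

text \<open>Boundedness of the continuous function \<open>F (Suc m)\<close> on a compact interval
  yields the Lipschitz bound for \<open>F m\<close>.\<close>

lemma F_bounds: "\<exists>A\<ge>0. \<forall>i\<le>m. \<forall>y z. \<bar>y\<bar> \<le> K \<longrightarrow> \<bar>z\<bar> \<le> K \<longrightarrow> \<bar>F i y\<bar> \<le> A \<and> \<bar>F i y - F i z\<bar> \<le> A * \<bar>y - z\<bar>"
proof -
  have "\<exists>B\<ge>0. \<forall>y\<in>{- K..K}. \<bar>F i y\<bar> \<le> B" if "i \<le> Suc m" for i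
  proof -
    have "bounded (F i ` {- K..K})"
      by (intro compact_imp_bounded compact_continuous_image F_continuous that) auto
    then obtain B where "B > 0" "\<forall>y\<in>F i ` {- K..K}. norm y \<le> B"
      unfolding bounded_pos by blast
    then show ?thesis by (intro exI[of _ B]) auto
  qed
  then obtain B where B: "\<And>i. i \<le> Suc m \<Longrightarrow> B i \<ge> 0" "\<And>i y. i \<le> Suc m \<Longrightarrow> y \<in> {- K..K} \<Longrightarrow> \<bar>F i y\<bar> \<le> B i"
    by metis
  define A where "A = (\<Sum>i\<le>Suc m. B i)"
  have BA: "B i \<le> A" if "i \<le> Suc m" for i
    unfolding A_def by (rule member_le_sum) (use that B in auto)
  have "\<bar>F i y\<bar> \<le> A \<and> \<bar>F i y - F i z\<bar> \<le> A * \<bar>y - z\<bar>" if i: "i \<le> m" and yz: "\<bar>y\<bar> \<le> K" "\<bar>z\<bar> \<le> K" for i y z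
  proof
    have yz': "y \<in> {- K..K}" "z \<in> {- K..K}"
      using yz by (auto simp: abs_le_iff)
    show "\<bar>F i y\<bar> \<le> A"
      using B(2)[of i y] BA[of i] i yz' by force
    have "norm (F i y - F i z) \<le> A * norm (y - z)"
    proof (rule field_differentiable_bound[of "{- K..K}"])
      fix x assume x: "x \<in> {- K..K}"
      show "(F i has_field_derivative F (Suc i) x) (at x within {- K..K})"
        using F_DERIV[OF i] by (rule has_field_derivative_at_within)
      show "norm (F (Suc i) x) \<le> A"
        using B(2)[of "Suc i" x] BA[of "Suc i"] i x by force
    qed (use yz' in auto)
    then show "\<bar>F i y - F i z\<bar> \<le> A * \<bar>y - z\<bar>" by simp
  qed
  moreover have "0 \<le> A"
    unfolding A_def using B by (intro sum_nonneg) auto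
  ultimately show ?thesis by blast
qed

lemma H_lipschitz:
  "\<exists>L\<ge>0. \<forall>v w. norm v \<le> R \<longrightarrow> norm w \<le> R \<longrightarrow> (\<forall>j\<le>m. sq_int (cr (\<lambda>x. H j v x - H j w x)) \<and>
      norm (L2_of (cr (\<lambda>x. H j v x - H j w x))) \<le> L * norm (v - w))"
proof -
  define K where "K = max 1 (cK * R)"
  have K: "1 \<le> K" by (simp add: K_def)
  have UK: "\<bar>U k w x\<bar> \<le> K" if "k \<le> m" "norm w \<le> R" for k w x
  proof -
    have "\<bar>U k w x\<bar> \<le> cK * norm w" by (rule U_bound[OF that(1)])
    also have "\<dots> \<le> cK * R" using that cK_nonneg by (intro mult_left_mono) auto
    finally show ?thesis by (simp add: K_def)
  qed
  obtain A where A: "A \<ge> 0" "\<And>i y z. i \<le> m \<Longrightarrow> \<bar>y\<bar> \<le> K \<Longrightarrow> \<bar>z\<bar> \<le> K \<Longrightarrow> \<bar>F i y\<bar> \<le> A \<and> \<bar>F i y - F i z\<bar> \<le> A * \<bar>y - z\<bar>"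
    using F_bounds[of K] by blast
  have "\<exists>L\<ge>0. \<forall>D E x. (\<forall>k\<le>m. \<bar>D k x\<bar> \<le> K) \<longrightarrow> (\<forall>k\<le>m. \<bar>E k x\<bar> \<le> K) \<longrightarrow>
     (\<forall>j\<le>m. \<bar>comp_deriv F D j x - comp_deriv F E j x\<bar> \<le> L * (\<Sum>k\<le>m. \<bar>D k x - E k x\<bar>))"
    by (rule comp_deriv_lipschitz[OF A(1) K]) (use A(2) in blast)+
  then obtain L where L: "L \<ge> 0" "\<And>D E x j. (\<forall>k\<le>m. \<bar>D k x\<bar> \<le> K) \<Longrightarrow> (\<forall>k\<le>m. \<bar>E k x\<bar> \<le> K) \<Longrightarrow> j \<le> m \<Longrightarrow>
     \<bar>comp_deriv F D j x - comp_deriv F E j x\<bar> \<le> L * (\<Sum>k\<le>m. \<bar>D k x - E k x\<bar>)"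
    by blast
  have "sq_int (cr (\<lambda>x. H j v x - H j w x)) \<and>
      norm (L2_of (cr (\<lambda>x. H j v x - H j w x))) \<le> L * (real (Suc m)) * norm (v - w)"
    if v: "norm v \<le> R" and w: "norm w \<le> R" and j: "j \<le> m" for v w j
  proof -
    note [measurable] = H_measurable[OF j]
    have le: "AE x in lborel. cmod (cr (\<lambda>x. H j v x - H j w x) x) \<le> L * (\<Sum>k\<le>m. cmod (cr (U k (v - w)) x))"
    proof (rule AE_I2)
      fix x
      have "\<bar>H j v x - H j w x\<bar> \<le> L * (\<Sum>k\<le>m. \<bar>U k v x - U k w x\<bar>)"
        unfolding H_def using UK v w j by (intro L(2)) auto
      then show "cmod (cr (\<lambda>x. H j v x - H j w x) x) \<le> L * (\<Sum>k\<le>m. cmod (cr (U k (v - w)) x))"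
        by (simp add: U_diff flip: of_real_diff)
    qed
    have m: "(\<lambda>x. complex_of_real (H j v x - H j w x)) \<in> borel_measurable borel"
      by measurable
    note nl = norm_L2_of_le_sum[OF m _ _ le L(1)]
    have "norm (L2_of (cr (\<lambda>x. H j v x - H j w x))) \<le> L * (\<Sum>k\<le>m. norm (L2_of (cr (U k (v - w)))))"
      by (rule nl(2)) (auto intro: U_sq_int')
    also have "\<dots> \<le> L * (\<Sum>k\<le>m. norm (v - w))"
      using L(1) by (intro mult_left_mono sum_mono U_sq_int') auto
    finally show ?thesis
      using nl(1) by (auto intro: U_sq_int' simp: mult_ac)
  qed
  with L(1) show ?thesis
    by (intro exI[of _ "L * real (Suc m)"]) (auto simp del: of_nat_Suc)
qed

lemma H_sq_int: "j \<le> m \<Longrightarrow> sq_int (cr (H j w))"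
  using H_lipschitz[of "norm w"] H_zero[of j] by (metis (no_types, lifting) diff_zero ext norm_zero norm_ge_zero order_refl)

text \<open>The weight of order \<open>s - 2 \<le> m\<close> is dominated by
  \<open>1 + \<bar>\<xi>\<bar> ^ m\<close> up to a constant, so only \<open>h 0\<close> and
  \<open>h m\<close> matter. The chain \<open>h\<close> is arbitrary since both \<open>H j w\<close>
  and differences of such functions are inserted.\<close>

lemma fourier_weight_bound:
  fixes h :: "nat \<Rightarrow> real \<Rightarrow> real"
  assumes h: "\<And>j. j \<le> m \<Longrightarrow> sq_int (cr (h j))"
    and d: "\<And>j x. j < m \<Longrightarrow> (h j has_real_derivative h (Suc j) x) (at x)"
  shows "sq_int (\<lambda>\<xi>. jb (s - 2) \<xi> * fn_of (FT (L2_of (cr (h 0)))) \<xi>)"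
    "norm (L2_of (\<lambda>\<xi>. jb (s - 2) \<xi> * fn_of (FT (L2_of (cr (h 0)))) \<xi>))
       \<le> 2 ^ m * sqrt (2 * pi) * (norm (L2_of (cr (h 0))) + norm (L2_of (cr (h m))))"
proof -
  have "AE \<xi> in lborel. fn_of (FT (L2_of (cr (h j)))) \<xi> = (\<i> * complex_of_real \<xi>) ^ j * fn_of (FT (L2_of (cr (h 0)))) \<xi>"
    if "j \<le> m" for j
    using that
  proof (induction j)
    case (Suc j)
    have "AE \<xi> in lborel. fn_of (FT (L2_of (cr (h (Suc j))))) \<xi> = \<i> * complex_of_real \<xi> * fn_of (FT (L2_of (cr (h j)))) \<xi>"
      using Suc.prems by (intro FT_derivative h d) auto
    moreover have "AE \<xi> in lborel. fn_of (FT (L2_of (cr (h j)))) \<xi> = (\<i> * complex_of_real \<xi>) ^ j * fn_of (FT (L2_of (cr (h 0)))) \<xi>"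
      using Suc by simp
    ultimately show ?case
      by eventually_elim (simp add: mult_ac)
  qed simp
  from this[of m] have AE_m: "AE \<xi> in lborel. fn_of (FT (L2_of (cr (h m)))) \<xi> = (\<i> * complex_of_real \<xi>) ^ m * fn_of (FT (L2_of (cr (h 0)))) \<xi>"
    by simp
  \<comment> \<open>The index type \<open>bool\<close> turns the two bounding functions into a
    finite family.\<close>
  let ?g = "\<lambda>i :: bool. if i then fn_of (FT (L2_of (cr (h 0)))) else fn_of (FT (L2_of (cr (h m))))"
  have le: "AE \<xi> in lborel. cmod (jb (s - 2) \<xi> * fn_of (FT (L2_of (cr (h 0)))) \<xi>) \<le> 2 ^ m * (\<Sum>i\<in>UNIV. cmod (?g i \<xi>))"
    using AE_m
  proof eventually_elim
    fix \<xi> assume *: "fn_of (FT (L2_of (cr (h m)))) \<xi> = (\<i> * complex_of_real \<xi>) ^ m * fn_of (FT (L2_of (cr (h 0)))) \<xi>"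
    have "cmod (jb (s - 2) \<xi> * fn_of (FT (L2_of (cr (h 0)))) \<xi>) = jb (s - 2) \<xi> * cmod (fn_of (FT (L2_of (cr (h 0)))) \<xi>)"
      by (simp add: norm_mult)
    also have "\<dots> \<le> (2 ^ m * (1 + \<bar>\<xi>\<bar> ^ m)) * cmod (fn_of (FT (L2_of (cr (h 0)))) \<xi>)"
      using order_trans[OF jb_mono[OF ms] jb_le_power] by (intro mult_right_mono) auto
    also have "\<dots> = 2 ^ m * (\<Sum>i\<in>UNIV. cmod (?g i \<xi>))"
      by (simp add: UNIV_bool * norm_mult norm_power algebra_simps)
    finally show "cmod (jb (s - 2) \<xi> * fn_of (FT (L2_of (cr (h 0)))) \<xi>) \<le> 2 ^ m * (\<Sum>i\<in>UNIV. cmod (?g i \<xi>))" .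
  qed
  have mm: "(\<lambda>\<xi>. jb (s - 2) \<xi> * fn_of (FT (L2_of (cr (h 0)))) \<xi>) \<in> borel_measurable borel"
    by measurable
  note nl = norm_L2_of_le_sum[OF mm _ _ le]
  show "sq_int (\<lambda>\<xi>. jb (s - 2) \<xi> * fn_of (FT (L2_of (cr (h 0)))) \<xi>)"
    by (rule nl(1)) auto
  have "norm (L2_of (\<lambda>\<xi>. jb (s - 2) \<xi> * fn_of (FT (L2_of (cr (h 0)))) \<xi>)) \<le> 2 ^ m * (\<Sum>i\<in>UNIV. norm (L2_of (?g i)))"
    by (rule nl(2)) auto
  also have "\<dots> = 2 ^ m * (norm (FT (L2_of (cr (h 0)))) + norm (FT (L2_of (cr (h m)))))"
    by (simp add: UNIV_bool)
  also have "\<dots> \<le> 2 ^ m * (sqrt (2 * pi) * norm (L2_of (cr (h 0))) + sqrt (2 * pi) * norm (L2_of (cr (h m))))"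
    by (intro mult_left_mono add_mono norm_FT) auto
  finally show "norm (L2_of (\<lambda>\<xi>. jb (s - 2) \<xi> * fn_of (FT (L2_of (cr (h 0)))) \<xi>))
       \<le> 2 ^ m * sqrt (2 * pi) * (norm (L2_of (cr (h 0))) + norm (L2_of (cr (h m))))"
    by (simp add: algebra_simps)
qed

text \<open>The transform of \<open>f(u)\<close> carries the weight of order \<open>s - 2\<close>;
  the two missing orders are supplied later by the multiplier \<open>m1\<close>.\<close>

definition NL :: "L2 \<Rightarrow> L2" where
  "NL w = L2_of (\<lambda>\<xi>. jb (s - 2) \<xi> * fn_of (FT (L2_of (cr (H 0 w)))) \<xi>)"

lemma NL_sq_int: "sq_int (\<lambda>\<xi>. jb (s - 2) \<xi> * fn_of (FT (L2_of (cr (H 0 w)))) \<xi>)"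
  by (rule fourier_weight_bound[of "\<lambda>j. H j w"]) (auto intro: H_sq_int H_DERIV)

lemma NL_bound: "norm (NL w) \<le> 2 ^ m * sqrt (2 * pi) * (norm (L2_of (cr (H 0 w))) + norm (L2_of (cr (H m w))))"
  unfolding NL_def by (rule fourier_weight_bound(2)[of "\<lambda>j. H j w"]) (auto intro: H_sq_int H_DERIV)

lemma NL_lipschitz:
  "\<exists>L\<ge>0. \<forall>v w. norm v \<le> R \<longrightarrow> norm w \<le> R \<longrightarrow> norm (NL v - NL w) \<le> L * norm (v - w)"
proof -
  obtain L where L: "L \<ge> 0" "\<And>v w j. norm v \<le> R \<Longrightarrow> norm w \<le> R \<Longrightarrow> j \<le> m \<Longrightarrow> sq_int (cr (\<lambda>x. H j v x - H j w x)) \<and>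
      norm (L2_of (cr (\<lambda>x. H j v x - H j w x))) \<le> L * norm (v - w)"
    using H_lipschitz[of R] by blast
  have "norm (NL v - NL w) \<le> (2 ^ m * sqrt (2 * pi) * (2 * L)) * norm (v - w)" if v: "norm v \<le> R" and w: "norm w \<le> R" for v w
  proof -
    let ?h = "\<lambda>j x. H j v x - H j w x"
    have sq: "sq_int (cr (?h j))" if "j \<le> m" for j
      using L(2)[OF v w that] by blast
    have dh: "(?h j has_real_derivative ?h (Suc j) x) (at x)" if "j < m" for j x
      by (intro DERIV_diff H_DERIV that)
    have "L2_of (cr (?h 0)) = L2_of (cr (H 0 v)) - L2_of (cr (H 0 w))"
      using L2_of_diff[OF H_sq_int[of 0 v] H_sq_int[of 0 w]] by simp
    then have FTd: "FT (L2_of (cr (?h 0))) = FT (L2_of (cr (H 0 v))) - FT (L2_of (cr (H 0 w)))"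
      by (simp add: linear_diff bounded_linear.linear[OF bounded_linear_FT])
    have "NL v - NL w = L2_of (\<lambda>\<xi>. jb (s - 2) \<xi> * fn_of (FT (L2_of (cr (H 0 v)))) \<xi> - jb (s - 2) \<xi> * fn_of (FT (L2_of (cr (H 0 w)))) \<xi>)"
      unfolding NL_def by (intro L2_of_diff[symmetric] NL_sq_int)
    also have "\<dots> = L2_of (\<lambda>\<xi>. jb (s - 2) \<xi> * fn_of (FT (L2_of (cr (?h 0)))) \<xi>)"
    proof (rule L2_of_cong)
      show "sq_int (\<lambda>\<xi>. jb (s - 2) \<xi> * fn_of (FT (L2_of (cr (?h 0)))) \<xi>)"
        by (rule fourier_weight_bound[of ?h, OF sq dh])
      show "AE \<xi> in lborel. jb (s - 2) \<xi> * fn_of (FT (L2_of (cr (H 0 v)))) \<xi> - jb (s - 2) \<xi> * fn_of (FT (L2_of (cr (H 0 w)))) \<xi>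
         = jb (s - 2) \<xi> * fn_of (FT (L2_of (cr (?h 0)))) \<xi>"
        unfolding FTd using fn_diff[of "FT (L2_of (cr (H 0 v)))" "FT (L2_of (cr (H 0 w)))"]
        by eventually_elim (simp add: right_diff_distrib)
    qed (intro sq_int_diff NL_sq_int)
    finally have eq: "NL v - NL w = L2_of (\<lambda>\<xi>. jb (s - 2) \<xi> * fn_of (FT (L2_of (cr (?h 0)))) \<xi>)" .
    have "norm (NL v - NL w) \<le> 2 ^ m * sqrt (2 * pi) * (norm (L2_of (cr (?h 0))) + norm (L2_of (cr (?h m))))"
      unfolding eq by (rule fourier_weight_bound(2)[of ?h, OF sq dh])
    also have "\<dots> \<le> 2 ^ m * sqrt (2 * pi) * (L * norm (v - w) + L * norm (v - w))"
      using L(2)[OF v w, of 0] L(2)[OF v w, of m] by (intro mult_left_mono add_mono) auto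
    finally show ?thesis by (simp add: algebra_simps)
  qed
  with L(1) show ?thesis
    by (intro exI[of _ "2 ^ m * sqrt (2 * pi) * (2 * L)"]) auto
qed

text \<open>At each \<open>x\<close> the pointwise growth estimate is applied on the window starting
  at \<open>x\<close>, with \<open>B x\<close> an integral over that window dominating the suprema
  of \<open>U 0 w\<close> and \<open>U m w\<close>. Integrability of \<open>gw (Suc m) w\<close>
  provides a continuous derivative of order \<open>m + 1\<close> without entering the constant; the
  \<open>L\<^sup>2\<close> bound on this derivative needs only \<open>m + 1 \<le> s\<close>.\<close>

lemma H_moser_bandlimited:
  assumes "m \<ge> 1" "0 \<le> M"
  shows "\<exists>C\<ge>0. \<forall>w. integrable lborel (gw (Suc m) w) \<longrightarrow> (\<forall>x. \<bar>U 0 w x\<bar> \<le> M) \<longrightarrow> norm (L2_of (cr (H m w))) \<le> C * norm w"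
proof -
  obtain A where A: "A \<ge> 0" "\<And>i y z. i \<le> m \<Longrightarrow> \<bar>y\<bar> \<le> M \<Longrightarrow> \<bar>z\<bar> \<le> M \<Longrightarrow> \<bar>F i y\<bar> \<le> A \<and> \<bar>F i y - F i z\<bar> \<le> A * \<bar>y - z\<bar>"
    using F_bounds[of M] by blast
  have "\<exists>C\<ge>0. \<forall>D p B.
     (\<forall>k<m. \<forall>x. (D k has_real_derivative D (Suc k) x) (at x)) \<longrightarrow>
     (\<forall>x. \<bar>D 0 x\<bar> \<le> M) \<longrightarrow> (\<forall>x\<in>{p..p+1}. \<bar>D 0 x\<bar> \<le> B) \<longrightarrow> (\<forall>x\<in>{p..p+1}. \<bar>D m x\<bar> \<le> B) \<longrightarrow>
     \<bar>comp_deriv F D m p\<bar> \<le> C * B"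
    by (rule comp_deriv_moser[OF assms A(1)]) (use A(2) in blast)
  then obtain C where C: "C \<ge> 0" "\<And>D p B.
     (\<forall>k<m. \<forall>x. (D k has_real_derivative D (Suc k) x) (at x)) \<Longrightarrow>
     (\<forall>x. \<bar>D 0 x\<bar> \<le> M) \<Longrightarrow> (\<forall>x\<in>{p..p+1}. \<bar>D 0 x\<bar> \<le> B) \<Longrightarrow> (\<forall>x\<in>{p..p+1}. \<bar>D m x\<bar> \<le> B) \<Longrightarrow>
     \<bar>comp_deriv F D m p\<bar> \<le> C * B" by blast
  have "norm (L2_of (cr (H m w))) \<le> (C * 4) * norm w"
    if i: "integrable lborel (gw (Suc m) w)" and M: "\<forall>x. \<bar>U 0 w x\<bar> \<le> M" for w
  proof -
    have i': "integrable lborel (gw j w)" if "j \<le> Suc m" for j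
      using i gw_integrable(1)[of j w] that by (cases "j = Suc m") auto
    have js: "real j \<le> s" if "j \<le> Suc m" for j
      using that m assms(1) by auto
    have Uc: "continuous_on UNIV (U j w)" if "j \<le> Suc m" for j
      by (intro U_continuous i' that)
    define I where "I = {0, 1, m, Suc m}"
    define S where "S x = (\<bar>U 0 w x\<bar> + \<bar>U 1 w x\<bar>) + (\<bar>U m w x\<bar> + \<bar>U (Suc m) w x\<bar>)" for x
    have Sc: "continuous_on A S" for A
      unfolding S_def using assms(1) by (intro continuous_intros continuous_on_subset[OF Uc]) auto
    have S0: "0 \<le> S x" for x by (simp add: S_def)
    \<comment> \<open>For \<open>m = 1\<close> the four orders are not distinct, so the sum runs
      over positions instead of a set of orders.\<close>
    let ?j = "\<lambda>i::nat. if i = 0 then 0 else if i = 1 then 1 else if i = 2 then m else Suc m"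
    have Smeas: "(\<lambda>x. cr S x) \<in> borel_measurable borel"
      unfolding S_def by measurable
    have Sle: "AE x in lborel. cmod (cr S x) \<le> 1 * (\<Sum>i<4. cmod (cr (U (?j i) w) x))"
    proof (rule AE_I2)
      fix x
      have "cmod (cr S x) = S x"
        by (simp only: norm_of_real abs_of_nonneg[OF S0])
      then show "cmod (cr S x) \<le> 1 * (\<Sum>i<4. cmod (cr (U (?j i) w) x))"
        by (simp only:) (simp add: S_def eval_nat_numeral)
    qed
    have jm: "?j i \<le> Suc m" for i using assms(1) by auto
    have sqU: "sq_int (cr (U (?j i) w))" "norm (L2_of (cr (U (?j i) w))) \<le> norm w" for i
      using U_sq_int[OF i'[OF jm] js[OF jm]] by auto
    have S: "sq_int (cr S)" "norm (L2_of (cr S)) \<le> 1 * (\<Sum>i<4. norm (L2_of (cr (U (?j i) w))))"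
      using norm_L2_of_le_sum[OF Smeas _ sqU(1) Sle] by simp_all
    note S(2)
    also have "1 * (\<Sum>i<4. norm (L2_of (cr (U (?j i) w)))) \<le> 1 * (\<Sum>i<4::nat. norm w)"
      by (intro mult_left_mono sum_mono sqU) auto
    finally have S4: "norm (L2_of (cr S)) \<le> 4 * norm w" by simp
    define B where "B x = integral {x..x+1} S" for x
    have Bsq: "sq_int (cr B)" "norm (L2_of (cr B)) \<le> norm (L2_of (cr S))"
      unfolding B_def using window_average[OF Sc S(1) S0] by auto
    have sup: "\<bar>U j w z\<bar> \<le> B x" if z: "z \<in> {x..x+1}" and j: "j = 0 \<or> j = m" for j z x
    proof -
      have jS: "j \<le> m" using j by auto
      have "\<bar>U j w z\<bar> \<le> integral {x..x+1} (\<lambda>x. \<bar>U j w x\<bar> + \<bar>U (Suc j) w x\<bar>)"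
        using jS by (intro sup_le_window_integral U_DERIV i' Uc z) auto
      also have "\<dots> \<le> B x"
        unfolding B_def
      proof (rule integral_le)
        show "(\<lambda>x. \<bar>U j w x\<bar> + \<bar>U (Suc j) w x\<bar>) integrable_on {x..x+1}"
          using jS by (intro integrable_continuous_real continuous_intros continuous_on_subset[OF Uc]) auto
        show "S integrable_on {x..x+1}"
          by (intro integrable_continuous_real Sc)
        show "\<bar>U j w y\<bar> + \<bar>U (Suc j) w y\<bar> \<le> S y" for y
          using j by (auto simp: S_def)
      qed
      finally show ?thesis .
    qed
    have "\<bar>H m w x\<bar> \<le> C * B x" for x
      unfolding H_def by (rule C(2)) (use U_DERIV' M sup in auto)
    moreover have "0 \<le> B x" for x
      using sup[of x x 0] by (auto intro: order_trans[OF abs_ge_zero])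
    ultimately have "norm (L2_of (cr (H m w))) \<le> C * norm (L2_of (cr B))"
      using C(1) by (intro norm_L2_of_mono H_sq_int Bsq) auto
    also have "\<dots> \<le> C * (4 * norm w)"
      using Bsq(2) S4 C(1) by (intro mult_left_mono) auto
    finally show ?thesis by simp
  qed
  with C(1) show ?thesis
    by (intro exI[of _ "C * 4"]) auto
qed

lemma H_0_bound:
  assumes "0 \<le> M"
  shows "\<exists>C\<ge>0. \<forall>w. (\<forall>x. \<bar>U 0 w x\<bar> \<le> M) \<longrightarrow> norm (L2_of (cr (H 0 w))) \<le> C * norm w"
proof -
  obtain A where A: "A \<ge> 0" "\<And>i y z. i \<le> m \<Longrightarrow> \<bar>y\<bar> \<le> M \<Longrightarrow> \<bar>z\<bar> \<le> M \<Longrightarrow> \<bar>F i y\<bar> \<le> A \<and> \<bar>F i y - F i z\<bar> \<le> A * \<bar>y - z\<bar>"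
    using F_bounds[of M] by blast
  have "norm (L2_of (cr (H 0 w))) \<le> A * norm w" if M: "\<forall>x. \<bar>U 0 w x\<bar> \<le> M" for w
  proof -
    have "\<bar>H 0 w x\<bar> \<le> A * \<bar>U 0 w x\<bar>" for x
      using A(2)[of 0 "U 0 w x" 0] M assms by (simp add: H_0 F_0)
    then have "norm (L2_of (cr (H 0 w))) \<le> A * norm (L2_of (cr (U 0 w)))"
      using A(1) by (intro norm_L2_of_mono H_sq_int U_sq_int') auto
    also have "\<dots> \<le> A * norm w"
      using A(1) by (intro mult_left_mono U_sq_int') auto
    finally show ?thesis .
  qed
  with A(1) show ?thesis by blast
qed

lemma gw_trunc_integrable: "integrable lborel (gw j (L2_of (trunc n w)))"
proof -
  have [measurable]: "trunc n w \<in> borel_measurable borel"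
    using trunc_sq_int by (rule sq_int_measurable)
  have "integrable lborel (\<lambda>\<xi>. trunc n w \<xi> * ((\<i> * complex_of_real \<xi>) ^ j * complex_of_real (jb (- s) \<xi>) * indicator {- real n..real n} \<xi>))"
  proof (rule integrable_bmult[OF trunc_integrable, where B = "real n ^ j"])
    fix \<xi>
    have "\<bar>\<xi>\<bar> ^ j * jb (- s) \<xi> \<le> real n ^ j * 1" if "\<xi> \<in> {- real n..real n}"
      using that jb_mono[of "- s" 0 \<xi>] s by (intro mult_mono power_mono) auto
    then show "cmod ((\<i> * complex_of_real \<xi>) ^ j * complex_of_real (jb (- s) \<xi>) * indicator {- real n..real n} \<xi>) \<le> real n ^ j"
      by (auto simp: norm_mult norm_power indicator_def abs_of_pos)
  qed measurable
  then show ?thesis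
  proof (rule integrable_cong_AE_imp)
    show "AE \<xi> in lborel. trunc n w \<xi> * ((\<i> * complex_of_real \<xi>) ^ j * complex_of_real (jb (- s) \<xi>) * indicator {- real n..real n} \<xi>) = gw j (L2_of (trunc n w)) \<xi>"
      using fn_of_L2[OF trunc_sq_int[of n w]]
      by eventually_elim (auto simp: gw_def trunc_def indicator_def)
  qed measurable
qed

text \<open>For a general \<open>w\<close> the derivative of order \<open>m + 1\<close> is not continuous, so the estimate is
  first obtained for band-limited functions.\<close>

lemma NL_growth:
  assumes "0 \<le> M"
  shows "\<exists>C\<ge>0. \<forall>w. (\<forall>x. \<bar>U 0 w x\<bar> \<le> M) \<longrightarrow> norm (NL w) \<le> C * norm w"
proof -
  \<comment> \<open>The band-limited approximations may exceed the sup bound \<open>M\<close>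
    slightly; by the embedding they stay below \<open>M + 1\<close> from some index on.\<close>
  have M1: "0 \<le> M + 1" using assms by simp
  obtain C0 where C0: "C0 \<ge> 0" "\<And>w. (\<forall>x. \<bar>U 0 w x\<bar> \<le> M + 1) \<Longrightarrow> norm (L2_of (cr (H 0 w))) \<le> C0 * norm w"
    using H_0_bound[OF M1] by blast
  have "\<exists>C\<ge>0. \<forall>w. integrable lborel (gw (Suc m) w) \<longrightarrow> (\<forall>x. \<bar>U 0 w x\<bar> \<le> M + 1) \<longrightarrow> norm (L2_of (cr (H m w))) \<le> C * norm w"
  proof (cases "m = 0")
    case True
    with C0 show ?thesis by auto
  next
    case False
    then show ?thesis by (intro H_moser_bandlimited M1) auto
  qed
  then obtain Cm where Cm: "Cm \<ge> 0" "\<And>w. integrable lborel (gw (Suc m) w) \<Longrightarrow> (\<forall>x. \<bar>U 0 w x\<bar> \<le> M + 1) \<Longrightarrow> norm (L2_of (cr (H m w))) \<le> Cm * norm w"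
    by blast
  define C where "C = 2 ^ m * sqrt (2 * pi) * (C0 + Cm)"
  have "norm (NL w) \<le> C * norm w" if w: "\<forall>x. \<bar>U 0 w x\<bar> \<le> M" for w
  proof -
    define X where "X n = L2_of (trunc n w)" for n
    have X: "X \<longlonglongrightarrow> w"
      unfolding X_def by (rule trunc_tendsto)
    \<comment> \<open>Truncation does not increase the norm, so a single local Lipschitz constant of
      \<open>NL\<close> covers the sequence and its limit.\<close>
    have XR: "norm (X n) \<le> norm w" for n
    proof -
      have "norm (X n) \<le> 1 * norm (L2_of (fn_of w))"
        unfolding X_def by (intro norm_L2_of_mono trunc_sq_int sq_int_fn) (auto simp: trunc_def indicator_def)
      then show ?thesis by simp
    qed
    obtain L where L: "L \<ge> 0" "\<And>u v. norm u \<le> norm w \<Longrightarrow> norm v \<le> norm w \<Longrightarrow> norm (NL u - NL v) \<le> L * norm (u - v)"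
      using NL_lipschitz[of "norm w"] by blast
    have lim0: "(\<lambda>n. c * norm (X n - w)) \<longlonglongrightarrow> 0" for c
      by (intro tendsto_mult_right_zero tendsto_norm_zero LIM_zero X)
    have "(\<lambda>n. NL (X n) - NL w) \<longlonglongrightarrow> 0"
      by (rule Lim_null_comparison[OF always_eventually lim0[of L]]) (use L(2)[OF XR order_refl] in blast)
    then have NLX: "(\<lambda>n. NL (X n)) \<longlonglongrightarrow> NL w"
      by (rule LIM_zero_cancel)
    have "\<forall>\<^sub>F n in sequentially. cK * norm (X n - w) < 1"
      using order_tendstoD(2)[OF lim0[of cK], of 1] by simp
    then have "\<forall>\<^sub>F n in sequentially. norm (NL (X n)) \<le> C * norm (X n)"
    proof eventually_elim
      fix n assume n: "cK * norm (X n - w) < 1"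
      have UM: "\<forall>x. \<bar>U 0 (X n) x\<bar> \<le> M + 1"
      proof
        fix x
        have "U 0 (X n) x = U 0 w x + U 0 (X n - w) x"
          by (simp add: U_diff)
        with U_bound[of 0 "X n - w" x] n w[rule_format, of x] show "\<bar>U 0 (X n) x\<bar> \<le> M + 1"
          by linarith
      qed
      have "norm (L2_of (cr (H 0 (X n)))) \<le> C0 * norm (X n)" "norm (L2_of (cr (H m (X n)))) \<le> Cm * norm (X n)"
        using C0(2)[OF UM] Cm(2)[OF _ UM] gw_trunc_integrable by (auto simp: X_def)
      then have "2 ^ m * sqrt (2 * pi) * (norm (L2_of (cr (H 0 (X n)))) + norm (L2_of (cr (H m (X n)))))
          \<le> 2 ^ m * sqrt (2 * pi) * (C0 * norm (X n) + Cm * norm (X n))"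
        by (intro mult_left_mono add_mono) auto
      with NL_bound[of "X n"] show "norm (NL (X n)) \<le> C * norm (X n)"
        by (simp add: C_def algebra_simps)
    qed
    then show ?thesis
      by (intro tendsto_le[OF _ tendsto_mult_left[OF tendsto_norm[OF X]] tendsto_norm[OF NLX]]) auto
  qed
  moreover have "0 \<le> C"
    using C0(1) Cm(1) by (simp add: C_def)
  ultimately show ?thesis by blast
qed

end

section \<open>Hermitian symmetry and Sobolev functions\<close>

text \<open>On the function side this is complex conjugation, so its fixed points are the transforms
  of real functions.\<close>

definition creflect :: "L2 \<Rightarrow> L2" where
  "creflect w = L2_of (\<lambda>\<xi>. cnj (fn_of w (- \<xi>)))"

lemma AE_reflect:
  fixes Q :: "real \<Rightarrow> bool"
  assumes "Measurable.pred borel Q" "AE x in lborel. Q x"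
  shows "AE x in lborel. Q (- x)"
  using AE_borel_affine[of "-1" Q 0] assms by simp

lemma fn_creflect: "AE \<xi> in lborel. fn_of (creflect w) \<xi> = cnj (fn_of w (- \<xi>))"
  unfolding creflect_def by (intro fn_of_L2 sq_int_cnj sq_int_reflect sq_int_fn)

lemma creflect_creflect: "creflect (creflect w) = w"
proof (rule L2_eqI)
  have "AE \<xi> in lborel. fn_of (creflect w) (- \<xi>) = cnj (fn_of w (- (- \<xi>)))"
    by (rule AE_reflect[OF _ fn_creflect]) measurable
  with fn_creflect[of "creflect w"] show "AE \<xi> in lborel. fn_of (creflect (creflect w)) \<xi> = fn_of w \<xi>"
    by eventually_elim simp
qed

lemma bounded_linear_creflect: "bounded_linear creflect"
proof (rule bounded_linear_intro)
  fix v w :: L2 and r :: real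
  have "AE \<xi> in lborel. fn_of (v + w) (- \<xi>) = fn_of v (- \<xi>) + fn_of w (- \<xi>)"
    by (rule AE_reflect[OF _ fn_add]) measurable
  then have "AE \<xi> in lborel. fn_of (creflect (v + w)) \<xi> = fn_of (creflect v + creflect w) \<xi>"
    using fn_creflect[of v] fn_creflect[of w] fn_creflect[of "v + w"] fn_add[of "creflect v" "creflect w"]
    by eventually_elim simp
  then show "creflect (v + w) = creflect v + creflect w"
    by (rule L2_eqI)
  have "AE \<xi> in lborel. fn_of (r *\<^sub>R v) (- \<xi>) = r *\<^sub>R fn_of v (- \<xi>)"
    by (rule AE_reflect[OF _ fn_scaleR]) measurable
  then have "AE \<xi> in lborel. fn_of (creflect (r *\<^sub>R v)) \<xi> = fn_of (r *\<^sub>R creflect v) \<xi>"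
    using fn_creflect[of v] fn_creflect[of "r *\<^sub>R v"] fn_scaleR[of r "creflect v"]
    by eventually_elim (simp add: scaleR_conv_of_real)
  then show "creflect (r *\<^sub>R v) = r *\<^sub>R creflect v"
    by (rule L2_eqI)
  have sq: "sq_int (\<lambda>\<xi>. cnj (fn_of v (- \<xi>)))"
    by (intro sq_int_cnj sq_int_reflect sq_int_fn)
  have "(norm (creflect v))\<^sup>2 = (norm v)\<^sup>2"
    unfolding creflect_def norm_L2_of_sq[OF sq, unfolded complex_mod_cnj] norm_L2_sq[of v]
    using lborel_integral_real_affine[of "-1" "\<lambda>x. (cmod (fn_of v x))\<^sup>2" 0] by simp
  then show "norm (creflect v) \<le> norm v * 1" by simp
qed

definition herm :: "L2 \<Rightarrow> L2" where
  "herm w = (1 / 2) *\<^sub>R (w + creflect w)"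

lemma bounded_linear_herm: "bounded_linear herm"
  unfolding herm_def
  by (intro bounded_linear_const_scaleR bounded_linear_add bounded_linear_ident bounded_linear_creflect)

lemma creflect_herm: "creflect (herm w) = herm w"
proof -
  interpret creflect: bounded_linear creflect by (rule bounded_linear_creflect)
  show ?thesis by (simp add: herm_def creflect.scaleR creflect.add creflect_creflect add.commute)
qed

lemma creflect_diff: "creflect (v - w) = creflect v - creflect w"
  by (simp add: linear_diff bounded_linear.linear[OF bounded_linear_creflect])

lemma creflect_scaleR: "creflect (r *\<^sub>R w) = r *\<^sub>R creflect w"
  by (simp add: linear_scale bounded_linear.linear[OF bounded_linear_creflect])

lemma ift_cong_AE:
  assumes "f \<in> borel_measurable borel" "g \<in> borel_measurable borel" "AE x in lborel. f x = g x"
  shows "ift f = ift g"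
  using ft_cong_AE[OF assms] by (simp add: ift_def fun_eq_iff)

lemma ift_eq: "ift g x = complex_of_real (1 / (2 * pi)) * (LINT \<xi>|lborel. g \<xi> * cis (x * \<xi>))"
  by (simp add: ift_def ft_def mult.commute)

text \<open>The isometry of \<open>H\<^sup>s\<close>, modulo null sets, onto the Hermitian elements
  of \<open>L2\<close>; its inverse is \<open>U 0\<close>. It carries the equation over to the
  Hilbert space.\<close>

definition Hs_rep :: "real \<Rightarrow> (real \<Rightarrow> real) \<Rightarrow> L2" where
  "Hs_rep s u = L2_of (\<lambda>\<xi>. complex_of_real (jb s \<xi>) * fourier_rep u \<xi>)"

lemma fourier_rep_AE:
  assumes "sq_int (cr u)"
  shows "AE \<xi> in lborel. fourier_rep u \<xi> = fn_of (FT (L2_of (cr u))) \<xi>"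
    and "fourier_rep u \<in> borel_measurable borel"
proof -
  have *: "is_fourier u (fourier_rep u)"
    unfolding fourier_rep_def by (rule someI[of "is_fourier u", OF is_fourier_FT[OF assms]])
  show "AE \<xi> in lborel. fourier_rep u \<xi> = fn_of (FT (L2_of (cr u))) \<xi>"
    by (rule is_fourier_unique[OF * is_fourier_FT[OF assms]])
  show "fourier_rep u \<in> borel_measurable borel"
    using * by (simp add: is_fourier_def)
qed

lemma in_Hs_sq_int:
  assumes "in_Hs s u"
  shows "sq_int (cr u)"
proof -
  have [measurable]: "u \<in> borel_measurable borel"
    using assms by (simp add: in_Hs_def)
  have "cr u \<in> borel_measurable borel" by measurable
  with assms show ?thesis
    by (simp add: in_Hs_def sq_int_def)
qed

lemma in_Hs_weighted_sq_int:
  assumes "in_Hs s u"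
  shows "sq_int (\<lambda>\<xi>. complex_of_real (jb s \<xi>) * fourier_rep u \<xi>)"
proof -
  note sq = in_Hs_sq_int[OF assms]
  note [measurable] = fourier_rep_AE(2)[OF sq]
  obtain g where g: "is_fourier u g" "integrable lborel (\<lambda>\<xi>. (1 + \<xi>\<^sup>2) powr s * (cmod (g \<xi>))\<^sup>2)"
    using assms by (auto simp: in_Hs_def)
  show ?thesis
  proof (rule sq_int_bound[OF g(2)])
    show "AE \<xi> in lborel. (cmod (complex_of_real (jb s \<xi>) * fourier_rep u \<xi>))\<^sup>2 \<le> (1 + \<xi>\<^sup>2) powr s * (cmod (g \<xi>))\<^sup>2"
      using fourier_rep_AE(1)[OF sq] is_fourier_unique[OF g(1) is_fourier_FT[OF sq]]
      by eventually_elim (simp add: norm_mult power_mult_distrib jb_sq)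
  qed measurable
qed

lemma Hs_norm_eq:
  assumes "in_Hs s u"
  shows "Hs_norm s u = norm (Hs_rep s u)"
  unfolding Hs_norm_def Hs_rep_def norm_L2_of[OF in_Hs_weighted_sq_int[OF assms]]
  by (simp add: norm_mult power_mult_distrib jb_sq)

section \<open>Sobolev functions and Hermitian elements\<close>

context nemytskii
begin

lemma U_add: "j \<le> m \<Longrightarrow> U j (v + w) x = U j v x + U j w x"
  using U_diff[of j "v + w" w x] by simp

lemma U_scaleR: "U j (r *\<^sub>R w) x = r * U j w x"
proof -
  have "ft (gw j (r *\<^sub>R w)) = ft (\<lambda>\<xi>. complex_of_real r * gw j w \<xi>)"
    unfolding gw_def by (rule ft_cong_AE; measurable?) (use fn_scaleR[of r w] in eventually_elim, simp add: scaleR_conv_of_real)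
  then have "ift (gw j (r *\<^sub>R w)) x = complex_of_real r * ift (gw j w) x"
    by (simp add: ift_def ft_cmult mult.left_commute)
  then show ?thesis
    by (simp add: U_def)
qed

lemma gw_0_int: "integrable lborel (gw 0 w)" "sq_int (gw 0 w)"
  using gw_integrable[of 0 w] gw_sq_int[of 0 w] s by auto

lemma ift_gw_creflect: "ift (gw 0 (creflect w)) x = cnj (ift (gw 0 w) x)"
proof -
  have "ift (gw 0 (creflect w)) = ift (\<lambda>\<xi>. cnj (gw 0 w (- \<xi>)))"
    unfolding gw_def by (rule ift_cong_AE; measurable?) (use fn_creflect[of w] in eventually_elim, simp)
  then show ?thesis
    by (simp add: ift_def ft_cnj ft_reflect[of "gw 0 w"])
qed

lemma U_herm: "U 0 (herm w) x = U 0 w x"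
  unfolding herm_def U_scaleR U_add[OF le0] by (simp add: U_def ift_gw_creflect)

lemma cr_U: 
  assumes "creflect w = w"
  shows "cr (U 0 w) = ift (gw 0 w)"
proof
  fix x
  have "cnj (ift (gw 0 w) x) = ift (gw 0 w) x"
    using ift_gw_creflect[of w x] assms by simp
  then show "cr (U 0 w) x = ift (gw 0 w) x"
    by (simp add: U_def complex_eq_iff)
qed

text \<open>The working rule for computing \<open>Hs_norm\<close>: it suffices to exhibit a
  Hermitian \<open>z\<close> whose function agrees with \<open>q\<close> almost everywhere; the
  choice inside \<open>fourier_rep\<close> need not be examined.\<close>

lemma Hs_rep_unique:
  assumes [measurable]: "q \<in> borel_measurable borel" and q: "AE x in lborel. q x = U 0 z x" and z: "creflect z = z"
  shows "in_Hs s q" "Hs_rep s q = z" "Hs_norm s q = norm z"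
proof -
  have sq: "sq_int (cr q)"
    by (rule sq_int_cong_AE[OF U_sq_int'(1)[of 0 z]]) (use q in auto)
  have "L2_of (cr q) = L2_of (ift (gw 0 z))"
    by (rule L2_of_cong[OF sq ift_sq_int(1)[OF gw_0_int]]) (use q cr_U[OF z] in \<open>auto simp: fun_eq_iff\<close>)
  then have FTq: "FT (L2_of (cr q)) = L2_of (gw 0 z)"
    by (simp add: FT_ift gw_0_int)
  have AEg: "AE \<xi> in lborel. fn_of (FT (L2_of (cr q))) \<xi> = gw 0 z \<xi>"
    unfolding FTq by (rule fn_of_L2[OF gw_0_int(2)])
  show Hs: "in_Hs s q"
    unfolding in_Hs_def
  proof (intro conjI exI)
    show "is_fourier q (fn_of (FT (L2_of (cr q))))"
      by (rule is_fourier_FT[OF sq])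
    show "integrable lborel (\<lambda>x. (q x)\<^sup>2)"
      using sq_intD[OF sq] by simp
    have "integrable lborel (\<lambda>\<xi>. (cmod (fn_of z \<xi>))\<^sup>2)" by simp
    then show "integrable lborel (\<lambda>\<xi>. (1 + \<xi>\<^sup>2) powr s * (cmod (fn_of (FT (L2_of (cr q))) \<xi>))\<^sup>2)"
    proof (rule integrable_cong_AE_imp)
      show "AE \<xi> in lborel. (cmod (fn_of z \<xi>))\<^sup>2 = (1 + \<xi>\<^sup>2) powr s * (cmod (fn_of (FT (L2_of (cr q))) \<xi>))\<^sup>2"
        using AEg
      proof eventually_elim
        fix \<xi> assume "fn_of (FT (L2_of (cr q))) \<xi> = gw 0 z \<xi>"
        then have "(1 + \<xi>\<^sup>2) powr s * (cmod (fn_of (FT (L2_of (cr q))) \<xi>))\<^sup>2 = (jb s \<xi> * jb (- s) \<xi>)\<^sup>2 * (cmod (fn_of z \<xi>))\<^sup>2"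
          by (simp only: gw_def jb_sq[symmetric] norm_mult power_mult_distrib) (simp add: power_mult_distrib)
        then show "(cmod (fn_of z \<xi>))\<^sup>2 = (1 + \<xi>\<^sup>2) powr s * (cmod (fn_of (FT (L2_of (cr q))) \<xi>))\<^sup>2"
          by simp
      qed
    qed measurable
  qed auto
  show "Hs_rep s q = z"
  proof -
    have "L2_of (\<lambda>\<xi>. complex_of_real (jb s \<xi>) * fourier_rep q \<xi>) = L2_of (fn_of z)"
    proof (rule L2_of_cong[OF in_Hs_weighted_sq_int[OF Hs] sq_int_fn])
      show "AE \<xi> in lborel. complex_of_real (jb s \<xi>) * fourier_rep q \<xi> = fn_of z \<xi>"
        using AEg fourier_rep_AE(1)[OF sq]
      proof eventually_elim
        fix \<xi> assume *: "fn_of (FT (L2_of (cr q))) \<xi> = gw 0 z \<xi>" "fourier_rep q \<xi> = fn_of (FT (L2_of (cr q))) \<xi>"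
        then have "complex_of_real (jb s \<xi>) * fourier_rep q \<xi> = complex_of_real (jb s \<xi> * jb (- s) \<xi>) * fn_of z \<xi>"
          by (simp only: gw_def of_real_mult) simp
        then show "complex_of_real (jb s \<xi>) * fourier_rep q \<xi> = fn_of z \<xi>"
          by simp
      qed
    qed
    then show ?thesis by (simp add: Hs_rep_def)
  qed
  then show "Hs_norm s q = norm z"
    using Hs_norm_eq[OF Hs] by simp
qed

text \<open>Injectivity of \<open>FT\<close> identifies the two functions. Reflecting
  \<open>z\<close> conjugates the function, which is real, so \<open>z\<close> and its reflection
  have the same inverse transform and therefore coincide.\<close>

lemma in_Hs_U:
  assumes "in_Hs s u"
  shows "AE x in lborel. u x = U 0 (Hs_rep s u) x" "creflect (Hs_rep s u) = Hs_rep s u"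
proof -
  define z where "z = Hs_rep s u"
  note sq = in_Hs_sq_int[OF assms]
  note [measurable] = sq_int_cr_measurable[OF sq]
  have "AE \<xi> in lborel. gw 0 z \<xi> = fn_of (FT (L2_of (cr u))) \<xi>"
    using fourier_rep_AE(1)[OF sq] fn_of_L2[OF in_Hs_weighted_sq_int[OF assms]]
  proof eventually_elim
    fix \<xi> assume *: "fourier_rep u \<xi> = fn_of (FT (L2_of (cr u))) \<xi>"
      "fn_of (L2_of (\<lambda>\<xi>. complex_of_real (jb s \<xi>) * fourier_rep u \<xi>)) \<xi> = complex_of_real (jb s \<xi>) * fourier_rep u \<xi>"
    have "gw 0 z \<xi> = complex_of_real (jb (- s) \<xi> * jb s \<xi>) * fourier_rep u \<xi>"
      unfolding z_def Hs_rep_def gw_def * of_real_mult by simp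
    then show "gw 0 z \<xi> = fn_of (FT (L2_of (cr u))) \<xi>"
      using * by simp
  qed
  then have "L2_of (gw 0 z) = FT (L2_of (cr u))"
    using L2_of_cong[OF gw_0_int(2) sq_int_fn] by simp
  then have "FT (L2_of (ift (gw 0 z))) = FT (L2_of (cr u))"
    by (simp add: FT_ift gw_0_int)
  then have eq: "L2_of (ift (gw 0 z)) = L2_of (cr u)"
    by (rule FT_inj)
  have u: "AE x in lborel. ift (gw 0 z) x = cr u x"
    using fn_of_L2[OF ift_sq_int(1)[OF gw_0_int[of z]]] fn_of_L2[OF sq] unfolding eq
    by eventually_elim simp
  then show "AE x in lborel. u x = U 0 (Hs_rep s u) x"
    unfolding z_def[symmetric] U_def by eventually_elim simp
  have "L2_of (ift (gw 0 (creflect z))) = L2_of (ift (gw 0 z))"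
    by (rule L2_of_cong[OF ift_sq_int(1)[OF gw_0_int] ift_sq_int(1)[OF gw_0_int]])
      (use u in eventually_elim, simp add: ift_gw_creflect)
  then have "L2_of (gw 0 (creflect z)) = L2_of (gw 0 z)"
    by (metis FT_ift gw_0_int)
  then have "AE \<xi> in lborel. gw 0 (creflect z) \<xi> = gw 0 z \<xi>"
    using fn_of_L2[OF gw_0_int(2)[of z]] fn_of_L2[OF gw_0_int(2)[of "creflect z"]]
    by (auto elim: eventually_elim2)
  then have "AE \<xi> in lborel. fn_of (creflect z) \<xi> = fn_of z \<xi>"
    by eventually_elim (simp add: gw_def)
  then show "creflect (Hs_rep s u) = Hs_rep s u"
    unfolding z_def[symmetric] by (rule L2_eqI)
qed

end

subsection \<open>The sup norm of continuous functions\<close>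

text \<open>An essential supremum bounds a function almost everywhere only; for continuous
  \<open>v\<close> the set where the bound fails is open, hence empty if it is null. Boundedness
  keeps \<open>real_of_ereal\<close> from returning its default 0 at infinity.\<close>

lemma Linf_norm_continuous:
  fixes v :: "real \<Rightarrow> real"
  assumes c: "continuous_on UNIV v" and b: "\<And>x. \<bar>v x\<bar> \<le> B"
  shows "\<bar>v x\<bar> \<le> Linf_norm v" "Linf_norm v \<le> B"
proof -
  have [measurable]: "v \<in> borel_measurable borel"
    using c by (rule borel_measurable_continuous_onI)
  define e where "e = esssup lborel (\<lambda>x. ereal \<bar>v x\<bar>)"
  have "AE x in lborel. ereal \<bar>v x\<bar> \<le> ereal B"
    using b by simp
  then have eB: "e \<le> ereal B"
    unfolding e_def by (intro esssup_I) auto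
  have e: "AE x in lborel. ereal \<bar>v x\<bar> \<le> e"
    unfolding e_def by (rule esssup_AE)
  \<comment> \<open>Excludes the value \<open>- \<infinity>\<close>, which
    \<open>real_of_ereal\<close> would also map to 0.\<close>
  have "0 \<le> e"
  proof -
    have "AE x in (lborel :: real measure). 0 \<le> e"
      using e by eventually_elim (auto intro: order_trans[rotated])
    then show ?thesis
      by (simp add: AE_iff_null null_sets_def split: if_splits)
  qed
  with eB have r: "e = ereal (Linf_norm v)"
    unfolding Linf_norm_def e_def[symmetric] by (cases e) auto
  show "Linf_norm v \<le> B"
    using eB r by simp
  show "\<bar>v x\<bar> \<le> Linf_norm v"
  proof (rule ccontr)
    assume "\<not> \<bar>v x\<bar> \<le> Linf_norm v"
    define A where "A = {x. Linf_norm v < \<bar>v x\<bar>}"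
    have "open A"
      unfolding A_def using c by (intro open_Collect_less continuous_intros)
    moreover have "x \<in> A"
      using \<open>\<not> _\<close> by (simp add: A_def)
    ultimately obtain d where d: "d > 0" "ball x d \<subseteq> A"
      by (meson openE)
    have "AE x in lborel. x \<notin> A"
      using e r by (auto simp: A_def not_less)
    then have "AE y in lborel. y \<notin> {x - d<..<x + d}"
      by eventually_elim (use d(2) in \<open>auto simp: ball_eq_greaterThanLessThan\<close>)
    then have "emeasure lborel {x - d<..<x + d} = 0"
      by (subst (asm) AE_iff_measurable[where N = "{x - d<..<x + d}"]) auto
    with d(1) show False by simp
  qed
qed

section \<open>The convolution operators as Fourier multipliers\<close>

lemma smooth_trig: "smooth (\<lambda>x. a * cos (c * x) + b * sin (c * x))"
proof (rule smooth_coinduct[where S = "\<lambda>p. \<exists>a b. p = (\<lambda>x. a * cos (c * x) + b * sin (c * x))"], blast)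
  fix q assume "\<exists>a b. q = (\<lambda>x. a * cos (c * x) + b * sin (c * x))"
  then obtain a b where q: "q = (\<lambda>x. a * cos (c * x) + b * sin (c * x))" by blast
  have d: "(q has_real_derivative (b * c) * cos (c * x) + (- a * c) * sin (c * x)) (at x)" for x
    unfolding q by (auto intro!: derivative_eq_intros simp: algebra_simps)
  from deriv_eqI[OF d] d differentiable_real
  show "(\<forall>x. q differentiable (at x)) \<and> (\<exists>a b. deriv q = (\<lambda>x. a * cos (c * x) + b * sin (c * x)))"
    by blast
qed

text \<open>The derivative of the cutoff factor tends to \<open>0\<close> uniformly, so weak derivatives can be tested
  against \<open>cos\<close> and \<open>sin\<close>. The factor is \<open>exp (- 2)\<close> at the origin, whence the constant in the limits.\<close>

definition cutoff :: "nat \<Rightarrow> (real \<Rightarrow> real) \<Rightarrow> real \<Rightarrow> real" where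
  "cutoff n e x = bump 1 (- 1) 1 (inverse (real (Suc n)) * x + 0) * e x"

lemma test_fun_cutoff:
  assumes "smooth e"
  shows "test_fun (cutoff n e)"
  unfolding test_fun_iff
proof
  have "smooth (bump 1 (- 1) 1)"
    using test_fun_bump[of 1 "- 1" 1] by (simp add: test_fun_iff)
  from smooth_mult[OF smooth_affine_comp[OF this, of "inverse (real (Suc n))" 0] assms]
  show "smooth (cutoff n e)"
    unfolding cutoff_def[abs_def] .
  have "cutoff n e x = 0" if "real (Suc n) < \<bar>x\<bar>" for x
  proof -
    have "\<not> (- 1 < inverse (real (Suc n)) * x \<and> inverse (real (Suc n)) * x < 1)"
      using that by (auto simp: field_simps)
    then show ?thesis
      by (auto simp: cutoff_def bump_eq)
  qed
  then show "\<exists>R. \<forall>x. R < \<bar>x\<bar> \<longrightarrow> cutoff n e x = 0" by blast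
qed

lemma cutoff_limits:
  assumes e: "smooth e"
  shows "(\<lambda>n. cutoff n e x) \<longlonglongrightarrow> exp (- 2) * e x"
    "(\<lambda>n. deriv (cutoff n e) x) \<longlonglongrightarrow> exp (- 2) * deriv e x"
    and "\<bar>e x\<bar> \<le> B \<Longrightarrow> \<bar>cutoff n e x\<bar> \<le> B"
    and "\<exists>K. \<forall>n x. \<bar>e x\<bar> \<le> B \<longrightarrow> \<bar>deriv e x\<bar> \<le> B' \<longrightarrow> \<bar>deriv (cutoff n e) x\<bar> \<le> K * B + B'"
proof -
  define b where "b = bump 1 (- 1) 1"
  have tb: "test_fun b"
    unfolding b_def by (rule test_fun_bump) simp
  have b01: "0 \<le> b x" "b x \<le> 1" for x
    using bump_bounds[of 1 "- 1" 1 x] order_trans[OF _ indicator_le_1] unfolding b_def by auto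
  have b0: "b 0 = exp (- 2)"
    by (simp add: b_def bump_eq)
  have c_eq: "cutoff n e x = b (inverse (real (Suc n)) * x) * e x" for n x
    by (simp add: cutoff_def b_def)
  have lim: "(\<lambda>n. inverse (real (Suc n)) * x) \<longlonglongrightarrow> 0"
    using tendsto_mult_right[OF LIMSEQ_inverse_real_of_nat, of x] by simp
  have lb: "(\<lambda>n. b (inverse (real (Suc n)) * x)) \<longlonglongrightarrow> exp (- 2)"
    using isCont_tendsto_compose[OF test_fun_isCont[OF tb] lim] by (simp add: b0)
  then show "(\<lambda>n. cutoff n e x) \<longlonglongrightarrow> exp (- 2) * e x"
    unfolding c_eq by (intro tendsto_intros)
  have d_eq: "deriv (cutoff n e) x = inverse (real (Suc n)) * (deriv b (inverse (real (Suc n)) * x) * e x) + b (inverse (real (Suc n)) * x) * deriv e x" for n x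
  proof (rule DERIV_imp_deriv)
    have "((\<lambda>x. b (inverse (real (Suc n)) * x)) has_real_derivative deriv b (inverse (real (Suc n)) * x) * inverse (real (Suc n))) (at x)"
      by (rule DERIV_chain2[OF test_fun_DERIV[OF tb]]) (auto intro!: derivative_eq_intros)
    from DERIV_mult[OF this smooth_DERIV[OF e]]
    show "(cutoff n e has_real_derivative inverse (real (Suc n)) * (deriv b (inverse (real (Suc n)) * x) * e x) + b (inverse (real (Suc n)) * x) * deriv e x) (at x)"
      unfolding c_eq[abs_def] by (simp add: algebra_simps)
  qed
  note tb' = test_fun_deriv[OF tb]
  have ld: "(\<lambda>n. deriv b (inverse (real (Suc n)) * x)) \<longlonglongrightarrow> deriv b 0"
    using isCont_tendsto_compose[OF test_fun_isCont[OF tb'] lim] .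
  have "(\<lambda>n. inverse (real (Suc n)) * (deriv b (inverse (real (Suc n)) * x) * e x) + b (inverse (real (Suc n)) * x) * deriv e x)
      \<longlonglongrightarrow> 0 * (deriv b 0 * e x) + exp (- 2) * deriv e x"
    by (intro tendsto_intros LIMSEQ_inverse_real_of_nat ld lb)
  then show "(\<lambda>n. deriv (cutoff n e) x) \<longlonglongrightarrow> exp (- 2) * deriv e x"
    unfolding d_eq by simp
  show "\<bar>cutoff n e x\<bar> \<le> B" if "\<bar>e x\<bar> \<le> B"
  proof -
    have "b (inverse (real (Suc n)) * x) * \<bar>e x\<bar> \<le> 1 * B"
      using b01 that by (intro mult_mono) auto
    then show ?thesis
      using b01 by (simp add: c_eq abs_mult)
  qed
  obtain K where K: "K > 0" "\<And>x. \<bar>deriv b x\<bar> \<le> K"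
    using test_fun_bounded[OF tb'] by blast
  have "\<bar>deriv (cutoff n e) x\<bar> \<le> K * B + B'" if "\<bar>e x\<bar> \<le> B" "\<bar>deriv e x\<bar> \<le> B'" for n x
  proof -
    let ?y = "inverse (real (Suc n)) * x"
    have "\<bar>deriv b ?y\<bar> * \<bar>e x\<bar> \<le> K * B"
      using K that by (intro mult_mono) auto
    moreover have "inverse (real (Suc n)) * (\<bar>deriv b ?y\<bar> * \<bar>e x\<bar>) \<le> 1 * (\<bar>deriv b ?y\<bar> * \<bar>e x\<bar>)"
      by (intro mult_right_mono) (auto simp: inverse_le_1_iff)
    moreover have "b ?y * \<bar>deriv e x\<bar> \<le> 1 * B'"
      using b01 that by (intro mult_mono) auto
    moreover have "\<bar>deriv (cutoff n e) x\<bar> \<le> inverse (real (Suc n)) * (\<bar>deriv b ?y\<bar> * \<bar>e x\<bar>) + b ?y * \<bar>deriv e x\<bar>"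
      unfolding d_eq using b01[of ?y] by (intro order_trans[OF abs_triangle_ineq]) (simp add: abs_mult)
    ultimately show ?thesis by linarith
  qed
  then show "\<exists>K. \<forall>n x. \<bar>e x\<bar> \<le> B \<longrightarrow> \<bar>deriv e x\<bar> \<le> B' \<longrightarrow> \<bar>deriv (cutoff n e) x\<bar> \<le> K * B + B'"
    by blast
qed

lemma integral_mult_left_commute:
  fixes c :: real
  shows "(LINT x|M. h x * (c * e x)) = c * (LINT x|M. h x * e x)"
  unfolding integral_mult_right_zero[symmetric] by (simp only: mult.left_commute)

lemma smooth_measurable: "smooth e \<Longrightarrow> e \<in> borel_measurable borel"
  by (intro borel_measurable_continuous_onI continuous_at_imp_continuous_on ballI smooth_isCont)

lemma cutoff_integral_limits:
  fixes h :: "real \<Rightarrow> real"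
  assumes e: "smooth e" and B: "\<And>x. \<bar>e x\<bar> \<le> B" "\<And>x. \<bar>deriv e x\<bar> \<le> B'"
  shows "integrable lborel h \<Longrightarrow> (\<lambda>n. LINT x|lborel. h x * cutoff n e x) \<longlonglongrightarrow> exp (- 2) * (LINT x|lborel. h x * e x)"
    and "integrable lborel h \<Longrightarrow> (\<lambda>n. LINT x|lborel. h x * deriv (cutoff n e) x) \<longlonglongrightarrow> exp (- 2) * (LINT x|lborel. h x * deriv e x)"
    and "Defs.finite_borel_measure M \<Longrightarrow> (\<lambda>n. LINT x|M. cutoff n e x) \<longlonglongrightarrow> exp (- 2) * (LINT x|M. e x)"
proof -
  note [measurable] = smooth_measurable[OF e] smooth_measurable[OF smooth_deriv[OF e]]
  have [measurable]: "cutoff n e \<in> borel_measurable borel" "deriv (cutoff n e) \<in> borel_measurable borel" for n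
    using test_fun_measurable test_fun_deriv test_fun_cutoff[OF e] by blast+
  {
    assume h: "integrable lborel h"
    then have [measurable]: "h \<in> borel_measurable borel" by auto
    have "(\<lambda>n. LINT x|lborel. h x * cutoff n e x) \<longlonglongrightarrow> (LINT x|lborel. h x * (exp (- 2) * e x))"
    proof (rule integral_dominated_convergence)
      show "integrable lborel (\<lambda>x. \<bar>h x\<bar> * B)" using h by simp
      show "AE x in lborel. (\<lambda>n. h x * cutoff n e x) \<longlonglongrightarrow> h x * (exp (- 2) * e x)"
        by (intro AE_I2 tendsto_intros cutoff_limits e)
      show "AE x in lborel. norm (h x * cutoff n e x) \<le> \<bar>h x\<bar> * B" for n
        using cutoff_limits(3)[OF e B(1)] by (auto simp: abs_mult intro!: mult_left_mono)
    qed measurable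
    then show "(\<lambda>n. LINT x|lborel. h x * cutoff n e x) \<longlonglongrightarrow> exp (- 2) * (LINT x|lborel. h x * e x)"
      by (simp only: integral_mult_left_commute)
    obtain K where K: "\<And>n x. \<bar>deriv (cutoff n e) x\<bar> \<le> K * B + B'"
      using cutoff_limits(4)[OF e, of B B'] B by blast
    have "(\<lambda>n. LINT x|lborel. h x * deriv (cutoff n e) x) \<longlonglongrightarrow> (LINT x|lborel. h x * (exp (- 2) * deriv e x))"
    proof (rule integral_dominated_convergence)
      show "integrable lborel (\<lambda>x. \<bar>h x\<bar> * (K * B + B'))" using h by simp
      show "AE x in lborel. (\<lambda>n. h x * deriv (cutoff n e) x) \<longlonglongrightarrow> h x * (exp (- 2) * deriv e x)"
        by (intro AE_I2 tendsto_intros cutoff_limits e)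
      show "AE x in lborel. norm (h x * deriv (cutoff n e) x) \<le> \<bar>h x\<bar> * (K * B + B')" for n
        unfolding real_norm_def abs_mult by (intro AE_I2 mult_left_mono K) auto
    qed measurable
    then show "(\<lambda>n. LINT x|lborel. h x * deriv (cutoff n e) x) \<longlonglongrightarrow> exp (- 2) * (LINT x|lborel. h x * deriv e x)"
      by (simp only: integral_mult_left_commute)
  }
  assume M: "Defs.finite_borel_measure M"
  then interpret M: finite_measure M by (simp add: Defs.finite_borel_measure_def)
  have [measurable_cong]: "sets M = sets borel"
    using M by (simp add: Defs.finite_borel_measure_def)
  have "(\<lambda>n. LINT x|M. cutoff n e x) \<longlonglongrightarrow> (LINT x|M. exp (- 2) * e x)"
  proof (rule integral_dominated_convergence)
    show "integrable M (\<lambda>x. B)" by simp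
    show "AE x in M. (\<lambda>n. cutoff n e x) \<longlonglongrightarrow> exp (- 2) * e x"
      by (intro AE_I2 cutoff_limits e)
    show "AE x in M. norm (cutoff n e x) \<le> B" for n
      using cutoff_limits(3)[OF e B(1)] by auto
  qed measurable
  then show "(\<lambda>n. LINT x|M. cutoff n e x) \<longlonglongrightarrow> exp (- 2) * (LINT x|M. e x)"
    by simp
qed

lemma weak_deriv_bounded:
  assumes w: "weak_deriv h g" and h: "integrable lborel h" and g: "integrable lborel g"
    and e: "smooth e" and B: "\<And>x. \<bar>e x\<bar> \<le> B" "\<And>x. \<bar>deriv e x\<bar> \<le> B'"
  shows "(LINT x|lborel. h x * deriv e x) = - (LINT x|lborel. g x * e x)"
proof -
  have "(LINT x|lborel. h x * deriv (cutoff n e) x) = - (LINT x|lborel. g x * cutoff n e x)" for n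
    using w test_fun_cutoff[OF e] unfolding weak_deriv_def by blast
  then have "(\<lambda>n. LINT x|lborel. h x * deriv (cutoff n e) x) \<longlonglongrightarrow> - (exp (- 2) * (LINT x|lborel. g x * e x))"
    using cutoff_integral_limits(1)[OF e B g] by (simp add: tendsto_minus)
  from LIMSEQ_unique[OF this cutoff_integral_limits(2)[OF e B h]]
  have "exp (- 2) * (LINT x|lborel. h x * deriv e x) = exp (- 2) * (- (LINT x|lborel. g x * e x))"
    by (simp only: mult_minus_right)
  then show ?thesis
    unfolding mult_left_cancel[OF exp_not_eq_zero] .
qed

lemma deriv_is_measure_bounded:
  assumes w: "deriv_is_measure h mp mn" and h: "integrable lborel h"
    and e: "smooth e" and B: "\<And>x. \<bar>e x\<bar> \<le> B" "\<And>x. \<bar>deriv e x\<bar> \<le> B'"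
  shows "- (LINT x|lborel. h x * deriv e x) = (LINT x|mp. e x) - (LINT x|mn. e x)"
proof -
  have fin: "Defs.finite_borel_measure mp" "Defs.finite_borel_measure mn"
    using w by (auto simp: deriv_is_measure_def)
  have eq: "- (LINT x|lborel. h x * deriv (cutoff n e) x) = (LINT x|mp. cutoff n e x) - (LINT x|mn. cutoff n e x)" for n
    using w test_fun_cutoff[OF e] unfolding deriv_is_measure_def by blast
  have "(\<lambda>n. (LINT x|mp. cutoff n e x) - (LINT x|mn. cutoff n e x)) \<longlonglongrightarrow> exp (- 2) * (LINT x|mp. e x) - exp (- 2) * (LINT x|mn. e x)"
    by (intro tendsto_diff cutoff_integral_limits(3)[OF e B] fin)
  moreover have "(\<lambda>n. - (LINT x|lborel. h x * deriv (cutoff n e) x)) \<longlonglongrightarrow> - (exp (- 2) * (LINT x|lborel. h x * deriv e x))"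
    by (intro tendsto_minus cutoff_integral_limits(2)[OF e B h])
  ultimately have "exp (- 2) * (LINT x|mp. e x) - exp (- 2) * (LINT x|mn. e x) = - (exp (- 2) * (LINT x|lborel. h x * deriv e x))"
    unfolding eq by (rule LIMSEQ_unique)
  then have "exp (- 2) * ((LINT x|mp. e x) - (LINT x|mn. e x)) = exp (- 2) * (- (LINT x|lborel. h x * deriv e x))"
    by (simp only: right_diff_distrib mult_minus_right)
  then show ?thesis
    unfolding mult_left_cancel[OF exp_not_eq_zero] by (rule sym)
qed

section \<open>The symbols of the convolution operators\<close>

locale dispersion =
  fixes a1 a2 :: "real \<Rightarrow> real" and mp mn :: "real measure"
  assumes a1: "integrable lborel a1" and a2: "integrable lborel a2"
    and wd: "weak_deriv a1 a2" and dm: "deriv_is_measure a2 mp mn"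
begin

sublocale mp: finite_measure mp
  using dm by (simp add: deriv_is_measure_def Defs.finite_borel_measure_def)

sublocale mn: finite_measure mn
  using dm by (simp add: deriv_is_measure_def Defs.finite_borel_measure_def)

lemma sets_mp [measurable_cong, simp]: "sets mp = sets borel" "sets mn = sets borel"
  using dm by (auto simp: deriv_is_measure_def Defs.finite_borel_measure_def)

lemma space_mp [simp]: "space mp = UNIV" "space mn = UNIV"
  using sets_eq_imp_space_eq[OF sets_mp(1)] sets_eq_imp_space_eq[OF sets_mp(2)] by auto

lemma a_measurable [measurable]: "a1 \<in> borel_measurable borel" "a2 \<in> borel_measurable borel"
  using a1 a2 by auto

definition ah :: "real \<Rightarrow> complex" where "ah = ft (cr a1)"

definition muh :: "real \<Rightarrow> complex" where
  "muh \<xi> = (LINT y|mp. cis (- (y * \<xi>))) - (LINT y|mn. cis (- (y * \<xi>)))"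

definition Bmu :: real where
  "Bmu = measure mp UNIV + measure mn UNIV"

lemma ah_measurable [measurable]: "ah \<in> borel_measurable borel"
  unfolding ah_def by measurable

lemma muh_measurable [measurable]: "muh \<in> borel_measurable borel"
  unfolding muh_def by measurable

lemma muh_bound: "cmod (muh \<xi>) \<le> Bmu"
proof -
  have "cmod (LINT y|mp. cis (- (y * \<xi>))) \<le> (LINT y|mp. cmod (cis (- (y * \<xi>))))"
    "cmod (LINT y|mn. cis (- (y * \<xi>))) \<le> (LINT y|mn. cmod (cis (- (y * \<xi>))))"
    by (rule integral_norm_bound)+
  then show ?thesis
    unfolding muh_def Bmu_def by (intro order_trans[OF norm_triangle_ineq4]) simp
qed

lemma trig_integral_bound: "(LINT x|mp. e x) - (LINT x|mn. e x) \<le> Bmu" "- ((LINT x|mp. e x) - (LINT x|mn. e x)) \<le> Bmu"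
  if [measurable]: "e \<in> borel_measurable borel" and e: "\<And>x. \<bar>e x\<bar> \<le> 1" for e :: "real \<Rightarrow> real"
proof -
  have "\<bar>LINT x|mp. e x\<bar> \<le> (LINT x|mp. 1)"
    using e mp.integrable_const_bound[of e 1] by (intro integral_norm_le[of mp e, simplified]) auto
  moreover have "\<bar>LINT x|mn. e x\<bar> \<le> (LINT x|mn. 1)"
    using e mn.integrable_const_bound[of e 1] by (intro integral_norm_le[of mn e, simplified]) auto
  ultimately show "(LINT x|mp. e x) - (LINT x|mn. e x) \<le> Bmu" "- ((LINT x|mp. e x) - (LINT x|mn. e x)) \<le> Bmu"
    by (auto simp: Bmu_def)
qed

lemma ft_cr_Re_Im:
  assumes "integrable lborel h"
  shows "ft (cr h) \<xi> = Complex (LINT x|lborel. h x * cos (\<xi> * x)) (- (LINT x|lborel. h x * sin (\<xi> * x)))"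
proof -
  have i: "integrable lborel (\<lambda>x. cr h x * cis (- (x * \<xi>)))"
    using assms by (intro integrable_cis) simp
  have "Re (ft (cr h) \<xi>) = (LINT x|lborel. Re (cr h x * cis (- (x * \<xi>))))"
    unfolding ft_def using integral_Re[OF i] by simp
  moreover have "Im (ft (cr h) \<xi>) = (LINT x|lborel. Im (cr h x * cis (- (x * \<xi>))))"
    unfolding ft_def using integral_Im[OF i] by simp
  ultimately show ?thesis
    by (simp add: complex_eq_iff mult.commute[of \<xi>])
qed

text \<open>Two integrations by parts, the second one against the measure, account for the two
  powers of \<open>\<xi>\<close>. Weak derivatives are tested with real functions, so cosine and
  sine are treated separately, whence the factor 2.\<close>

lemma ah_decay: "\<xi>\<^sup>2 * cmod (ah \<xi>) \<le> 2 * Bmu"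
proof -
  define c where "c x = cos (\<xi> * x)" for x
  define d where "d x = sin (\<xi> * x)" for x
  have cs: "smooth c" "smooth d"
    using smooth_trig[of 1 \<xi> 0] smooth_trig[of 0 \<xi> 1] by (simp_all add: c_def[abs_def] d_def[abs_def])
  have dc: "deriv c = (\<lambda>x. - \<xi> * d x)" "deriv d = (\<lambda>x. \<xi> * c x)"
    unfolding c_def[abs_def] d_def[abs_def]
    by (rule deriv_eqI; auto intro!: derivative_eq_intros)+
  have b: "\<bar>c x\<bar> \<le> 1" "\<bar>d x\<bar> \<le> 1" "\<bar>deriv c x\<bar> \<le> \<bar>\<xi>\<bar>" "\<bar>deriv d x\<bar> \<le> \<bar>\<xi>\<bar>" for x
    unfolding dc by (auto simp: c_def d_def abs_mult mult_left_le)
  note w1 = weak_deriv_bounded[OF wd a1 a2 cs(1) b(1,3)] weak_deriv_bounded[OF wd a1 a2 cs(2) b(2,4)]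
  note w2 = deriv_is_measure_bounded[OF dm a2 cs(1) b(1,3)] deriv_is_measure_bounded[OF dm a2 cs(2) b(2,4)]
  have i: "\<xi> * (LINT x|lborel. a1 x * d x) = (LINT x|lborel. a2 x * c x)"
     "\<xi> * (LINT x|lborel. a1 x * c x) = - (LINT x|lborel. a2 x * d x)"
     "\<xi> * (LINT x|lborel. a2 x * d x) = (LINT x|mp. c x) - (LINT x|mn. c x)"
     "- (\<xi> * (LINT x|lborel. a2 x * c x)) = (LINT x|mp. d x) - (LINT x|mn. d x)"
    using w1 w2 unfolding dc by (simp_all add: mult.left_commute[of _ \<xi>])
  have "\<xi>\<^sup>2 * (LINT x|lborel. a1 x * c x) = - (\<xi> * (LINT x|lborel. a2 x * d x))"
    "\<xi>\<^sup>2 * (LINT x|lborel. a1 x * d x) = \<xi> * (LINT x|lborel. a2 x * c x)"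
    using i(1,2) by (simp_all add: power2_eq_square mult.assoc)
  moreover have "\<bar>(LINT x|mp. c x) - (LINT x|mn. c x)\<bar> \<le> Bmu"
    using trig_integral_bound[OF smooth_measurable[OF cs(1)] b(1)] by linarith
  moreover have "\<bar>(LINT x|mp. d x) - (LINT x|mn. d x)\<bar> \<le> Bmu"
    using trig_integral_bound[OF smooth_measurable[OF cs(2)] b(2)] by linarith
  ultimately have 1: "\<bar>\<xi>\<^sup>2 * (LINT x|lborel. a1 x * c x)\<bar> \<le> Bmu" "\<bar>\<xi>\<^sup>2 * (LINT x|lborel. a1 x * d x)\<bar> \<le> Bmu"
    using i(3,4) by linarith+
  have "cmod (ah \<xi>) \<le> \<bar>LINT x|lborel. a1 x * c x\<bar> + \<bar>LINT x|lborel. a1 x * d x\<bar>"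
    using cmod_le[of "ah \<xi>"] unfolding ah_def ft_cr_Re_Im[OF a1] by (simp add: c_def d_def)
  then have "\<xi>\<^sup>2 * cmod (ah \<xi>) \<le> \<xi>\<^sup>2 * (\<bar>LINT x|lborel. a1 x * c x\<bar> + \<bar>LINT x|lborel. a1 x * d x\<bar>)"
    by (rule mult_left_mono) simp
  also have "\<dots> = \<bar>\<xi>\<^sup>2 * (LINT x|lborel. a1 x * c x)\<bar> + \<bar>\<xi>\<^sup>2 * (LINT x|lborel. a1 x * d x)\<bar>"
    by (simp add: abs_mult distrib_left)
  finally show ?thesis using 1 by linarith
qed

definition Ba :: real where
  "Ba = (LINT x|lborel. \<bar>a1 x\<bar>) + 2 * Bmu"

lemma ah_bound: "jb 2 \<xi> * cmod (ah \<xi>) \<le> Ba"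
  using ah_decay[of \<xi>] ft_bound[of "cr a1" \<xi>] unfolding jb_2 Ba_def ah_def by (simp add: distrib_right)

lemma Ba_nonneg: "0 \<le> Ba"
  using ah_bound[of 0] by (rule order_trans[rotated]) simp

text \<open>Integrability of \<open>ah\<close> lets inversion represent \<open>a1\<close> almost
  everywhere by a continuous function.\<close>

lemma ah_int: "integrable lborel ah" "sq_int ah"
proof -
  have b: "cmod (ah \<xi>) \<le> Ba * (1 / (1 + \<xi>\<^sup>2))" for \<xi>
  proof -
    have "0 < 1 + \<xi>\<^sup>2" by (simp add: add_pos_nonneg)
    then show ?thesis
      using ah_bound[of \<xi>] unfolding jb_2 by (simp add: field_simps)
  qed
  have q: "integrable lborel (\<lambda>\<xi>::real. Ba * (1 / (1 + \<xi>\<^sup>2)))"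
    using integrable_inverse_quadratic by (intro integrable_mult_right)
  show i: "integrable lborel ah"
    by (rule Bochner_Integration.integrable_bound[OF q]) (use b Ba_nonneg in auto)
  show "sq_int ah"
  proof (rule sq_int_bound)
    show "integrable lborel (\<lambda>\<xi>. (LINT x|lborel. \<bar>a1 x\<bar>) * cmod (ah \<xi>))"
      using i by simp
    show "AE \<xi> in lborel. (cmod (ah \<xi>))\<^sup>2 \<le> (LINT x|lborel. \<bar>a1 x\<bar>) * cmod (ah \<xi>)"
      unfolding power2_eq_square using ft_bound[of "cr a1"] by (intro AE_I2 mult_right_mono) (auto simp: ah_def)
  qed measurable
qed

text \<open>Pairing \<open>h\<close> with the translate of \<open>a1\<close>, which is the transform of \<open>ah\<close> times a character.\<close>

lemma conv_eq:
  assumes h: "sq_int (cr h)"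
  shows "conv a1 h x = Re (ift (\<lambda>\<xi>. ah \<xi> * fn_of (FT (L2_of (cr h))) \<xi>) x)"
proof -
  note [measurable] = sq_int_cr_measurable[OF h]
  define g where "g \<xi> = complex_of_real (1 / (2 * pi)) * (ah \<xi> * cis (x * \<xi>))" for \<xi>
  have [measurable]: "g \<in> borel_measurable borel"
    unfolding g_def by measurable
  have g: "integrable lborel g" "sq_int g"
  proof -
    show "integrable lborel g"
      unfolding g_def by (intro integrable_mult_right integrable_cis ah_int)
    show "sq_int g"
      by (rule sq_int_mono[OF ah_int(2), of _ "1 / (2 * pi)"]) (auto simp: g_def norm_mult norm_divide)
  qed
  have ftg: "ft g y = ift ah (x - y)" for y
  proof -
    have "cis (x * \<xi>) * cis (- (\<xi> * y)) = cis (- (\<xi> * - (x - y)))" for \<xi>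
      by (simp add: cis_mult algebra_simps)
    then have "ah \<xi> * cis (x * \<xi>) * cis (- (\<xi> * y)) = ah \<xi> * cis (- (\<xi> * - (x - y)))" for \<xi>
      by (simp only: mult.assoc)
    then show ?thesis
      unfolding g_def ft_cmult ift_def by (simp only: ft_def)
  qed
  \<comment> \<open>\<open>a1\<close> equals its continuous representative only almost everywhere;
    reflection and translation preserve null sets, so the convolution is unaffected at every
    \<open>x\<close>.\<close>
  have "AE y in lborel. cr a1 (x + (-1) * y) = ift ah (x + (-1) * y)"
  proof (rule AE_borel_affine)
    show "AE y in lborel. cr a1 y = ift ah y"
      unfolding ah_def by (rule ft_inversion) (use a1 ah_int(1) in \<open>auto simp: ah_def\<close>)
  qed auto
  then have a: "AE y in lborel. cr a1 (x - y) = ift ah (x - y)" by simp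
  have "complex_of_real (conv a1 h x) = (LINT y|lborel. cr a1 (x - y) * cr h y)"
    unfolding conv_def by (simp flip: of_real_mult)
  also have "\<dots> = (LINT y|lborel. fn_of (L2_of (cr h)) y * ft g y)"
    by (rule integral_cong_AE; measurable?) (use a fn_of_L2[OF h] in eventually_elim, simp add: ftg)
  also have "\<dots> = (LINT \<xi>|lborel. fn_of (FT (L2_of (cr h))) \<xi> * g \<xi>)"
    by (rule FT_pairing[OF g, symmetric])
  also have "\<dots> = ift (\<lambda>\<xi>. ah \<xi> * fn_of (FT (L2_of (cr h))) \<xi>) x"
    unfolding ift_def ft_def g_def integral_mult_right_zero[symmetric]
    by (intro Bochner_Integration.integral_cong) (simp_all add: mult_ac)
  finally show ?thesis
    by (metis Re_complex_of_real)
qed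

lemma measure_shift:
  assumes M: "finite_measure M" "sets M = sets borel" and g: "integrable lborel g"
  shows "integrable M (\<lambda>y. ift g (x - y))"
    "(LINT y|M. ift g (x - y)) = ift (\<lambda>\<xi>. (LINT y|M. cis (- (y * \<xi>))) * g \<xi>) x"
proof -
  interpret finite_measure M by (rule M)
  have [measurable_cong]: "sets M = sets borel" by (rule M)
  have [measurable]: "g \<in> borel_measurable borel" using g by auto
  show "integrable M (\<lambda>y. ift g (x - y))"
  proof (rule integrable_const_bound)
    show "AE y in M. cmod (ift g (x - y)) \<le> (LINT \<xi>|lborel. cmod (g \<xi>))"
    proof (rule AE_I2)
      fix y
      have "1 / (2 * pi) \<le> 1" using pi_ge_two by simp
      then have "1 / (2 * pi) * cmod (ft g (- (x - y))) \<le> 1 * (LINT \<xi>|lborel. cmod (g \<xi>))"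
        by (intro mult_mono ft_bound) auto
      then show "cmod (ift g (x - y)) \<le> (LINT \<xi>|lborel. cmod (g \<xi>))"
        unfolding ift_def norm_mult by (simp add: norm_divide)
    qed
  qed measurable
  interpret P: pair_sigma_finite M lborel ..
  have "(LINT y|M. 1 * (LINT \<xi>|lborel. g \<xi> * cis ((x - y) * \<xi>))) = (LINT \<xi>|lborel. g \<xi> * (LINT y|M. 1 * cis ((x - y) * \<xi>)))"
    by (rule P.fubini_kernel[OF _ g, where B = 1]) auto
  moreover have "(LINT y|M. cis ((x - y) * \<xi>)) = (LINT y|M. cis (- (y * \<xi>))) * cis (x * \<xi>)" for \<xi>
  proof -
    have "cis ((x - y) * \<xi>) = cis (- (y * \<xi>)) * cis (x * \<xi>)" for y
      by (simp add: cis_mult algebra_simps)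
    then show ?thesis by simp
  qed
  ultimately have "(LINT y|M. (LINT \<xi>|lborel. g \<xi> * cis ((x - y) * \<xi>))) = (LINT \<xi>|lborel. (LINT y|M. cis (- (y * \<xi>))) * g \<xi> * cis (x * \<xi>))"
    by (simp add: mult_ac)
  then show "(LINT y|M. ift g (x - y)) = ift (\<lambda>\<xi>. (LINT y|M. cis (- (y * \<xi>))) * g \<xi>) x"
    unfolding ift_eq by (simp only: integral_mult_right_zero)
qed

text \<open>\<open>ift g\<close> is a genuine pointwise integral, so the identity holds at every
  \<open>x\<close>, even if the measures have atoms.\<close>

lemma mconv_eq:
  assumes g: "integrable lborel g"
  shows "mconv mp mn (\<lambda>x. Re (ift g x)) x = Re (ift (\<lambda>\<xi>. muh \<xi> * g \<xi>) x)"
proof -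
  have [measurable]: "g \<in> borel_measurable borel" using g by auto
  have b: "cmod (LINT y|M. cis (- (y * \<xi>))) \<le> measure M (space M)" for M and \<xi>
    using integral_norm_bound[of M "\<lambda>y. cis (- (y * \<xi>))"] by simp
  have "integrable lborel (\<lambda>\<xi>. g \<xi> * (LINT y|mp. cis (- (y * \<xi>))))" "integrable lborel (\<lambda>\<xi>. g \<xi> * (LINT y|mn. cis (- (y * \<xi>))))"
    by (rule integrable_bmult[OF g _ b]; measurable)+
  then have i: "integrable lborel (\<lambda>\<xi>. (LINT y|mp. cis (- (y * \<xi>))) * g \<xi>)" "integrable lborel (\<lambda>\<xi>. (LINT y|mn. cis (- (y * \<xi>))) * g \<xi>)"
    by (simp_all only: mult.commute[of _ "g _"])
  note m = measure_shift[OF mp.finite_measure_axioms sets_mp(1) g, of x] measure_shift[OF mn.finite_measure_axioms sets_mp(2) g, of x]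
  have "mconv mp mn (\<lambda>x. Re (ift g x)) x = Re (LINT y|mp. ift g (x - y)) - Re (LINT y|mn. ift g (x - y))"
    unfolding mconv_def using integral_Re[OF m(1)] integral_Re[OF m(3)] by simp
  also have "\<dots> = Re (ift (\<lambda>\<xi>. (LINT y|mp. cis (- (y * \<xi>))) * g \<xi>) x - ift (\<lambda>\<xi>. (LINT y|mn. cis (- (y * \<xi>))) * g \<xi>) x)"
    unfolding m by simp
  also have "ift (\<lambda>\<xi>. (LINT y|mp. cis (- (y * \<xi>))) * g \<xi>) x - ift (\<lambda>\<xi>. (LINT y|mn. cis (- (y * \<xi>))) * g \<xi>) x
      = ift (\<lambda>\<xi>. muh \<xi> * g \<xi>) x"
    unfolding ift_def muh_def left_diff_distrib using ft_diff[OF i] by (simp add: right_diff_distrib)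
  finally show ?thesis .
qed

text \<open>The measures may charge Lebesgue null sets, so the two convolutions can differ at some
  points; by Fubini these points form a null set.\<close>

lemma mconv_cong_AE:
  assumes [measurable]: "v \<in> borel_measurable borel" "v' \<in> borel_measurable borel"
    and eq: "AE x in lborel. v x = v' x"
  shows "AE x in lborel. mconv mp mn v x = mconv mp mn v' x"
proof -
  have *: "AE x in lborel. (LINT y|M. v (x - y)) = (LINT y|M. v' (x - y))"
    if M: "finite_measure M" and [measurable_cong]: "sets M = sets borel" for M
  proof -
    interpret finite_measure M by (rule M)
    interpret P: pair_sigma_finite M lborel ..
    have sp: "space M = UNIV"
      using sets_eq_imp_space_eq[OF \<open>sets M = _\<close>] by simp
    have "AE y in M. AE x in lborel. v (x - y) = v' (x - y)"
    proof (rule AE_I2)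
      fix y
      have "AE x in lborel. v (- y + 1 * x) = v' (- y + 1 * x)"
        by (rule AE_borel_affine[OF _ _ eq]) auto
      then show "AE x in lborel. v (x - y) = v' (x - y)" by simp
    qed
    then have "AE x in lborel. AE y in M. v (x - y) = v' (x - y)"
      by (subst (asm) P.AE_commute) measurable
    then show ?thesis
      by eventually_elim (intro integral_cong_AE; measurable)
  qed
  show ?thesis
    using *[OF mp.finite_measure_axioms sets_mp(1)] *[OF mn.finite_measure_axioms sets_mp(2)]
    unfolding mconv_def by eventually_elim simp
qed

end

section \<open>The initial value problem\<close>

locale ivp = nemytskii s m F + dispersion a1 a2 mp mn
  for s m F a1 a2 mp mn +
  fixes \<kappa> :: real
begin

text \<open>The weights satisfy \<open>jb (- s) * jb 2 * jb (s - 2) = 1\<close>: this bounded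
  multiplier lifts \<open>NL w\<close>, of order \<open>s - 2\<close>, to an element representing
  the convolution of \<open>a1\<close> with \<open>f(u)\<close>.\<close>

definition m1 :: "real \<Rightarrow> complex" where
  "m1 \<xi> = complex_of_real (jb 2 \<xi>) * ah \<xi>"

sublocale M1: bounded_multiplier m1 Ba
proof
  show "m1 \<in> borel_measurable borel"
    unfolding m1_def by measurable
  show "cmod (m1 \<xi>) \<le> Ba" for \<xi>
    using ah_bound[of \<xi>] by (simp add: m1_def norm_mult)
qed

sublocale MU: bounded_multiplier muh Bmu
  by standard (auto intro: muh_bound)

definition G0 :: "L2 \<Rightarrow> L2" where
  "G0 w = (- 1) *\<^sub>R (mulop m1 (NL w) + \<kappa> *\<^sub>R mulop muh w)"

text \<open>The projection \<open>herm\<close> keeps trajectories Hermitian and does not change the function that is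
  represented, see \<open>U_herm\<close>.\<close>

definition G :: "L2 \<Rightarrow> L2" where
  "G w = herm (G0 w)"

lemma U_mulop_muh: "U 0 (mulop muh w) x = mconv mp mn (U 0 w) x"
proof -
  have "ift (gw 0 (mulop muh w)) = ift (\<lambda>\<xi>. muh \<xi> * gw 0 w \<xi>)"
    unfolding gw_def by (rule ift_cong_AE; measurable?) (use MU.fn_mulop[of w] in eventually_elim, simp)
  then show ?thesis
    using mconv_eq[OF gw_0_int(1), of w x] by (simp add: U_def[abs_def])
qed

lemma U_mulop_m1: "U 0 (mulop m1 (NL w)) x = conv a1 (\<lambda>y. F 0 (U 0 w y)) x"
proof -
  have "ift (gw 0 (mulop m1 (NL w))) = ift (\<lambda>\<xi>. ah \<xi> * fn_of (FT (L2_of (cr (H 0 w)))) \<xi>)"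
  proof (rule ift_cong_AE)
    show "AE \<xi> in lborel. gw 0 (mulop m1 (NL w)) \<xi> = ah \<xi> * fn_of (FT (L2_of (cr (H 0 w)))) \<xi>"
      using M1.fn_mulop[of "NL w"] fn_of_L2[OF NL_sq_int[of w]]
    proof eventually_elim
      fix \<xi> assume *: "fn_of (mulop m1 (NL w)) \<xi> = m1 \<xi> * fn_of (NL w) \<xi>"
        "fn_of (L2_of (\<lambda>\<xi>. complex_of_real (jb (s - 2) \<xi>) * fn_of (FT (L2_of (cr (H 0 w)))) \<xi>)) \<xi>
          = complex_of_real (jb (s - 2) \<xi>) * fn_of (FT (L2_of (cr (H 0 w)))) \<xi>"
      have "jb (- s) \<xi> * (jb 2 \<xi> * jb (s - 2) \<xi>) = 1"
        by (simp flip: jb_add)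
      then have "complex_of_real (jb (- s) \<xi>) * (complex_of_real (jb 2 \<xi>) * complex_of_real (jb (s - 2) \<xi>)) = 1"
        by (metis of_real_mult of_real_1)
      then have "complex_of_real (jb (- s) \<xi>) * (complex_of_real (jb 2 \<xi>) * ah \<xi> * (complex_of_real (jb (s - 2) \<xi>) * z)) = ah \<xi> * z" for z
        by (metis (no_types, lifting) mult.assoc mult.commute mult_1)
      then show "gw 0 (mulop m1 (NL w)) \<xi> = ah \<xi> * fn_of (FT (L2_of (cr (H 0 w)))) \<xi>"
        unfolding gw_def *(1) unfolding NL_def *(2) m1_def by simp
    qed
  qed measurable
  then have "U 0 (mulop m1 (NL w)) x = conv a1 (H 0 w) x"
    unfolding conv_eq[OF H_sq_int[OF le0]] by (simp add: U_def)
  then show ?thesis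
    by (simp add: H_0[abs_def])
qed

lemma U_G: "U 0 (G w) x = - conv a1 (\<lambda>y. F 0 (U 0 w y)) x - \<kappa> * mconv mp mn (U 0 w) x"
  unfolding G_def U_herm G0_def U_scaleR U_add[OF le0] U_mulop_muh U_mulop_m1 by simp

lemma creflect_G: "creflect (G w) = G w"
  by (simp add: G_def creflect_herm)

lemma norm_herm: "norm (herm w) \<le> norm w"
proof -
  have sq: "sq_int (\<lambda>\<xi>. cnj (fn_of w (- \<xi>)))"
    by (intro sq_int_cnj sq_int_reflect sq_int_fn)
  have "(norm (creflect w))\<^sup>2 = (norm w)\<^sup>2"
    unfolding creflect_def norm_L2_of_sq[OF sq, unfolded complex_mod_cnj] norm_L2_sq[of w]
    using lborel_integral_real_affine[of "-1" "\<lambda>x. (cmod (fn_of w x))\<^sup>2" 0] by simp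
  then have "norm (creflect w) = norm w" by simp
  then show ?thesis
    using norm_triangle_ineq[of w "creflect w"] by (simp add: herm_def)
qed

text \<open>One estimate for two purposes: local Lipschitz continuity and, since \<open>G\<close>
  and \<open>NL\<close> vanish at 0, the growth bound by taking \<open>w = 0\<close>.\<close>

lemma G_diff: "norm (G v - G w) \<le> Ba * norm (NL v - NL w) + \<bar>\<kappa>\<bar> * Bmu * norm (v - w)"
proof -
  interpret L1: bounded_linear "mulop m1" by (rule M1.bounded_linear_mulop)
  interpret L2: bounded_linear "mulop muh" by (rule MU.bounded_linear_mulop)
  interpret h: bounded_linear herm by (rule bounded_linear_herm)
  have "G v - G w = herm ((- 1) *\<^sub>R (mulop m1 (NL v - NL w) + \<kappa> *\<^sub>R mulop muh (v - w)))"
    by (simp add: G_def G0_def h.diff[symmetric] L1.diff L2.diff algebra_simps)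
  then have "norm (G v - G w) \<le> norm ((- 1) *\<^sub>R (mulop m1 (NL v - NL w) + \<kappa> *\<^sub>R mulop muh (v - w)))"
    using norm_herm by simp
  also have "\<dots> \<le> norm (mulop m1 (NL v - NL w)) + \<bar>\<kappa>\<bar> * norm (mulop muh (v - w))"
    using norm_triangle_ineq[of "mulop m1 (NL v - NL w)" "\<kappa> *\<^sub>R mulop muh (v - w)"]
    by (simp only: norm_scaleR)
  also have "\<dots> \<le> Ba * norm (NL v - NL w) + \<bar>\<kappa>\<bar> * (Bmu * norm (v - w))"
    by (intro add_mono mult_left_mono M1.norm_mulop MU.norm_mulop) auto
  finally show ?thesis by (simp add: mult.assoc)
qed

lemma G_lipschitz:
  "\<exists>L\<ge>0. \<forall>v w. norm v \<le> R \<longrightarrow> norm w \<le> R \<longrightarrow> norm (G v - G w) \<le> L * norm (v - w)"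
proof -
  obtain L where L: "L \<ge> 0" "\<And>v w. norm v \<le> R \<Longrightarrow> norm w \<le> R \<Longrightarrow> norm (NL v - NL w) \<le> L * norm (v - w)"
    using NL_lipschitz[of R] by blast
  have "norm (G v - G w) \<le> (Ba * L + \<bar>\<kappa>\<bar> * Bmu) * norm (v - w)" if "norm v \<le> R" "norm w \<le> R" for v w
  proof -
    have "Ba * norm (NL v - NL w) \<le> Ba * (L * norm (v - w))"
      using that L(2) M1.B_nonneg by (intro mult_left_mono) auto
    with G_diff[of v w] show ?thesis
      by (simp add: algebra_simps)
  qed
  moreover have "0 \<le> Ba * L + \<bar>\<kappa>\<bar> * Bmu"
    using L(1) M1.B_nonneg MU.B_nonneg by simp
  ultimately show ?thesis by blast
qed

lemma NL_0: "NL 0 = 0"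
proof -
  have "\<forall>x. \<bar>U 0 0 x\<bar> \<le> 0" by (simp add: U_0)
  then show ?thesis
    using NL_growth[of 0] by force
qed

lemma G_0: "G 0 = 0"
  by (simp add: G_def G0_def NL_0 linear_0 bounded_linear.linear[OF M1.bounded_linear_mulop]
      bounded_linear.linear[OF MU.bounded_linear_mulop] bounded_linear.linear[OF bounded_linear_herm])

text \<open>Stated for every real \<open>M\<close> so that a total function \<open>\<Phi>\<close>
  can be chosen; for negative \<open>M\<close> the condition on \<open>w\<close> is
  contradictory.\<close>

lemma G_growth: "\<exists>C\<ge>0. \<forall>w. (\<forall>x. \<bar>U 0 w x\<bar> \<le> M) \<longrightarrow> norm (G w) \<le> C * norm w"
proof (cases "0 \<le> M")
  case True
  obtain C where C: "C \<ge> 0" "\<And>w. (\<forall>x. \<bar>U 0 w x\<bar> \<le> M) \<Longrightarrow> norm (NL w) \<le> C * norm w"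
    using NL_growth[OF True] by blast
  have "norm (G w) \<le> (Ba * C + \<bar>\<kappa>\<bar> * Bmu) * norm w" if "\<forall>x. \<bar>U 0 w x\<bar> \<le> M" for w
  proof -
    have "Ba * norm (NL w) \<le> Ba * (C * norm w)"
      using C(2)[OF that] M1.B_nonneg by (intro mult_left_mono) auto
    with G_diff[of w 0] show ?thesis
      by (simp add: G_0 NL_0 algebra_simps)
  qed
  moreover have "0 \<le> Ba * C + \<bar>\<kappa>\<bar> * Bmu"
    using C(1) M1.B_nonneg MU.B_nonneg by simp
  ultimately show ?thesis by blast
next
  case False
  then have "\<not> (\<forall>x. \<bar>U 0 w x\<bar> \<le> M)" for w
    using abs_ge_zero[of "U 0 w 0"] by (meson order_trans)
  then show ?thesis by blast
qed

lemma G_continuous: "continuous_on A G"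
proof -
  have "isCont G w" for w
  proof -
    obtain L where L: "\<And>v u. norm v \<le> norm w + 1 \<Longrightarrow> norm u \<le> norm w + 1 \<Longrightarrow> norm (G v - G u) \<le> L * norm (v - u)"
      using G_lipschitz[of "norm w + 1"] by blast
    have "((\<lambda>v. G v - G w) \<longlongrightarrow> 0) (at w)"
    proof (rule Lim_null_comparison)
      have "\<forall>\<^sub>F v in at w. dist v w < 1"
        by (auto simp: eventually_at intro!: exI[of _ 1])
      then show "\<forall>\<^sub>F v in at w. norm (G v - G w) \<le> L * norm (v - w)"
      proof eventually_elim
        fix v assume "dist v w < 1"
        then have "norm v \<le> norm w + 1"
          using norm_triangle_ineq2[of v w] by (simp add: dist_norm)
        then show "norm (G v - G w) \<le> L * norm (v - w)"
          by (intro L) auto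
      qed
      have "((\<lambda>v. v - w) \<longlongrightarrow> 0) (at w)"
        by (rule LIM_zero) simp
      then show "((\<lambda>v. L * norm (v - w)) \<longlongrightarrow> 0) (at w)"
        by (intro tendsto_mult_right_zero tendsto_norm_zero)
    qed
    then show ?thesis
      unfolding isCont_def by (rule LIM_zero_cancel)
  qed
  then show ?thesis
    by (simp add: continuous_at_imp_continuous_on)
qed

section \<open>Trajectories of the vector field and solutions of the equation\<close>

lemma trajectory_distance:
  assumes y: "continuous_on {0..T} y" "\<And>t. 0 < t \<Longrightarrow> t < T \<Longrightarrow> (y has_vector_derivative G (y t)) (at t)"
    and z: "continuous_on {0..T} z" "\<And>t. 0 < t \<Longrightarrow> t < T \<Longrightarrow> (z has_vector_derivative G (z t)) (at t)"
    and L: "L \<ge> 0" "\<And>v w. norm v \<le> R \<Longrightarrow> norm w \<le> R \<Longrightarrow> norm (G v - G w) \<le> L * norm (v - w)"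
    and R: "\<And>t. t \<in> {0..T} \<Longrightarrow> norm (y t) \<le> R" "\<And>t. t \<in> {0..T} \<Longrightarrow> norm (z t) \<le> R"
    and t: "t \<in> {0..T}"
  shows "norm (y t - z t) \<le> norm (y 0 - z 0) * exp (L * t)"
proof (rule exp_growth[where y = "\<lambda>t. y t - z t" and y' = "\<lambda>t. G (y t) - G (z t)", OF _ L(1) _ _ t])
  show "continuous_on {0..T} (\<lambda>t. y t - z t)"
    by (intro continuous_intros y z)
  fix t assume t: "0 < t" "t < T"
  show "((\<lambda>t. y t - z t) has_vector_derivative G (y t) - G (z t)) (at t)"
    by (intro has_vector_derivative_diff y z t)
  show "norm (G (y t) - G (z t)) \<le> L * norm (y t - z t)"
    using t by (intro L R) auto
qed

lemma at_within_interior_interval: "0 < t \<Longrightarrow> t < T \<Longrightarrow> at t within {0..T} = at t" for t T :: real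
  by (rule at_within_interior) auto

lemma Hs_cont_on_U:
  assumes c: "continuous_on {0..T} z" and h: "\<And>t. t \<in> {0..T} \<Longrightarrow> creflect (z t) = z t"
  shows "Hs_cont_on s T (\<lambda>t. U 0 (z t))"
  unfolding Hs_cont_on_def
proof (intro ballI conjI)
  fix t assume t: "t \<in> {0..T}"
  show "in_Hs s (U 0 (z t))"
    by (rule Hs_rep_unique[OF _ _ h[OF t]]) auto
  have "((\<lambda>\<tau>. norm (z \<tau> - z t)) \<longlongrightarrow> 0) (at t within {0..T})"
    using c t by (intro tendsto_norm_zero LIM_zero) (auto simp: continuous_on_def)
  moreover have "\<forall>\<^sub>F \<tau> in at t within {0..T}. norm (z \<tau> - z t) = Hs_norm s (\<lambda>x. U 0 (z \<tau>) x - U 0 (z t) x)"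
    unfolding eventually_at_filter
  proof (intro always_eventually allI impI)
    fix \<tau> assume "\<tau> \<in> {0..T}"
    then show "norm (z \<tau> - z t) = Hs_norm s (\<lambda>x. U 0 (z \<tau>) x - U 0 (z t) x)"
      by (intro Hs_rep_unique(3)[symmetric]) (auto simp: U_diff creflect_diff h h[OF t])
  qed
  ultimately show "((\<lambda>\<tau>. Hs_norm s (\<lambda>x. U 0 (z \<tau>) x - U 0 (z t) x)) \<longlongrightarrow> 0) (at t within {0..T})"
    by (rule Lim_transform_eventually)
qed

text \<open>The values of \<open>G\<close> are Hermitian, so \<open>y - creflect y\<close> has
  derivative 0 and starts at 0.\<close>

lemma trajectory_hermitian:
  assumes y: "continuous_on {0..T} y" and d: "\<And>t. 0 < t \<Longrightarrow> t < T \<Longrightarrow> (y has_vector_derivative G (y t)) (at t)"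
    and y0: "creflect (y 0) = y 0" and t: "t \<in> {0..T}"
  shows "creflect (y t) = y t"
proof -
  have "norm (y t - creflect (y t)) \<le> norm (y 0 - creflect (y 0)) * exp (0 * t)"
  proof (rule exp_growth[where y = "\<lambda>t. y t - creflect (y t)" and y' = "\<lambda>t. G (y t) - creflect (G (y t))", OF _ order_refl _ _ t])
    show "continuous_on {0..T} (\<lambda>t. y t - creflect (y t))"
      by (intro continuous_on_diff y bounded_linear.continuous_on[OF bounded_linear_creflect])
    fix t assume t: "0 < t" "t < T"
    show "((\<lambda>t. y t - creflect (y t)) has_vector_derivative G (y t) - creflect (G (y t))) (at t)"
      by (intro has_vector_derivative_diff bounded_linear.has_vector_derivative[OF bounded_linear_creflect] d t)
  qed (simp add: creflect_G)
  then show ?thesis by (simp add: y0)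
qed

lemma solution_of_trajectory:
  assumes T: "T > 0" and \<psi>: "in_Hs s \<psi>" and y0: "y 0 = Hs_rep s \<psi>" and yc: "continuous_on {0..T} y"
    and d: "\<And>t. t \<in> {0..T} \<Longrightarrow> (y has_vector_derivative G (y t)) (at t within {0..T})"
  shows "is_solution s \<kappa> a1 mp mn (F 0) \<psi> T (\<lambda>t. U 0 (y t))"
  unfolding is_solution_def
proof (intro conjI exI[of _ "\<lambda>t. U 0 (G (y t))"] ballI)
  have d': "(y has_vector_derivative G (y t)) (at t)" if "0 < t" "t < T" for t
    using d[of t] that at_within_interior_interval[OF that] by auto
  have h: "creflect (y t) = y t" if "t \<in> {0..T}" for t
    using trajectory_hermitian[OF yc d' _ that] in_Hs_U(2)[OF \<psi>] y0 by simp
  show "Hs_cont_on s T (\<lambda>t. U 0 (y t))"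
    by (rule Hs_cont_on_U[OF yc h])
  show "Hs_cont_on s T (\<lambda>t. U 0 (G (y t)))"
    by (rule Hs_cont_on_U) (auto intro: creflect_G continuous_on_compose2[OF G_continuous[of UNIV] yc])
  show "Hs_deriv_on s T (\<lambda>t. U 0 (y t)) (\<lambda>t. U 0 (G (y t)))"
    unfolding Hs_deriv_on_def
  proof
    fix t assume t: "t \<in> {0..T}"
    have "((\<lambda>\<tau>. norm ((1 / (\<tau> - t)) *\<^sub>R (y \<tau> - y t) - G (y t))) \<longlongrightarrow> 0) (at t within {0..T})"
      using d[OF t] unfolding has_vector_derivative_quotient .
    moreover have "\<forall>\<^sub>F \<tau> in at t within {0..T}. norm ((1 / (\<tau> - t)) *\<^sub>R (y \<tau> - y t) - G (y t))
        = Hs_norm s (\<lambda>x. (U 0 (y \<tau>) x - U 0 (y t) x) / (\<tau> - t) - U 0 (G (y t)) x)"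
      unfolding eventually_at_filter
    proof (intro always_eventually allI impI)
      fix \<tau> assume "\<tau> \<in> {0..T}"
      then show "norm ((1 / (\<tau> - t)) *\<^sub>R (y \<tau> - y t) - G (y t))
        = Hs_norm s (\<lambda>x. (U 0 (y \<tau>) x - U 0 (y t) x) / (\<tau> - t) - U 0 (G (y t)) x)"
        by (intro Hs_rep_unique(3)[symmetric]) (auto simp: U_diff U_scaleR creflect_diff creflect_scaleR creflect_G h h[OF t])
    qed
    ultimately show "((\<lambda>\<tau>. Hs_norm s (\<lambda>x. (U 0 (y \<tau>) x - U 0 (y t) x) / (\<tau> - t) - U 0 (G (y t)) x)) \<longlongrightarrow> 0) (at t within {0..T})"
      by (rule Lim_transform_eventually)
  qed
  show "AE x in lborel. U 0 (G (y t)) x + conv a1 (\<lambda>z. F 0 (U 0 (y t) z)) x + \<kappa> * mconv mp mn (U 0 (y t)) x = 0" for t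
    by (simp add: U_G)
  show "AE x in lborel. U 0 (y 0) x = \<psi> x"
    unfolding y0 using in_Hs_U(1)[OF \<psi>] by eventually_elim simp
qed

text \<open>The bridge used for uniqueness: an arbitrary solution, determined only up to null sets
  in \<open>x\<close>, becomes a curve in \<open>L2\<close>. The equation holds for positive times,
  so the derivative is identified in the open interval.\<close>

lemma trajectory_of_solution:
  assumes T: "T > 0" and \<psi>: "in_Hs s \<psi>" and sol: "is_solution s \<kappa> a1 mp mn (F 0) \<psi> T v"
  shows "continuous_on {0..T} (\<lambda>t. Hs_rep s (v t))" "Hs_rep s (v 0) = Hs_rep s \<psi>"
    "\<And>t. 0 < t \<Longrightarrow> t < T \<Longrightarrow> ((\<lambda>t. Hs_rep s (v t)) has_vector_derivative G (Hs_rep s (v t))) (at t)"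
    "\<And>t. t \<in> {0..T} \<Longrightarrow> AE x in lborel. v t x = U 0 (Hs_rep s (v t)) x"
proof -
  obtain v' where vc: "Hs_cont_on s T v" and v'c: "Hs_cont_on s T v'" and vd: "Hs_deriv_on s T v v'"
    and eq: "\<And>t. t \<in> {0<..T} \<Longrightarrow> AE x in lborel. v' t x + conv a1 (\<lambda>y. F 0 (v t y)) x + \<kappa> * mconv mp mn (v t) x = 0"
    and v0: "AE x in lborel. v 0 x = \<psi> x"
    using sol unfolding is_solution_def by blast
  define Y where "Y t = Hs_rep s (v t)" for t
  have Hs: "in_Hs s (v t)" "in_Hs s (v' t)" if "t \<in> {0..T}" for t
    using vc v'c that by (auto simp: Hs_cont_on_def)
  have Y: "AE x in lborel. v t x = U 0 (Y t) x" "creflect (Y t) = Y t" if "t \<in> {0..T}" for t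
    using in_Hs_U[OF Hs(1)[OF that]] by (auto simp: Y_def)
  have v_meas: "v t \<in> borel_measurable borel" "v' t \<in> borel_measurable borel" if "t \<in> {0..T}" for t
    using Hs[OF that] by (auto simp: in_Hs_def)
  show "\<And>t. t \<in> {0..T} \<Longrightarrow> AE x in lborel. v t x = U 0 (Hs_rep s (v t)) x"
    using Y(1) unfolding Y_def .
  show "Hs_rep s (v 0) = Hs_rep s \<psi>"
  proof (rule Hs_rep_unique(2))
    show "v 0 \<in> borel_measurable borel" using v_meas[of 0] T by simp
    show "AE x in lborel. v 0 x = U 0 (Hs_rep s \<psi>) x"
      using v0 in_Hs_U(1)[OF \<psi>] by eventually_elim simp
    show "creflect (Hs_rep s \<psi>) = Hs_rep s \<psi>" by (rule in_Hs_U(2)[OF \<psi>])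
  qed
  show "continuous_on {0..T} (\<lambda>t. Hs_rep s (v t))"
    unfolding continuous_on_def Y_def[symmetric]
  proof
    fix t assume t: "t \<in> {0..T}"
    have "((\<lambda>\<tau>. Hs_norm s (\<lambda>x. v \<tau> x - v t x)) \<longlongrightarrow> 0) (at t within {0..T})"
      using vc t by (auto simp: Hs_cont_on_def)
    moreover have "\<forall>\<^sub>F \<tau> in at t within {0..T}. Hs_norm s (\<lambda>x. v \<tau> x - v t x) = norm (Y \<tau> - Y t)"
      unfolding eventually_at_filter
    proof (intro always_eventually allI impI)
      fix \<tau> assume \<tau>: "\<tau> \<in> {0..T}"
      note [measurable] = v_meas[OF t] v_meas[OF \<tau>]
      show "Hs_norm s (\<lambda>x. v \<tau> x - v t x) = norm (Y \<tau> - Y t)"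
      proof (rule Hs_rep_unique(3))
        show "AE x in lborel. v \<tau> x - v t x = U 0 (Y \<tau> - Y t) x"
          using Y(1)[OF t] Y(1)[OF \<tau>] by eventually_elim (simp add: U_diff)
        show "creflect (Y \<tau> - Y t) = Y \<tau> - Y t"
          by (simp add: creflect_diff Y(2)[OF t] Y(2)[OF \<tau>])
      qed measurable
    qed
    ultimately have "((\<lambda>\<tau>. norm (Y \<tau> - Y t)) \<longlongrightarrow> 0) (at t within {0..T})"
      by (rule Lim_transform_eventually)
    then show "(Y \<longlongrightarrow> Y t) (at t within {0..T})"
      by (rule LIM_zero_cancel[OF tendsto_norm_zero_cancel])
  qed
  fix t assume t0: "0 < t" "t < T"
  then have t: "t \<in> {0..T}" by simp
  \<comment> \<open>In the equation \<open>v t\<close> may be replaced by its continuous version: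
    this leaves the convolution with \<open>a1\<close> unchanged at every point, and the one with
    the measures almost everywhere.\<close>
  have "Hs_rep s (v' t) = G (Y t)"
  proof (rule Hs_rep_unique(2)[OF v_meas(2)[OF t] _ creflect_G])
    have "continuous_on UNIV (F 0)" by (rule F_continuous) simp
    then have [measurable]: "F 0 \<in> borel_measurable borel" by (rule borel_measurable_continuous_onI)
    note [measurable] = v_meas[OF t]
    have c: "conv a1 (\<lambda>y. F 0 (v t y)) x = conv a1 (\<lambda>y. F 0 (U 0 (Y t) y)) x" for x
      unfolding conv_def by (rule integral_cong_AE; measurable?) (use Y(1)[OF t] in eventually_elim, simp)
    have m: "AE x in lborel. mconv mp mn (v t) x = mconv mp mn (U 0 (Y t)) x"
      by (rule mconv_cong_AE[OF _ _ Y(1)[OF t]]) measurable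
    show "AE x in lborel. v' t x = U 0 (G (Y t)) x"
      using eq[of t, unfolded c] m t0 by (auto simp: U_G elim!: eventually_elim2)
  qed
  moreover have "(Y has_vector_derivative Hs_rep s (v' t)) (at t within {0..T})"
    unfolding has_vector_derivative_quotient
  proof (rule Lim_transform_eventually)
    show "((\<lambda>\<tau>. Hs_norm s (\<lambda>x. (v \<tau> x - v t x) / (\<tau> - t) - v' t x)) \<longlongrightarrow> 0) (at t within {0..T})"
      using vd t by (auto simp: Hs_deriv_on_def)
    show "\<forall>\<^sub>F \<tau> in at t within {0..T}. Hs_norm s (\<lambda>x. (v \<tau> x - v t x) / (\<tau> - t) - v' t x)
        = norm ((1 / (\<tau> - t)) *\<^sub>R (Y \<tau> - Y t) - Hs_rep s (v' t))"
      unfolding eventually_at_filter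
    proof (intro always_eventually allI impI)
      fix \<tau> assume \<tau>: "\<tau> \<in> {0..T}"
      note [measurable] = v_meas[OF t] v_meas[OF \<tau>]
      show "Hs_norm s (\<lambda>x. (v \<tau> x - v t x) / (\<tau> - t) - v' t x) = norm ((1 / (\<tau> - t)) *\<^sub>R (Y \<tau> - Y t) - Hs_rep s (v' t))"
      proof (rule Hs_rep_unique(3))
        show "AE x in lborel. (v \<tau> x - v t x) / (\<tau> - t) - v' t x = U 0 ((1 / (\<tau> - t)) *\<^sub>R (Y \<tau> - Y t) - Hs_rep s (v' t)) x"
          using Y(1)[OF t] Y(1)[OF \<tau>] in_Hs_U(1)[OF Hs(2)[OF t]] by eventually_elim (simp add: U_diff U_scaleR)
        show "creflect ((1 / (\<tau> - t)) *\<^sub>R (Y \<tau> - Y t) - Hs_rep s (v' t)) = (1 / (\<tau> - t)) *\<^sub>R (Y \<tau> - Y t) - Hs_rep s (v' t)"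
          by (simp add: creflect_diff creflect_scaleR Y(2)[OF t] Y(2)[OF \<tau>] in_Hs_U(2)[OF Hs(2)[OF t]])
      qed measurable
    qed
  qed
  ultimately show "((\<lambda>t. Hs_rep s (v t)) has_vector_derivative G (Hs_rep s (v t))) (at t)"
    unfolding Y_def[symmetric] using at_within_interior_interval[OF t0] by simp
qed

text \<open>\<open>\<Phi>\<close> is a parameter here so that it can be fixed before the datum is
  given.\<close>

theorem local_well_posedness:
  assumes \<Phi>: "\<And>M. \<Phi> M \<ge> 0" "\<And>M w. (\<forall>x. \<bar>U 0 w x\<bar> \<le> M) \<Longrightarrow> norm (G w) \<le> \<Phi> M * norm w"
    and \<phi>: "in_Hs s \<phi>"
  shows "\<exists>T>0. \<exists>u.
        is_solution s \<kappa> a1 mp mn (F 0) \<phi> T u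
      \<and> (\<forall>v. is_solution s \<kappa> a1 mp mn (F 0) \<phi> T v \<longrightarrow>
            (\<forall>t\<in>{0..T}. AE x in lborel. v t x = u t x))
      \<and> (\<forall>\<epsilon>>0. \<exists>\<delta>>0. \<forall>\<psi>. in_Hs s \<psi> \<and> Hs_norm s (\<lambda>x. \<psi> x - \<phi> x) < \<delta> \<longrightarrow>
            (\<exists>v. is_solution s \<kappa> a1 mp mn (F 0) \<psi> T v \<and>
                 (\<forall>t\<in>{0..T}. Hs_norm s (\<lambda>x. v t x - u t x) < \<epsilon>)))
      \<and> (let M = Sup ((\<lambda>t. Linf_norm (u t)) ` {0..T}) in
           \<forall>t\<in>{0..T}. Hs_norm s (u t) \<le> Hs_norm s \<phi> * exp (\<Phi> M * t))"
proof -
  define r0 where "r0 = Hs_rep s \<phi>"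
  \<comment> \<open>One unit leaves room for perturbed data at distance less than 1, the other is
    the margin demanded by \<open>picard\<close>; thus one \<open>T\<close> serves all nearby
    data.\<close>
  define R where "R = norm r0 + 2"
  obtain L where L: "L \<ge> 0" "\<And>v w. norm v \<le> R \<Longrightarrow> norm w \<le> R \<Longrightarrow> norm (G v - G w) \<le> L * norm (v - w)"
    using G_lipschitz[of R] by blast
  have R0: "0 \<le> R" by (simp add: R_def)
  have K: "norm (G w) \<le> L * R" if "norm w \<le> R" for w
  proof -
    have "norm (G w - G 0) \<le> L * norm (w - 0)"
      using that R0 by (intro L) auto
    also have "\<dots> \<le> L * R"
      using that L(1) by (intro mult_left_mono) auto
    finally show ?thesis by (simp add: G_0)
  qed
  \<comment> \<open>Both \<open>T * L\<close> and \<open>T * (L * R)\<close> are at most one half;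
    \<open>L * R\<close> bounds \<open>G\<close> on the ball because \<open>G 0 = 0\<close>, and the
    summand 1 keeps the denominator positive.\<close>
  define T where "T = 1 / (2 * (L * R + L + 1))"
  have LR: "0 \<le> L * R" using L(1) R0 by simp
  have T: "T > 0" "T * L \<le> 1 / 2" "T * (L * R) \<le> 1"
    using LR L(1) by (auto simp: T_def field_simps)
  have ex: "\<exists>y. continuous_on {0..T} y \<and> y 0 = y0 \<and> (\<forall>t\<in>{0..T}. norm (y t) \<le> R) \<and>
      (\<forall>t\<in>{0..T}. (y has_vector_derivative G (y t)) (at t within {0..T}))" if "norm y0 \<le> norm r0 + 1" for y0
  proof (rule picard[where L = L and K = "L * R"])
    show "norm y0 + 1 \<le> R" using that by (simp add: R_def)
  qed (use L T K in auto)
  have inner: "(y has_vector_derivative G (y t)) (at t)"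
    if "\<forall>t\<in>{0..T}. (y has_vector_derivative G (y t)) (at t within {0..T})" "0 < t" "t < T" for y t
    using bspec[OF that(1), of t] that at_within_interior_interval[OF that(2,3)] by auto
  obtain y where y: "continuous_on {0..T} y" "y 0 = r0" "\<And>t. t \<in> {0..T} \<Longrightarrow> norm (y t) \<le> R"
    and yd: "\<forall>t\<in>{0..T}. (y has_vector_derivative G (y t)) (at t within {0..T})"
    using ex[of r0] by auto
  define u where "u t = U 0 (y t)" for t
  have sol: "is_solution s \<kappa> a1 mp mn (F 0) \<phi> T u"
    unfolding u_def[abs_def] using y yd by (intro solution_of_trajectory T \<phi>) (auto simp: r0_def)
  have herm: "creflect (y t) = y t" if "t \<in> {0..T}" for t
    using in_Hs_U(2)[OF \<phi>] y(2) by (intro trajectory_hermitian[OF y(1) inner[OF yd] _ that]) (auto simp: r0_def)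
  have uniq: "AE x in lborel. v t x = u t x" if v: "is_solution s \<kappa> a1 mp mn (F 0) \<phi> T v" and t: "t \<in> {0..T}" for v t
  proof -
    note Y = trajectory_of_solution[OF T(1) \<phi> v]
    \<comment> \<open>A competing solution is not known to remain in the ball of radius
      \<open>R\<close>; compactness of \<open>{0..T}\<close> gives it a bound of its own, and
      \<open>G\<close> has a Lipschitz constant on every ball.\<close>
    have "bounded ((\<lambda>t. Hs_rep s (v t)) ` {0..T})"
      by (intro compact_imp_bounded compact_continuous_image Y(1)) auto
    then obtain R1 where R1: "\<And>t. t \<in> {0..T} \<Longrightarrow> norm (Hs_rep s (v t)) \<le> R1"
      unfolding bounded_iff by blast
    obtain L' where L': "L' \<ge> 0" "\<And>v w. norm v \<le> max R R1 \<Longrightarrow> norm w \<le> max R R1 \<Longrightarrow> norm (G v - G w) \<le> L' * norm (v - w)"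
      using G_lipschitz[of "max R R1"] by blast
    have "norm (Hs_rep s (v t) - y t) \<le> norm (Hs_rep s (v 0) - y 0) * exp (L' * t)"
      by (rule trajectory_distance[OF Y(1,3) y(1) inner[OF yd] L' _ _ t]) (use R1 y(3) in \<open>auto intro: le_max_iff_disj[THEN iffD2]\<close>)
    then have "Hs_rep s (v t) = y t"
      using Y(2) y(2) by (simp add: r0_def)
    with Y(4)[OF t] show ?thesis by (simp add: u_def)
  qed
  have dep: "\<exists>\<delta>>0. \<forall>\<psi>. in_Hs s \<psi> \<and> Hs_norm s (\<lambda>x. \<psi> x - \<phi> x) < \<delta> \<longrightarrow>
          (\<exists>v. is_solution s \<kappa> a1 mp mn (F 0) \<psi> T v \<and> (\<forall>t\<in>{0..T}. Hs_norm s (\<lambda>x. v t x - u t x) < \<epsilon>))" if \<epsilon>: "\<epsilon> > 0" for \<epsilon>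
  \<comment> \<open>The minimum with 1 keeps the perturbed datum within the reach of the common
    \<open>T\<close>; the exponential compensates the growth of distances up to time
    \<open>T\<close>.\<close>
  proof (rule exI[of _ "min 1 (\<epsilon> * exp (- (L * T)))"], intro conjI allI impI)
    show "0 < min 1 (\<epsilon> * exp (- (L * T)))" using \<epsilon> by simp
    fix \<psi> assume "in_Hs s \<psi> \<and> Hs_norm s (\<lambda>x. \<psi> x - \<phi> x) < min 1 (\<epsilon> * exp (- (L * T)))"
    then have \<psi>: "in_Hs s \<psi>" and close: "Hs_norm s (\<lambda>x. \<psi> x - \<phi> x) < min 1 (\<epsilon> * exp (- (L * T)))" by auto
    have "Hs_norm s (\<lambda>x. \<psi> x - \<phi> x) = norm (Hs_rep s \<psi> - r0)"
    proof (rule Hs_rep_unique(3))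
      show "(\<lambda>x. \<psi> x - \<phi> x) \<in> borel_measurable borel"
        using \<psi> \<phi> by (auto simp: in_Hs_def)
      show "AE x in lborel. \<psi> x - \<phi> x = U 0 (Hs_rep s \<psi> - r0) x"
        unfolding r0_def using in_Hs_U(1)[OF \<psi>] in_Hs_U(1)[OF \<phi>] by eventually_elim (simp add: U_diff)
      show "creflect (Hs_rep s \<psi> - r0) = Hs_rep s \<psi> - r0"
        by (simp add: r0_def creflect_diff in_Hs_U(2) \<phi> \<psi>)
    qed
    with close have d: "norm (Hs_rep s \<psi> - r0) < 1" "norm (Hs_rep s \<psi> - r0) < \<epsilon> * exp (- (L * T))" by auto
    have "norm (Hs_rep s \<psi>) \<le> norm r0 + 1"
      using d(1) norm_triangle_ineq2[of "Hs_rep s \<psi>" r0] by linarith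
    then obtain z where z: "continuous_on {0..T} z" "z 0 = Hs_rep s \<psi>" "\<And>t. t \<in> {0..T} \<Longrightarrow> norm (z t) \<le> R"
      and zd: "\<forall>t\<in>{0..T}. (z has_vector_derivative G (z t)) (at t within {0..T})"
      using ex by blast
    show "\<exists>v. is_solution s \<kappa> a1 mp mn (F 0) \<psi> T v \<and> (\<forall>t\<in>{0..T}. Hs_norm s (\<lambda>x. v t x - u t x) < \<epsilon>)"
    proof (intro exI[of _ "\<lambda>t. U 0 (z t)"] conjI ballI)
      show "is_solution s \<kappa> a1 mp mn (F 0) \<psi> T (\<lambda>t. U 0 (z t))"
        using z zd by (intro solution_of_trajectory T \<psi>) auto
      fix t assume t: "t \<in> {0..T}"
      have zh: "creflect (z t) = z t"
        using in_Hs_U(2)[OF \<psi>] z(2) by (intro trajectory_hermitian[OF z(1) inner[OF zd] _ t]) auto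
      have "Hs_norm s (\<lambda>x. U 0 (z t) x - u t x) = norm (z t - y t)"
        unfolding u_def by (rule Hs_rep_unique(3)) (auto simp: U_diff creflect_diff zh herm[OF t])
      also have "\<dots> \<le> norm (z 0 - y 0) * exp (L * t)"
        by (rule trajectory_distance[OF z(1) inner[OF zd] y(1) inner[OF yd] L z(3) y(3) t])
      also have "\<dots> \<le> norm (Hs_rep s \<psi> - r0) * exp (L * T)"
        unfolding z(2) y(2) using t L(1) by (intro mult_left_mono) (auto intro: mult_left_mono)
      also have "\<dots> < \<epsilon> * exp (- (L * T)) * exp (L * T)"
        by (intro mult_strict_right_mono d) simp
      also have "\<dots> = \<epsilon>"
        by (simp add: mult.assoc flip: exp_add)
      finally show "Hs_norm s (\<lambda>x. U 0 (z t) x - u t x) < \<epsilon>" .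
    qed
  qed
  have growth: "Hs_norm s (u t) \<le> Hs_norm s \<phi> * exp (\<Phi> M * t)"
    if M: "M = Sup ((\<lambda>t. Linf_norm (u t)) ` {0..T})" and t: "t \<in> {0..T}" for M t
  proof -
    have Uc: "continuous_on UNIV (u t)" for t
      unfolding u_def by (rule U_m_continuous) simp
    have Ub: "\<bar>u t x\<bar> \<le> cK * R" if "t \<in> {0..T}" for t x
      unfolding u_def using U_bound[OF le0, of "y t" x] mult_left_mono[OF y(3)[OF that] cK_nonneg] by linarith
    \<comment> \<open>\<open>Sup\<close> is an upper bound only for a set that is bounded above; the
      embedding on the ball of radius \<open>R\<close> supplies the bound.\<close>
    have "bdd_above ((\<lambda>t. Linf_norm (u t)) ` {0..T})"
      using Linf_norm_continuous(2)[OF Uc Ub] by (intro bdd_aboveI2[of _ _ "cK * R"]) auto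
    then have uM: "\<bar>U 0 (y t) x\<bar> \<le> M" if "t \<in> {0..T}" for t x
      using Linf_norm_continuous(1)[OF Uc Ub[OF that], of x] cSUP_upper[OF that] unfolding M u_def by fastforce
    have "norm (y t) \<le> norm (y 0) * exp (\<Phi> M * t)"
    proof (rule exp_growth[OF y(1) \<Phi>(1) inner[OF yd] _ t])
      fix r assume "0 < r" "r < T"
      then show "norm (G (y r)) \<le> \<Phi> M * norm (y r)"
        using uM by (intro \<Phi>(2)) auto
    qed
    moreover have "Hs_norm s (u t) = norm (y t)"
      unfolding u_def by (rule Hs_rep_unique(3)[OF _ _ herm[OF t]]) auto
    ultimately show ?thesis
      using y(2) Hs_norm_eq[OF \<phi>] by (simp add: r0_def)
  qed
  show ?thesis
    unfolding Let_def
    by (intro exI[of _ T] conjI exI[of _ u] T(1) sol allI impI ballI uniq dep growth refl)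
qed

end

text \<open>Rounding up gives \<open>\<lceil>s\<rceil> - 1 < s\<close> even for integer
  \<open>s\<close>, so \<open>m = \<lceil>s\<rceil> - 2\<close> satisfies both inequalities when
  \<open>s > 2\<close>; for \<open>s \<le> 2\<close> order 0 does.\<close>

lemma derivative_order:
  fixes s :: real
  assumes "s > 1 / 2"
  obtains m :: nat where "s - 2 \<le> real m" "m = 0 \<or> real m + 1 < s" "m \<le> nat \<lfloor>s\<rfloor>"
proof (cases "s \<le> 2")
  case True
  then show ?thesis by (intro that[of 0]) auto
next
  case False
  define m where "m = nat (\<lceil>s\<rceil> - 2)"
  have "2 \<le> \<lceil>s\<rceil>"
    using False by linarith
  then have m: "real m = of_int \<lceil>s\<rceil> - 2"
    by (simp add: m_def)
  show ?thesis
  proof (rule that[of m])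
    show "s - 2 \<le> real m" "m = 0 \<or> real m + 1 < s"
      unfolding m by linarith+
    show "m \<le> nat \<lfloor>s\<rfloor>"
      unfolding m_def by (rule nat_mono) linarith
  qed
qed

theorem theorem2p1:
  fixes \<kappa> s :: real and \<alpha> a1 a2 f :: "real \<Rightarrow> real" and mp mn :: "real measure"
  assumes "\<kappa> > 0"
    and C1: "W21_with \<alpha> a1 a2"
    and C2: "deriv_is_measure a2 mp mn"
    and "s > 1/2"
    and "C_n (nat \<lfloor>s\<rfloor> + 1) f" and "f 0 = 0"
  shows "\<exists>\<Phi> :: real \<Rightarrow> real. \<forall>\<phi>. in_Hs s \<phi> \<longrightarrow>
     (\<exists>T>0. \<exists>u.
        is_solution s \<kappa> a1 mp mn f \<phi> T u
      \<and> (\<forall>v. is_solution s \<kappa> a1 mp mn f \<phi> T v \<longrightarrow>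
            (\<forall>t\<in>{0..T}. AE x in lborel. v t x = u t x))
      \<and> (\<forall>\<epsilon>>0. \<exists>\<delta>>0. \<forall>\<psi>. in_Hs s \<psi> \<and> Hs_norm s (\<lambda>x. \<psi> x - \<phi> x) < \<delta> \<longrightarrow>
            (\<exists>v. is_solution s \<kappa> a1 mp mn f \<psi> T v \<and>
                 (\<forall>t\<in>{0..T}. Hs_norm s (\<lambda>x. v t x - u t x) < \<epsilon>)))
      \<and> (let M = Sup ((\<lambda>t. Linf_norm (u t)) ` {0..T}) in
           \<forall>t\<in>{0..T}. Hs_norm s (u t) \<le> Hs_norm s \<phi> * exp (\<Phi> M * t)))"
proof -
  obtain m where m: "s - 2 \<le> real m" "m = 0 \<or> real m + 1 < s" "m \<le> nat \<lfloor>s\<rfloor>"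
    using derivative_order[OF assms(4)] by blast
  define F where "F i = (deriv ^^ i) f" for i
  have d: "(F i has_real_derivative F (Suc i) y) (at y)" if "i \<le> nat \<lfloor>s\<rfloor>" for i y
    using assms(5) that by (auto simp: F_def C_n_def DERIV_deriv_iff_real_differentiable)
  have "continuous_on UNIV (F (Suc m))"
  \<comment> \<open>Equality occurs only for \<open>s < 1\<close>, and then \<open>F (Suc m)\<close>
    is the top derivative, which is assumed continuous; otherwise it is differentiable.\<close>
  proof (cases "m = nat \<lfloor>s\<rfloor>")
    case True
    then show ?thesis using assms(5) by (simp add: F_def C_n_def)
  next
    case False
    then show ?thesis
      using d[of "Suc m"] m(3) by (intro continuous_at_imp_continuous_on ballI DERIV_isCont) auto
  qed
  then interpret ivp s m F a1 a2 mp mn \<kappa>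
    using assms m d C1 C2 by unfold_locales (auto simp: F_def W21_with_def)
  \<comment> \<open>A constant is chosen for every \<open>M\<close> at this point, before any datum
    is given, so \<open>\<Phi>\<close> cannot depend on it.\<close>
  obtain \<Phi> where \<Phi>: "\<And>M. \<Phi> M \<ge> 0" "\<And>M w. (\<forall>x. \<bar>U 0 w x\<bar> \<le> M) \<Longrightarrow> norm (G w) \<le> \<Phi> M * norm w"
    using G_growth by metis
  have F0: "F 0 = f"
    by (simp add: F_def)
  show ?thesis
    by (intro exI[of _ \<Phi>] allI impI) (rule local_well_posedness[of \<Phi>, OF \<Phi>, unfolded F0])
qed

end
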